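(* Let $P$ be a finite $d$-complete poset with $d$-complete coloring $c:P\to I$ and let $F$ be an order filter of $P$. Let $\boldsymbol a=(a_i)_{i\in I}$ be indeterminates. Put $a(p)=a_{c(p)}$ for $p\in P$ and define a linear polynomial $\boldsymbol a\langle H_P(u)\rangle$ for $u\in P$ as follows: (i) if $u$ is not the top of any $d_k$-interval, then $\boldsymbol a\langle H_P(u)\rangle=\sum_{w\le u}a_{c(w)}$; (ii) if $u$ is the top of a $d_k$-interval $[v,u]$ with sides $x$ and $y$, then $\boldsymbol a\langle H_P(u)\rangle=\boldsymbol a\langle H_P(x)\rangle+\boldsymbol a\langle H_P(y)\rangle-\boldsymbol a\langle H_P(v)\rangle$. Then $$\sum_{(q_1,\dots,q_n)}\frac{1}{a(q_1)\,(a(q_1)+a(q_2))\cdots(a(q_1)+\cdots+a(q_n))}=\sum_{D\in\mathcal E_P(F)}\ \prod_{v\in P\setminus D}\frac{1}{\boldsymbol a\langle H_P(v)\rangle},$$ where $n=\#(P\setminus F)$ and the sum on the left is over all linear extensions of $P\setminus F$, i.e. all labelings of the elements of $P\setminus F$ with $q_1,\dots,q_n$ such that $q_i<q_j$ in $P\setminus F$ implies $i<j$.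
   Context: **$d$-complete posets.** For $k\ge 3$, the double-tailed diamond $d_k(1)$ is the poset on $2k-2$ elements $u_1,\dots,u_{k-2},x,y,v_{k-2},\dots,v_1$ with covering relations $u_1\gtrdot u_2\gtrdot\cdots\gtrdot u_{k-2}$, $u_{k-2}\gtrdot x\gtrdot v_{k-2}$, $u_{k-2}\gtrdot y\gtrdot v_{k-2}$, $v_{k-2}\gtrdot\cdots\gtrdot v_1$ ($a\gtrdot b$ means $a$ covers $b$). In a poset $P$, an interval $[v,u]=\{x\in P: v\le x\le u\}$ is a $d_k$-interval if it is isomorphic to $d_k(1)$; then $v$, $u$ are its bottom and top, and its two incomparable elements are its sides. A convex subset of $P$ is a $d_k^-$-convex set if it is isomorphic to $d_k(1)$ with its top element removed. $P$ is $d$-complete if for every $k\ge3$: (D1) if $I$ is a $d_k^-$-convex set, there is an element $u$ such that $u$ covers the maximal elements of $I$ and $I\cup\{u\}$ is a $d_k$-interval; (D2) if $I=[v,u]$ is a $d_k$-interval and $u$ covers $u'$ in $P$, then $u'\in I$; (D3) there are no $d_k^-$-convex sets which differ only in the minimal elements. In a $d$-complete poset, an element is the top of at most one $d_k$-interval (over all $k$). **Coloring.** The top forest $\Gamma$ of $P$ is the full subgraph of the Hasse diagram on all $x\in P$ such that every $y\ge x$ is covered by at most one other element. Let $I$ be a set with $\#I=\#\Gamma$ and fix a bijection $c:\Gamma\to I$ (we identify nodes of $\Gamma$ with $I$). It is known that $c$ extends uniquely to a map $c:P\to I$, the $d$-complete coloring, such that: incomparable elements have different colors; if an interval is a chain then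 its elements have distinct colors; if $[v,u]$ is a $d_k$-interval then $c(v)=c(u)$. **Excited diagrams.** An order filter of $P$ is a subset $F$ such that $x<y$ and $x\in F$ imply $y\in F$. For $i\in I$ let $N_i$ be the set of $x\in P$ whose color $c(x)$ is adjacent to $i$ in $\Gamma$. For $D\subset P$ and $u\in D$, $u$ is $D$-active if there is $v\in P\setminus D$ with $v<u$, $c(v)=c(u)$, $[v,u]$ a $d_k$-interval for some $k$, and $[v,u]\cap D\cap N_{c(u)}=\emptyset$. In that case put $\alpha_u(D)=(D\setminus\{u\})\cup\{v\}$ (an elementary excitation). $\mathcal E_P(F)$ is the set of subsets of $P$ obtained from $F$ by finite (possibly empty) sequences of elementary excitations; its elements are the excited diagrams of $F$ in $P$. *)

theory Defs
  imports
    Complex_Main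
    "HOL-Library.Poly_Mapping"
    "HOL-Computational_Algebra.Fraction_Field"
begin

text \<open>A poset is a carrier set \<open>P\<close> inside a type of class \<open>order\<close>, with the induced order; it may be
  empty, and the type may be infinite. All order notions are relative to \<open>P\<close>.\<close>

section \<open>Posets\<close>

definition covers :: "'a::order set \<Rightarrow> 'a \<Rightarrow> 'a \<Rightarrow> bool" where
  "covers P a b \<longleftrightarrow> a \<in> P \<and> b \<in> P \<and> b < a \<and> \<not> (\<exists>z\<in>P. b < z \<and> z < a)"

definition interval :: "'a::order set \<Rightarrow> 'a \<Rightarrow> 'a \<Rightarrow> 'a set" where
  "interval P v u = {z \<in> P. v \<le> z \<and> z \<le> u}"

definition convex_in :: "'a::order set \<Rightarrow> 'a set \<Rightarrow> bool" where
  "convex_in P S \<longleftrightarrow> S \<subseteq> P \<and> (\<forall>a\<in>S. \<forall>b\<in>S. \<forall>z\<in>P. a \<le> z \<and> z \<le> b \<longrightarrow> z \<in> S)"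

definition order_filter :: "'a::order set \<Rightarrow> 'a set \<Rightarrow> bool" where
  "order_filter P F \<longleftrightarrow> F \<subseteq> P \<and> (\<forall>x\<in>F. \<forall>y\<in>P. x < y \<longrightarrow> y \<in> F)"

definition maximals :: "'a::order set \<Rightarrow> 'a set" where
  "maximals S = {m \<in> S. \<forall>z\<in>S. m \<le> z \<longrightarrow> z = m}"

definition minimals :: "'a::order set \<Rightarrow> 'a set" where
  "minimals S = {m \<in> S. \<forall>z\<in>S. z \<le> m \<longrightarrow> z = m}"


section \<open>Double-tailed diamonds and \<open>d\<close>-complete posets\<close>

datatype dtd_elem = DU nat | DX | DY | DV nat

definition dtd :: "nat \<Rightarrow> dtd_elem set" where
  "dtd k = DU ` {1..k-2} \<union> {DX, DY} \<union> DV ` {1..k-2}"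

text \<open>\<open>DU i\<close>, \<open>DX\<close>, \<open>DY\<close>, \<open>DV i\<close> stand for \<open>u\<^sub>i\<close>, \<open>x\<close>, \<open>y\<close>, \<open>v\<^sub>i\<close>; in particular \<open>DU 1\<close> is the top.
  \<open>dtd_covered k a b\<close>: the element \<open>b\<close> covers \<open>a\<close> in the double-tailed diamond
  with parameter \<open>k\<close>.\<close>

inductive dtd_covered :: "nat \<Rightarrow> dtd_elem \<Rightarrow> dtd_elem \<Rightarrow> bool" for k :: nat where
  "1 \<le> i \<Longrightarrow> i < k - 2 \<Longrightarrow> dtd_covered k (DU (Suc i)) (DU i)"
| "dtd_covered k DX (DU (k - 2))"
| "dtd_covered k DY (DU (k - 2))"
| "dtd_covered k (DV (k - 2)) DX"
| "dtd_covered k (DV (k - 2)) DY"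
| "1 \<le> i \<Longrightarrow> i < k - 2 \<Longrightarrow> dtd_covered k (DV i) (DV (Suc i))"

definition dtd_le :: "nat \<Rightarrow> dtd_elem \<Rightarrow> dtd_elem \<Rightarrow> bool" where
  "dtd_le k = (dtd_covered k)\<^sup>*\<^sup>*"

definition dtd_iso :: "nat \<Rightarrow> dtd_elem set \<Rightarrow> 'a::order set \<Rightarrow> bool" where
  "dtd_iso k A S \<longleftrightarrow>
     (\<exists>f. bij_betw f A S \<and> (\<forall>p\<in>A. \<forall>q\<in>A. dtd_le k p q \<longleftrightarrow> f p \<le> f q))"

definition dk_interval :: "'a::order set \<Rightarrow> nat \<Rightarrow> 'a \<Rightarrow> 'a \<Rightarrow> bool" where
  "dk_interval P k v u \<longleftrightarrow>
     3 \<le> k \<and> v \<in> P \<and> u \<in> P \<and> dtd_iso k (dtd k) (interval P v u)"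

definition dk_minus_convex :: "'a::order set \<Rightarrow> nat \<Rightarrow> 'a set \<Rightarrow> bool" where
  "dk_minus_convex P k S \<longleftrightarrow>
     3 \<le> k \<and> convex_in P S \<and> dtd_iso k (dtd k - {DU 1}) S"

text \<open>\<open>dk_sides P v u x y\<close>: \<open>[v,u]\<close> is a \<open>d\<^sub>k\<close>-interval for some \<open>k\<close>, with sides \<open>x\<close> and \<open>y\<close>.\<close>

definition dk_sides :: "'a::order set \<Rightarrow> 'a \<Rightarrow> 'a \<Rightarrow> 'a \<Rightarrow> 'a \<Rightarrow> bool" where
  "dk_sides P v u x y \<longleftrightarrow>
     (\<exists>k. dk_interval P k v u) \<and> x \<in> interval P v u \<and> y \<in> interval P v u
       \<and> \<not> x \<le> y \<and> \<not> y \<le> x"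

definition dk_top :: "'a::order set \<Rightarrow> 'a \<Rightarrow> bool" where
  "dk_top P u \<longleftrightarrow> (\<exists>k v. dk_interval P k v u)"

definition d_complete :: "'a::order set \<Rightarrow> bool" where
  "d_complete P \<longleftrightarrow> (\<forall>k\<ge>3.
     (\<forall>S. dk_minus_convex P k S \<longrightarrow>
        (\<exists>u\<in>P. (\<forall>m\<in>maximals S. covers P u m) \<and>
           (\<exists>v w. dk_interval P k v w \<and> insert u S = interval P v w))) \<and>
     (\<forall>v u u'. dk_interval P k v u \<and> covers P u u' \<longrightarrow> u' \<in> interval P v u) \<and>
     \<not> (\<exists>S T. dk_minus_convex P k S \<and> dk_minus_convex P k T \<and> S \<noteq> T \<and>
           S - minimals S = T - minimals T))"


section \<open>Top forest and coloring\<close>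

definition top_forest :: "'a::order set \<Rightarrow> 'a set" where
  "top_forest P = {x \<in> P. \<forall>y\<in>P. x \<le> y \<longrightarrow>
     (\<forall>z z'. covers P z y \<and> covers P z' y \<longrightarrow> z = z')}"

definition top_forest_adj :: "'a::order set \<Rightarrow> 'a \<Rightarrow> 'a \<Rightarrow> bool" where
  "top_forest_adj P x y \<longleftrightarrow>
     x \<in> top_forest P \<and> y \<in> top_forest P \<and> (covers P x y \<or> covers P y x)"

text \<open>\<open>I\<close> is the set of colors; \<open>c\<close> restricts to the identification of the top forest with \<open>I\<close>.\<close>

definition d_coloring :: "'a::order set \<Rightarrow> 'i set \<Rightarrow> ('a \<Rightarrow> 'i) \<Rightarrow> bool" where
  "d_coloring P I c \<longleftrightarrow>
     c ` P \<subseteq> I \<and> bij_betw c (top_forest P) I \<and>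
     (\<forall>x\<in>P. \<forall>y\<in>P. \<not> x \<le> y \<and> \<not> y \<le> x \<longrightarrow> c x \<noteq> c y) \<and>
     (\<forall>v\<in>P. \<forall>u\<in>P. (\<forall>x\<in>interval P v u. \<forall>y\<in>interval P v u. x \<le> y \<or> y \<le> x)
        \<longrightarrow> inj_on c (interval P v u)) \<and>
     (\<forall>k v u. dk_interval P k v u \<longrightarrow> c v = c u)"

definition color_adj :: "'a::order set \<Rightarrow> ('a \<Rightarrow> 'i) \<Rightarrow> 'i \<Rightarrow> 'i \<Rightarrow> bool" where
  "color_adj P c i j \<longleftrightarrow> (\<exists>x y. top_forest_adj P x y \<and> c x = i \<and> c y = j)"

definition color_nbrs :: "'a::order set \<Rightarrow> ('a \<Rightarrow> 'i) \<Rightarrow> 'i \<Rightarrow> 'a set" where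
  "color_nbrs P c i = {x \<in> P. color_adj P c (c x) i}"


section \<open>Excited diagrams\<close>

text \<open>\<open>excitation P c D D'\<close>: \<open>D' = \<alpha>\<^sub>u(D)\<close> for some \<open>D\<close>-active \<open>u\<close>.\<close>

definition excitation :: "'a::order set \<Rightarrow> ('a \<Rightarrow> 'i) \<Rightarrow> 'a set \<Rightarrow> 'a set \<Rightarrow> bool" where
  "excitation P c D D' \<longleftrightarrow> (\<exists>u\<in>D. \<exists>v\<in>P - D.
     v < u \<and> c v = c u \<and> (\<exists>k. dk_interval P k v u) \<and>
     interval P v u \<inter> D \<inter> color_nbrs P c (c u) = {} \<and>
     D' = insert v (D - {u}))"

definition excited_diagrams :: "'a::order set \<Rightarrow> ('a \<Rightarrow> 'i) \<Rightarrow> 'a set \<Rightarrow> 'a set set" where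
  "excited_diagrams P c F = {D. (excitation P c)\<^sup>*\<^sup>* F D}"


section \<open>Linear extensions\<close>

definition linear_extensions :: "'a::order set \<Rightarrow> 'a list set" where
  "linear_extensions S = {qs. set qs = S \<and> distinct qs \<and>
     (\<forall>i<length qs. \<forall>j<length qs. qs ! i < qs ! j \<longrightarrow> i < j)}"


section \<open>Indeterminates and hook polynomials\<close>

text \<open>Polynomials over the rationals in indeterminates indexed by \<open>'i\<close>, and the field of rational
  functions. The class \<open>linorder\<close> on \<open>'i\<close> is only there because the library derives integrality
  of this polynomial ring from it.\<close>

type_synonym 'i mpoly = "('i \<Rightarrow>\<^sub>0 nat) \<Rightarrow>\<^sub>0 rat"
type_synonym 'i ratfun = "'i mpoly fract"

definition indet :: "'i::linorder \<Rightarrow> 'i mpoly" where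
  "indet i = Poly_Mapping.single (Poly_Mapping.single i 1) 1"

definition to_ratfun :: "'i::linorder mpoly \<Rightarrow> 'i ratfun" where
  "to_ratfun p = Fract p 1"

inductive is_hook_poly ::
  "'a::order set \<Rightarrow> ('a \<Rightarrow> 'i::linorder) \<Rightarrow> 'a \<Rightarrow> 'i mpoly \<Rightarrow> bool" for P c where
  not_top: "u \<in> P \<Longrightarrow> \<not> dk_top P u \<Longrightarrow>
     is_hook_poly P c u (\<Sum>w\<in>{w \<in> P. w \<le> u}. indet (c w))"
| top: "dk_sides P v u x y \<Longrightarrow> is_hook_poly P c x hx \<Longrightarrow> is_hook_poly P c y hy \<Longrightarrow>
     is_hook_poly P c v hv \<Longrightarrow> is_hook_poly P c u (hx + hy - hv)"

text \<open>In a finite \<open>d\<close>-complete poset the polynomial below exists and is unique: see \<open>is_hook_poly_ex1\<close>,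
  and \<open>hook_poly_not_top\<close>, \<open>hook_poly_top\<close> for the recursion.\<close>

definition hook_poly :: "'a::order set \<Rightarrow> ('a \<Rightarrow> 'i::linorder) \<Rightarrow> 'a \<Rightarrow> 'i mpoly" where
  "hook_poly P c u = (THE h. is_hook_poly P c u h)"


section \<open>Well-definedness of the hook polynomials\<close>

fun dtd_rank :: "nat \<Rightarrow> dtd_elem \<Rightarrow> nat" where
  "dtd_rank k (DV i) = i"
| "dtd_rank k DX = k - 1"
| "dtd_rank k DY = k - 1"
| "dtd_rank k (DU i) = 2 * k - 2 - i"

lemma dtd_covered_rank: "dtd_covered k a b \<Longrightarrow> 3 \<le> k \<Longrightarrow> dtd_rank k a < dtd_rank k b"
  by (induction rule: dtd_covered.induct) auto

lemma dtd_le_rank: 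
  assumes "dtd_le k a b" "3 \<le> k" shows "a = b \<or> dtd_rank k a < dtd_rank k b"
  using assms(1) unfolding dtd_le_def
proof (induction rule: rtranclp_induct)
  case (step y z)
  then show ?case using dtd_covered_rank[OF step(2) assms(2)] by auto
qed simp

lemma dtd_le_trans: "dtd_le k a b \<Longrightarrow> dtd_le k b d \<Longrightarrow> dtd_le k a d"
  unfolding dtd_le_def by (rule rtranclp_trans)

lemma dtd_le_U: "1 \<le> i \<Longrightarrow> i \<le> j \<Longrightarrow> j \<le> k - 2 \<Longrightarrow> dtd_le k (DU j) (DU i)"
proof (induction j)
  case (Suc j)
  show ?case
  proof (cases "i = Suc j")
    case True then show ?thesis by (simp add: dtd_le_def)
  next
    case False
    then have "dtd_covered k (DU (Suc j)) (DU j)" using Suc by (intro dtd_covered.intros) auto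
    moreover have "dtd_le k (DU j) (DU i)" using Suc False by auto
    ultimately show ?thesis unfolding dtd_le_def by (rule converse_rtranclp_into_rtranclp)
  qed
qed simp

lemma dtd_le_V: "1 \<le> i \<Longrightarrow> i \<le> j \<Longrightarrow> j \<le> k - 2 \<Longrightarrow> dtd_le k (DV i) (DV j)"
proof (induction j)
  case (Suc j)
  show ?case
  proof (cases "i = Suc j")
    case True then show ?thesis by (simp add: dtd_le_def)
  next
    case False
    then have "dtd_covered k (DV j) (DV (Suc j))" using Suc by (intro dtd_covered.intros) auto
    moreover have "dtd_le k (DV i) (DV j)" using Suc False by auto
    ultimately show ?thesis unfolding dtd_le_def by (meson rtranclp.rtrancl_into_rtrancl)
  qed
qed simp

lemma dtd_le_XYU:
  assumes "1 \<le> i" "i \<le> k - 2" "p \<in> {DX, DY}" shows "dtd_le k p (DU i)"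
proof -
  have "dtd_covered k p (DU (k - 2))" using assms(3) by (auto intro: dtd_covered.intros)
  moreover have "dtd_le k (DU (k - 2)) (DU i)" using assms by (intro dtd_le_U) auto
  ultimately show ?thesis unfolding dtd_le_def by (rule converse_rtranclp_into_rtranclp)
qed

lemma dtd_le_VXY:
  assumes "1 \<le> i" "i \<le> k - 2" "p \<in> {DX, DY}" shows "dtd_le k (DV i) p"
proof -
  have "dtd_covered k (DV (k - 2)) p" using assms(3) by (auto intro: dtd_covered.intros)
  moreover have "dtd_le k (DV i) (DV (k - 2))" using assms by (intro dtd_le_V) auto
  ultimately show ?thesis unfolding dtd_le_def by (meson rtranclp.rtrancl_into_rtrancl)
qed

lemma dtd_le_iff:
  assumes "3 \<le> k" "p \<in> dtd k" "q \<in> dtd k"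
  shows "dtd_le k p q \<longleftrightarrow> p = q \<or> dtd_rank k p < dtd_rank k q"
proof
  assume "dtd_le k p q" then show "p = q \<or> dtd_rank k p < dtd_rank k q"
    using assms(1) by (rule dtd_le_rank)
next
  have XU: "dtd_le k p (DU i)" if "1 \<le> i" "i \<le> k - 2" "p \<in> {DX, DY}" for p i
    using that by (rule dtd_le_XYU)
  have VX: "dtd_le k (DV i) p" if "1 \<le> i" "i \<le> k - 2" "p \<in> {DX, DY}" for p i
    using that by (rule dtd_le_VXY)
  have VU: "dtd_le k (DV i) (DU j)" if "1 \<le> i" "i \<le> k - 2" "1 \<le> j" "j \<le> k - 2" for i j
    using VX[of i DX] XU[of j DX] that dtd_le_trans by blast
  assume r: "p = q \<or> dtd_rank k p < dtd_rank k q"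
  show "dtd_le k p q"
  proof (cases "p = q")
    case True then show ?thesis by (simp add: dtd_le_def)
  next
    case False
    with r have "dtd_rank k p < dtd_rank k q" by simp
    then show ?thesis using assms
      by (cases p; cases q) (auto simp: dtd_def intro: XU VX VU dtd_le_U dtd_le_V)
  qed
qed

lemma dtd_rank_bounds:
  assumes "3 \<le> k" "p \<in> dtd k"
  shows "p = DU 1 \<or> dtd_rank k p < dtd_rank k (DU 1)" "p = DV 1 \<or> dtd_rank k (DV 1) < dtd_rank k p"
  using assms by (auto simp: dtd_def)

definition dtd_iso_by :: "nat \<Rightarrow> (dtd_elem \<Rightarrow> 'a::order) \<Rightarrow> 'a set \<Rightarrow> bool" where
  "dtd_iso_by k f S \<longleftrightarrow> bij_betw f (dtd k) S \<and>
     (\<forall>p\<in>dtd k. \<forall>q\<in>dtd k. f p \<le> f q \<longleftrightarrow> p = q \<or> dtd_rank k p < dtd_rank k q)"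

lemma dtd_iso_by_less:
  assumes "dtd_iso_by k f S" "p \<in> dtd k" "q \<in> dtd k"
  shows "f p < f q \<longleftrightarrow> dtd_rank k p < dtd_rank k q"
  using assms unfolding dtd_iso_by_def less_le_not_le by (metis nat_neq_iff order_less_irrefl)

lemma dtd_corners [simp]: "3 \<le> k \<Longrightarrow> DU 1 \<in> dtd k" "3 \<le> k \<Longrightarrow> DV 1 \<in> dtd k"
  "3 \<le> k \<Longrightarrow> DU (Suc 0) \<in> dtd k" "3 \<le> k \<Longrightarrow> DV (Suc 0) \<in> dtd k" "DX \<in> dtd k" "DY \<in> dtd k"
  by (auto simp: dtd_def)

lemma dk_interval_iff:
  "dk_interval P k v u \<longleftrightarrow> 3 \<le> k \<and> v \<in> P \<and> u \<in> P \<and>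
     (\<exists>f. dtd_iso_by k f (interval P v u) \<and> f (DU 1) = u \<and> f (DV 1) = v)" (is "?L \<longleftrightarrow> ?R")
proof
  assume L: ?L
  then have k: "3 \<le> k" and v: "v \<in> P" and u: "u \<in> P" by (auto simp: dk_interval_def)
  obtain f where bij: "bij_betw f (dtd k) (interval P v u)"
    and le: "\<forall>p\<in>dtd k. \<forall>q\<in>dtd k. dtd_le k p q \<longleftrightarrow> f p \<le> f q"
    using L by (auto simp: dk_interval_def dtd_iso_def)
  have f: "dtd_iso_by k f (interval P v u)"
    unfolding dtd_iso_by_def using bij le dtd_le_iff[OF k] by blast
  have "f (DU 1) \<in> interval P v u" using bij k by (meson bij_betwE dtd_corners)
  then have vu: "v \<in> interval P v u" "u \<in> interval P v u" using u v by (auto simp: interval_def)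
  then obtain p q where p: "p \<in> dtd k" "f p = v" and q: "q \<in> dtd k" "f q = u"
    using bij unfolding bij_betw_def by (metis imageE)
  have "f q \<le> f (DU 1)" "f (DV 1) \<le> f p"
    using f k p q dtd_rank_bounds[OF k] unfolding dtd_iso_by_def by (metis dtd_corners(1,2))+
  moreover have "f (DU 1) \<le> u" "v \<le> f (DV 1)"
    using bij_betwE[OF bij] dtd_corners(1,2)[OF k] unfolding interval_def by blast+
  ultimately show ?R using k u v f p q by (metis order_antisym)
next
  assume R: ?R
  then show ?L unfolding dk_interval_def dtd_iso_def dtd_iso_by_def
    using dtd_le_iff by blast
qed

lemma dk_sides_iff:
  assumes k: "3 \<le> k" and f: "dtd_iso_by k f S" and "x \<in> S" "y \<in> S"
  shows "\<not> x \<le> y \<and> \<not> y \<le> x \<longleftrightarrow> (x = f DX \<and> y = f DY) \<or> (x = f DY \<and> y = f DX)"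
proof -
  obtain p q where p: "p \<in> dtd k" "f p = x" and q: "q \<in> dtd k" "f q = y"
    using assms unfolding dtd_iso_by_def bij_betw_def by blast
  have inj: "inj_on f (dtd k)" using f by (auto simp: dtd_iso_by_def bij_betw_def)
  have "\<not> x \<le> y \<and> \<not> y \<le> x \<longleftrightarrow> p \<noteq> q \<and> dtd_rank k p = dtd_rank k q"
    using f p q unfolding dtd_iso_by_def by auto
  also have "\<dots> \<longleftrightarrow> (p = DX \<and> q = DY) \<or> (p = DY \<and> q = DX)"
    using p(1) q(1) k by (auto simp: dtd_def)
  also have "\<dots> \<longleftrightarrow> (x = f DX \<and> y = f DY) \<or> (x = f DY \<and> y = f DX)"
    using p q inj by (metis dtd_corners(5,6) inj_onD)
  finally show ?thesis .
qed

lemma dk_sides_below: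
  assumes "dk_sides P v u x y"
  shows "v < u" "x < u" "y < u" "v \<in> P" "u \<in> P" "x \<in> P" "y \<in> P"
proof -
  from assms have i: "x \<in> interval P v u" "y \<in> interval P v u" "\<not> x \<le> y" "\<not> y \<le> x" "v \<in> P" "u \<in> P"
    by (auto simp: dk_sides_def dk_interval_def)
  then show "v < u" "x < u" "y < u" "v \<in> P" "u \<in> P" "x \<in> P" "y \<in> P"
    unfolding interval_def by (auto simp: order_less_le)
qed

lemma dk_interval_sides_exist:
  assumes "dk_interval P k v u" shows "\<exists>x y. dk_sides P v u x y"
proof -
  from assms obtain f where f: "3 \<le> k" "dtd_iso_by k f (interval P v u)"
    unfolding dk_interval_iff by blast
  then have "f DX \<in> interval P v u" "f DY \<in> interval P v u"
    unfolding dtd_iso_by_def by (meson bij_betwE dtd_corners)+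
  then show ?thesis using assms dk_sides_iff[OF f] unfolding dk_sides_def by blast
qed

text \<open>Removing top and bottom of a \<open>d\<^sub>k\<close>-interval, \<open>k \<ge> 4\<close>, leaves a \<open>d\<^sub>k\<^sub>-\<^sub>1\<close>-interval.\<close>

lemma dk_interval_inner:
  assumes I: "dk_interval P (Suc k) v u" and k: "3 \<le> k"
  shows "\<exists>v' u'. dk_interval P k v' u' \<and> interval P v u - {u, v} = interval P v' u' \<and>
    covers P u u' \<and> covers P v' v"
proof -
  obtain f where f: "dtd_iso_by (Suc k) f (interval P v u)" and fu: "f (DU 1) = u" and fv: "f (DV 1) = v"
    and uv: "v \<in> P" "u \<in> P"
    using I unfolding dk_interval_iff by blast
  define g where "g p = (case p of DU i \<Rightarrow> DU (Suc i) | DV i \<Rightarrow> DV (Suc i) | _ \<Rightarrow> p)" for p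
  have g_rank: "dtd_rank (Suc k) (g p) = Suc (dtd_rank k p)" if "p \<in> dtd k" for p
    using that k by (auto simp: g_def dtd_def)
  have g_inj: "inj g" by (auto simp: inj_def g_def split: dtd_elem.splits)
  have im: "g ` dtd k = dtd (Suc k) - {DU 1, DV 1}"
  proof -
    have 0: "(\<lambda>x. e (Suc x)) ` {Suc 0..m} = e ` {Suc (Suc 0)..Suc m}"
      for e :: "nat \<Rightarrow> dtd_elem" and m
      by (simp only: image_Suc_atLeastAtMost[symmetric] image_image)
    have 1: "g ` dtd k = DU ` {Suc 1..Suc (k - 2)} \<union> {DX, DY} \<union> DV ` {Suc 1..Suc (k - 2)}"
      by (simp add: dtd_def g_def image_Un image_image 0)
    show ?thesis unfolding 1 using k by (auto simp: dtd_def image_iff)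
  qed
  have bij: "bij_betw f (dtd (Suc k)) (interval P v u)" using f by (simp add: dtd_iso_by_def)
  have inj: "inj_on f (dtd (Suc k))" using bij by (simp add: bij_betw_def)
  have S: "interval P v u - {u, v} = f ` g ` dtd k"
    using bij k inj_on_image_set_diff[OF inj, of "dtd (Suc k)" "{DU 1, DV 1}"] fu fv
    unfolding im bij_betw_def by auto
  have gD: "g p \<in> dtd (Suc k)" if "p \<in> dtd k" for p using im that by blast
  have h: "dtd_iso_by k (f \<circ> g) (interval P v u - {u, v})"
    unfolding dtd_iso_by_def
  proof (intro conjI ballI)
    show "bij_betw (f \<circ> g) (dtd k) (interval P v u - {u, v})"
      unfolding bij_betw_def S image_comp
      using comp_inj_on[of g "dtd k" f] g_inj inj gD
      by (metis image_comp image_subsetI inj_on_subset subset_UNIV)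
    fix p q assume pq: "p \<in> dtd k" "q \<in> dtd k"
    have "f (g p) \<le> f (g q) \<longleftrightarrow> g p = g q \<or> dtd_rank (Suc k) (g p) < dtd_rank (Suc k) (g q)"
      using f gD pq unfolding dtd_iso_by_def by blast
    then show "((f \<circ> g) p \<le> (f \<circ> g) q) = (p = q \<or> dtd_rank k p < dtd_rank k q)"
      using g_rank pq g_inj by (simp add: inj_eq)
  qed
  define u' where "u' = f (g (DU 1))"
  define v' where "v' = f (g (DV 1))"
  have mem: "u' \<in> interval P v u - {u, v}" "v' \<in> interval P v u - {u, v}"
    using S k by (auto simp: u'_def v'_def)
  have bd: "z \<le> u' \<and> v' \<le> z" if "z \<in> interval P v u - {u, v}" for z
  proof -
    have "z \<in> f ` g ` dtd k" using that S by simp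
    then obtain p where p: "p \<in> dtd k" "z = (f \<circ> g) p" by auto
    have "(f \<circ> g) p \<le> (f \<circ> g) (DU 1)" "(f \<circ> g) (DV 1) \<le> (f \<circ> g) p"
      using h dtd_rank_bounds[OF k p(1)] k p(1) unfolding dtd_iso_by_def by (metis dtd_corners(1,2))+
    then show ?thesis using p by (simp add: u'_def v'_def)
  qed
  have eq: "interval P v u - {u, v} = interval P v' u'"
  proof
    show "interval P v u - {u, v} \<subseteq> interval P v' u'" using bd by (auto simp: interval_def)
    show "interval P v' u' \<subseteq> interval P v u - {u, v}"
      using mem unfolding interval_def by (auto intro: order_trans)
  qed
  have "dk_interval P k v' u'"
    unfolding dk_interval_iff using k mem h eq by (auto simp: interval_def u'_def v'_def)
  moreover have "covers P u u'"
    unfolding covers_def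
  proof (intro conjI)
    show "\<not> (\<exists>z\<in>P. u' < z \<and> z < u)"
    proof
      assume "\<exists>z\<in>P. u' < z \<and> z < u"
      then obtain z where z: "z \<in> P" "u' < z" "z < u" by blast
      then have "z \<in> interval P v u - {u, v}" using mem by (auto simp: interval_def)
      then show False using bd z by fastforce
    qed
  qed (use mem uv in \<open>auto simp: interval_def\<close>)
  moreover have "covers P v' v"
    unfolding covers_def
  proof (intro conjI)
    show "\<not> (\<exists>z\<in>P. v < z \<and> z < v')"
    proof
      assume "\<exists>z\<in>P. v < z \<and> z < v'"
      then obtain z where z: "z \<in> P" "v < z" "z < v'" by blast
      then have "z \<in> interval P v u - {u, v}" using mem by (auto simp: interval_def)
      then show False using bd z by fastforce
    qed
  qed (use mem uv in \<open>auto simp: interval_def\<close>)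
  ultimately show ?thesis using eq by blast
qed

lemma dk_interval_covers_in:
  "d_complete P \<Longrightarrow> dk_interval P k v u \<Longrightarrow> covers P u u' \<Longrightarrow> u' \<in> interval P v u"
  unfolding d_complete_def dk_interval_def by blast

lemma d3_interval_covers:
  assumes I: "dk_interval P 3 v u"
  shows "\<exists>x y. x \<noteq> y \<and> interval P v u - {u, v} = {x, y} \<and> covers P u x \<and> covers P u y"
proof -
  obtain f where f: "dtd_iso_by 3 f (interval P v u)" and fu: "f (DU 1) = u" and fv: "f (DV 1) = v"
    and uv: "v \<in> P" "u \<in> P"
    using I unfolding dk_interval_iff by blast
  have d: "dtd 3 = {DU 1, DX, DY, DV 1}" by (auto simp: dtd_def)
  have S: "interval P v u = {u, f DX, f DY, v}"
    using f fu fv unfolding dtd_iso_by_def bij_betw_def d by auto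
  have le: "f p \<le> f q \<longleftrightarrow> p = q \<or> dtd_rank 3 p < dtd_rank 3 q" if "p \<in> dtd 3" "q \<in> dtd 3" for p q
    using f that by (auto simp: dtd_iso_by_def)
  have r: "f DX < u" "f DY < u" "v < f DX" "v < f DY" "\<not> f DX \<le> f DY" "\<not> f DY \<le> f DX" "v < u"
    unfolding fu[symmetric] fv[symmetric] using le by (auto simp: less_le_not_le d)
  have XY: "f DX \<in> P" "f DY \<in> P" using S unfolding interval_def by auto
  have c: "covers P u w" if w: "w \<in> {f DX, f DY}" for w
  proof -
    have "\<not> (w < z \<and> z < u)" if "z \<in> P" for z
    proof
      assume z: "w < z \<and> z < u"
      have "v < w" using w r by auto
      then have "z \<in> interval P v u" using z that by (auto simp: interval_def)
      then have "z \<in> {u, f DX, f DY, v}" using S by simp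
      then show False using z w r by auto
    qed
    then show ?thesis using w r XY uv by (auto simp: covers_def)
  qed
  show ?thesis using S r c by (intro exI[of _ "f DX"] exI[of _ "f DY"]) auto
qed

lemma dk_minus_convex_of_interval:
  assumes I: "dk_interval P k v u"
  shows "dk_minus_convex P k (interval P v u - {u})" 
    "minimals (interval P v u - {u}) = {v}" "v < u" "v \<in> interval P v u - {u}"
proof -
  obtain f where k: "3 \<le> k" and f: "dtd_iso_by k f (interval P v u)"
    and fu: "f (DU 1) = u" and fv: "f (DV 1) = v"
    and uv: "v \<in> P" "u \<in> P"
    using I unfolding dk_interval_iff by blast
  show "v < u" using dk_interval_sides_exist[OF I] dk_sides_below(1) by blast
  then show v: "v \<in> interval P v u - {u}" using uv by (auto simp: interval_def)
  then show "minimals (interval P v u - {u}) = {v}"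
    unfolding minimals_def interval_def by (auto intro: order_antisym)
  have "convex_in P (interval P v u - {u})"
    unfolding convex_in_def interval_def by (auto intro: order_trans)
  moreover have "bij_betw f (dtd k - {DU 1}) (interval P v u - {u})"
  proof -
    have "inj_on f (dtd k)" "f ` dtd k = interval P v u" using f by (auto simp: dtd_iso_by_def bij_betw_def)
    then show ?thesis
      using inj_on_image_set_diff[of f "dtd k" "dtd k" "{DU 1}"] dtd_corners(1)[OF k] fu
      by (simp add: bij_betw_def inj_on_diff)
  qed
  moreover have "\<forall>p\<in>dtd k - {DU 1}. \<forall>q\<in>dtd k - {DU 1}. dtd_le k p q \<longleftrightarrow> f p \<le> f q"
    using f dtd_le_iff[OF k] unfolding dtd_iso_by_def by auto
  ultimately show "dk_minus_convex P k (interval P v u - {u})"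
    unfolding dk_minus_convex_def dtd_iso_def using k by blast
qed

lemma dk_interval_same_inner:
  assumes P: "d_complete P" and I: "dk_interval P k v u" and J: "dk_interval P k v' u"
    and eq: "interval P v u - {u, v} = interval P v' u - {u, v'}"
  shows "v = v'"
proof -
  note a = dk_minus_convex_of_interval[OF I] and b = dk_minus_convex_of_interval[OF J]
  have k: "3 \<le> k" using I by (simp add: dk_interval_def)
  have "interval P v u - {u} - {v} = interval P v' u - {u} - {v'}" using eq by blast
  then have "interval P v u - {u} - minimals (interval P v u - {u})
      = interval P v' u - {u} - minimals (interval P v' u - {u})"
    by (simp only: a(2) b(2))
  moreover have "\<not> (\<exists>S T. dk_minus_convex P k S \<and> dk_minus_convex P k T \<and> S \<noteq> T \<and>
           S - minimals S = T - minimals T)"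
    using P k unfolding d_complete_def by blast
  ultimately have "interval P v u - {u} = interval P v' u - {u}"
    using a(1) b(1) by blast
  then have "{v} = {v'}" by (simp only: a(2)[symmetric] b(2)[symmetric])
  then show ?thesis by simp
qed

lemma dk_interval_covered_unique:
  assumes P: "d_complete P" and I: "dk_interval P (Suc k) v u" and k: "3 \<le> k"
    and c: "covers P u a" "covers P u b"
  shows "a = b"
proof -
  obtain v' u' where i: "interval P v u - {u, v} = interval P v' u'" "covers P u u'" "covers P v' v"
    and J: "dk_interval P k v' u'"
    using dk_interval_inner[OF I k] by blast
  have "v' < u'" using dk_minus_convex_of_interval(3)[OF J] .
  have "z = u'" if z: "covers P u z" for z
  proof -
    have zi: "z \<in> interval P v u" using dk_interval_covers_in[OF P I z] .
    have "z \<noteq> u" using z by (auto simp: covers_def)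
    have "u' \<in> P" "v < u'" "u' < u" using i \<open>v' < u'\<close> by (auto simp: covers_def)
    then have "z \<noteq> v" using z by (auto simp: covers_def)
    with zi \<open>z \<noteq> u\<close> i(1) have "z \<le> u'" by (auto simp: interval_def)
    then show ?thesis using z \<open>u' \<in> P\<close> \<open>u' < u\<close> unfolding covers_def by (metis order_le_less)
  qed
  then show ?thesis using c by blast
qed

lemma dk_interval_unique:
  assumes P: "d_complete P" and "dk_interval P k v u" "dk_interval P l v' u"
  shows "k = l \<and> v = v'"
  using assms(2,3)
proof (induction k arbitrary: l u v v')
  case 0
  then show ?case by (simp add: dk_interval_def)
next
  case (Suc k)
  have 3: "3 \<le> Suc k" "3 \<le> l" using Suc.prems by (auto simp: dk_interval_def)
  then obtain l' where l: "l = Suc l'" by (cases l) auto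
  have one: "\<exists>a b. a \<noteq> b \<and> covers P u a \<and> covers P u b" if "dk_interval P 3 w u" for w
    using d3_interval_covers[OF that] by blast
  show ?case
  proof (cases "3 \<le> k")
    case True
    have "l \<noteq> 3" using one dk_interval_covered_unique[OF P Suc.prems(1) True] Suc.prems(2) by blast
    then have l': "3 \<le> l'" using 3 l by simp
    obtain w t where i: "dk_interval P k w t" "interval P v u - {u, v} = interval P w t" "covers P u t"
      using dk_interval_inner[OF Suc.prems(1) True] by blast
    obtain w' t' where j: "dk_interval P l' w' t'" "interval P v' u - {u, v'} = interval P w' t'"
        "covers P u t'"
      using dk_interval_inner[OF Suc.prems(2)[unfolded l] l'] by blast
    have "t = t'" using dk_interval_covered_unique[OF P Suc.prems(1) True i(3) j(3)] .
    with Suc.IH[OF i(1)] j(1) have "k = l'" "w = w'" by auto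
    then have "v = v'"
      using dk_interval_same_inner[OF P Suc.prems(1)] Suc.prems(2) l i(2) j(2) \<open>t = t'\<close> by simp
    then show ?thesis using l \<open>k = l'\<close> by simp
  next
    case False
    then have k: "Suc k = 3" using 3 by simp
    have I: "dk_interval P 3 v u" using Suc.prems(1) k by simp
    have "l = 3"
    proof (rule ccontr)
      assume "l \<noteq> 3"
      then have "3 \<le> l'" using l 3 by simp
      then show False using one[OF I] dk_interval_covered_unique[OF P Suc.prems(2)[unfolded l]] by blast
    qed
    then have J: "dk_interval P 3 v' u" using Suc.prems(2) by simp
    obtain x y where xy: "x \<noteq> y" "interval P v u - {u, v} = {x, y}" "covers P u x" "covers P u y"
      using d3_interval_covers[OF I] by blast
    obtain x' y' where xy': "x' \<noteq> y'" "interval P v' u - {u, v'} = {x', y'}" "covers P u x'" "covers P u y'"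
      using d3_interval_covers[OF J] by blast
    have nu: "\<not> covers P u v" "\<not> covers P u v'" "\<not> covers P u u"
    proof -
      have "x \<in> interval P v u - {u, v}" using xy by blast
      then have "v < x" "x < u" "x \<in> P" by (auto simp: interval_def)
      then show "\<not> covers P u v" by (auto simp: covers_def)
      have "x' \<in> interval P v' u - {u, v'}" using xy' by blast
      then have "v' < x'" "x' < u" "x' \<in> P" by (auto simp: interval_def)
      then show "\<not> covers P u v'" by (auto simp: covers_def)
      show "\<not> covers P u u" by (auto simp: covers_def)
    qed
    have "{x, y} \<subseteq> {x', y'}" "{x', y'} \<subseteq> {x, y}"
      using dk_interval_covers_in[OF P I] dk_interval_covers_in[OF P J] xy xy' nu by blast+
    then have "{x, y} = {x', y'}" by (rule subset_antisym)
    then have "v = v'" using dk_interval_same_inner[OF P I J] xy(2) xy'(2) by metis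
    then show ?thesis using k \<open>l = 3\<close> by simp
  qed
qed

lemma dk_sides_unique:
  assumes P: "d_complete P" and a: "dk_sides P v u x y" and b: "dk_sides P v' u x' y'"
  shows "v = v' \<and> ((x = x' \<and> y = y') \<or> (x = y' \<and> y = x'))"
proof -
  obtain k where I: "dk_interval P k v u" using a by (auto simp: dk_sides_def)
  obtain l where J: "dk_interval P l v' u" using b by (auto simp: dk_sides_def)
  have v: "v = v'" using dk_interval_unique[OF P I J] by simp
  obtain f where f: "3 \<le> k" "dtd_iso_by k f (interval P v u)" using I unfolding dk_interval_iff by blast
  show ?thesis using a b v dk_sides_iff[OF f] unfolding dk_sides_def by blast
qed

theorem is_hook_poly_ex1:
  assumes fin: "finite P" and P: "d_complete P" and "u \<in> P"
  shows "\<exists>!h. is_hook_poly P c u h"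
  using assms(3)
proof (induction "card {w \<in> P. w < u}" arbitrary: u rule: less_induct)
  case less
  have IH: "\<exists>!h. is_hook_poly P c w h" if "w \<in> P" "w < u" for w
  proof (rule less.hyps)
    show "card {z \<in> P. z < w} < card {z \<in> P. z < u}"
      using that fin by (intro psubset_card_mono) auto
  qed (use that in simp)
  show ?case
  proof (cases "dk_top P u")
    case False
    have nos: "\<not> dk_sides P v u x y" for v x y using False by (auto simp: dk_sides_def dk_top_def)
    show ?thesis
    proof (rule ex1I[where P = "is_hook_poly P c u", OF is_hook_poly.not_top[OF less.prems False]])
      fix h assume "is_hook_poly P c u h"
      then show "h = (\<Sum>w\<in>{w \<in> P. w \<le> u}. indet (c w))"
        by cases (use nos in auto)
    qed
  next
    case True
    then obtain v x y where s: "dk_sides P v u x y"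
      unfolding dk_top_def using dk_interval_sides_exist by blast
    note bel = dk_sides_below[OF s]
    obtain hx hy hv where h: "is_hook_poly P c x hx" "is_hook_poly P c y hy" "is_hook_poly P c v hv"
      using IH bel by metis
    have eq: "g = hx" if "is_hook_poly P c x g" for g using that h IH bel by metis
    have eq': "g = hy" if "is_hook_poly P c y g" for g using that h IH bel by metis
    have eq'': "g = hv" if "is_hook_poly P c v g" for g using that h IH bel by metis
    show ?thesis
    proof (rule ex1I[where P = "is_hook_poly P c u", OF is_hook_poly.top[OF s h]])
      fix g assume "is_hook_poly P c u g"
      then show "g = hx + hy - hv"
      proof cases
        case not_top then show ?thesis using True by simp
      next
        case (top v' x' y' hx' hy' hv')
        then show ?thesis using dk_sides_unique[OF P s top(2)] eq eq' eq'' by (auto simp: add.commute)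
      qed
    qed
  qed
qed

lemma hook_poly_eqI:
  assumes "finite P" "d_complete P" "u \<in> P" "is_hook_poly P c u h"
  shows "hook_poly P c u = h"
  unfolding hook_poly_def using is_hook_poly_ex1[OF assms(1-3)] assms(4) by (rule the1_equality)

lemma hook_poly_not_top:
  assumes "finite P" "d_complete P" "u \<in> P" "\<not> dk_top P u"
  shows "hook_poly P c u = (\<Sum>w\<in>{w \<in> P. w \<le> u}. indet (c w))"
  using assms by (intro hook_poly_eqI is_hook_poly.not_top)

lemma hook_poly_top:
  assumes "finite P" "d_complete P" "dk_sides P v u x y"
  shows "hook_poly P c u = hook_poly P c x + hook_poly P c y - hook_poly P c v"
proof -
  have h: "is_hook_poly P c w (hook_poly P c w)" if "w \<in> P" for w
    unfolding hook_poly_def using is_hook_poly_ex1[OF assms(1,2) that] by (rule theI')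
  note bel = dk_sides_below[OF assms(3)]
  show ?thesis
    by (rule hook_poly_eqI[OF assms(1,2) bel(5)
          is_hook_poly.top[OF assms(3) h[OF bel(6)] h[OF bel(7)] h[OF bel(4)]]])
qed

end

theory Submission
  imports Defs
begin

text \<open>Both sides satisfy the same recursion. Splitting off the last element of a linear extension shows
  that the left-hand side \<open>L(F)\<close> satisfies \<open>a(P - F) L(F) = \<Sum> L(F \<union> {q})\<close>, where \<open>q\<close> runs over the
  maximal elements of \<open>P - F\<close>. For the right-hand side this recursion is the Chevalley formula for the
  localizations of equivariant Schubert classes. The hook polynomials are the inversions of the
  Weyl group element \<open>w\<^sub>P\<close> whose heap is \<open>P\<close>, and \<open>\<Sum>D. \<Prod>v\<in>D. hook(v)\<close>, over the excited diagrams of \<open>F\<close>, is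
  Billey's formula for the localization of the class of \<open>w\<^sub>F\<close> at \<open>w\<^sub>P\<close>. The Chevalley formula
  follows by induction on \<open>P\<close>: removing a minimal element of color \<open>i\<close> applies the
  simple reflection of \<open>i\<close> to the indeterminates. Of \<open>d\<close>-completeness it needs only that
  elements of equal or adjacent colors are comparable, that covering elements have adjacent
  colors, and that exactly two elements of adjacent color lie between consecutive elements of
  equal color and at most one above the highest element of a color.\<close>

section \<open>Minuscule colored posets\<close>

text \<open>Since \<open>w\<^sub>F lam\<close> is \<open>lam\<close> minus the simple roots of the
  colors of \<open>F\<close>, the Chevalley coefficient \<open>w\<^sub>F lam - w\<^sub>P lam\<close>
  is \<open>a(P - F)\<close>, and minusculity makes the other coefficients 1. For a color that
  occurs outside \<open>F\<close>, the pairing of \<open>w\<^sub>F lam\<close> with its coroot is 1,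
  0 or -1 according to whether the color can be added to \<open>F\<close>, neither, or removed from
  it; the induction splits along these values. It also replaces \<open>a\<close> by its reflections,
  which are no longer indeterminates. Hence the formula is stated for arbitrary values in a
  commutative ring, and genericity returns only with the division at the end. The remaining obstacle
  is to recognize inversions as hooks. An element that is not the top of a d_k-interval is the
  lowest of its color, and its inversion has to be the plain sum over the ideal below it. This is a
  global fact: some pairing must be 0, and the value -1 is excluded by the positivity of an
  antidominant sum rather than by a look at neighbors.\<close>

lemma ex_maximal_such:
  fixes S :: "'a::order set"
  assumes "finite S" "s \<in> S" "Q s"
  obtains m where "m \<in> S" "Q m" "\<And>r. r \<in> S \<Longrightarrow> Q r \<Longrightarrow> \<not> m < r"
proof -
  have "finite {r \<in> S. Q r}" "{r \<in> S. Q r} \<noteq> {}" using assms by auto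
  from finite_has_maximal[OF this] obtain m where
    m: "m \<in> {r \<in> S. Q r}" "\<forall>r\<in>{r \<in> S. Q r}. m \<le> r \<longrightarrow> m = r" by (rule bexE)
  show ?thesis by (rule that[of m]) (use m in auto)
qed

lemma ex_minimal_such:
  fixes S :: "'a::order set"
  assumes "finite S" "s \<in> S" "Q s"
  obtains m where "m \<in> S" "Q m" "\<And>r. r \<in> S \<Longrightarrow> Q r \<Longrightarrow> \<not> r < m"
proof -
  have "finite {r \<in> S. Q r}" "{r \<in> S. Q r} \<noteq> {}" using assms by auto
  from finite_has_minimal[OF this] obtain m where
    m: "m \<in> {r \<in> S. Q r}" "\<forall>r\<in>{r \<in> S. Q r}. r \<le> m \<longrightarrow> m = r" by (rule bexE)
  show ?thesis by (rule that[of m]) (use m in auto)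
qed

lemma exists_cover_above:
  fixes P :: "'a::order set"
  assumes "finite P" "p \<in> P" "q \<in> P" "p < q"
  obtains r where "covers P r p" "r \<le> q"
proof -
  obtain r where r: "r \<in> P" "p < r \<and> r \<le> q" and min: "\<And>s. s \<in> P \<Longrightarrow> p < s \<and> s \<le> q \<Longrightarrow> \<not> s < r"
    using ex_minimal_such[OF assms(1,3), of "\<lambda>r. p < r \<and> r \<le> q"] assms(4) by blast
  have "\<not> (p < s \<and> s < r)" if "s \<in> P" for s
    using min[OF that] r by (meson order.trans order_less_imp_le)
  then show ?thesis using that[of r] r assms by (auto simp: covers_def)
qed

lemma exists_cover_below:
  fixes P :: "'a::order set"
  assumes "finite P" "p \<in> P" "q \<in> P" "p < q"
  obtains r where "covers P q r" "p \<le> r"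
proof -
  obtain r where r: "r \<in> P" "p \<le> r \<and> r < q" and max: "\<And>s. s \<in> P \<Longrightarrow> p \<le> s \<and> s < q \<Longrightarrow> \<not> r < s"
    using ex_maximal_such[OF assms(1,2), of "\<lambda>r. p \<le> r \<and> r < q"] assms(4) by blast
  have "\<not> (r < s \<and> s < q)" if "s \<in> P" for s
    using max[OF that] r by (meson order.trans order_less_imp_le)
  then show ?thesis using that[of r] r assms by (auto simp: covers_def)
qed

lemma order_filter_remove_minimal:
  "order_filter P F \<Longrightarrow> x \<in> minimals F \<Longrightarrow> order_filter P (F - {x})"
  unfolding order_filter_def minimals_def using order_less_imp_le by blast

lemma order_filter_insert_maximal:
  "order_filter P F \<Longrightarrow> q \<in> maximals (P - F) \<Longrightarrow> order_filter P (insert q F)"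
  unfolding order_filter_def maximals_def using order_less_imp_le by blast

lemma order_filter_not_le: "order_filter P {w \<in> P. \<not> w \<le> u}"
  unfolding order_filter_def using order_trans order_less_imp_le by blast

lemma minimals_iff: "x \<in> minimals S \<longleftrightarrow> x \<in> S \<and> (\<forall>z\<in>S. \<not> z < x)"
  unfolding minimals_def by (auto simp: order_le_less)

lemma maximals_iff: "x \<in> maximals S \<longleftrightarrow> x \<in> S \<and> (\<forall>z\<in>S. \<not> x < z)"
  unfolding maximals_def by (auto simp: order_le_less)

lemma minimals_nonempty:
  assumes "finite S" "s \<in> S" shows "\<exists>x. x \<in> minimals S"
  by (rule ex_minimal_such[OF assms, of "\<lambda>_. True"]) (auto simp: minimals_iff)

lemma covers_remove_minimal:
  "p \<in> minimals P \<Longrightarrow> covers (P - {p}) a b \<longleftrightarrow> covers P a b \<and> b \<noteq> p"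
  unfolding covers_def minimals_iff by auto

section \<open>Cartan data, heaps and pairings of filters\<close>

locale simply_laced =
  fixes adj :: "'i \<Rightarrow> 'i \<Rightarrow> bool" and lam :: "'i \<Rightarrow> int"
  assumes adj_sym: "adj i j \<Longrightarrow> adj j i"
    and adj_irrefl: "\<not> adj i i"
    and lam_nonneg: "0 \<le> lam i"
begin

definition cartan :: "'i \<Rightarrow> 'i \<Rightarrow> int" where
  "cartan i j = (if i = j then 2 else if adj i j then -1 else 0)"

lemma cartan_sym: "cartan i j = cartan j i"
  using adj_sym by (auto simp: cartan_def)

lemma cartan_refl [simp]: "cartan i i = 2"
  by (simp add: cartan_def)

lemma cartan_adj [simp]: "adj i j \<Longrightarrow> cartan i j = -1"
  using adj_irrefl by (auto simp: cartan_def)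

lemma sum_cartan_off_color:
  assumes "finite S" "\<And>r. r \<in> S \<Longrightarrow> c r \<noteq> k"
  shows "(\<Sum>r\<in>S. cartan k (c r)) = - int (card {r \<in> S. adj k (c r)})"
proof -
  have "(\<Sum>r\<in>S. cartan k (c r)) = (\<Sum>r\<in>S. if adj k (c r) then -1 else 0)"
    using assms(2) by (intro sum.cong) (auto simp: cartan_def)
  also have "\<dots> = (\<Sum>r\<in>{r \<in> S. adj k (c r)}. -1)"
    by (rule sum.inter_filter[symmetric]) (fact assms(1))
  finally show ?thesis by simp
qed

text \<open>The last condition says that \<open>P\<close> is the heap of a \<open>lam\<close>-minuscule element of the simply laced
  Weyl group with diagram \<open>adj\<close>, \<open>lam\<close> being a dominant weight.\<close>

definition heap :: "('a::order \<Rightarrow> 'i) \<Rightarrow> 'a set \<Rightarrow> bool" where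
  "heap c P \<longleftrightarrow> finite P \<and>
    (\<forall>p\<in>P. \<forall>q\<in>P. c p = c q \<or> adj (c p) (c q) \<longrightarrow> p \<le> q \<or> q \<le> p) \<and>
    (\<forall>p q. covers P p q \<longrightarrow> adj (c p) (c q)) \<and>
    (\<forall>p\<in>P. lam (c p) - (\<Sum>q\<in>{q \<in> P. p < q}. cartan (c p) (c q)) = 1)"

lemma
  assumes "heap c P"
  shows heap_finite: "finite P"
    and heap_comparable: "p \<in> P \<Longrightarrow> q \<in> P \<Longrightarrow> c p = c q \<or> adj (c p) (c q) \<Longrightarrow> p \<le> q \<or> q \<le> p"
    and heap_covers: "covers P p q \<Longrightarrow> adj (c p) (c q)"
    and heap_weight: "p \<in> P \<Longrightarrow> lam (c p) - (\<Sum>q\<in>{q \<in> P. p < q}. cartan (c p) (c q)) = 1"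
  using assms unfolding heap_def by blast+

lemma heap_cartan_zero:
  assumes "heap c P" "p \<in> P" "q \<in> P" "\<not> p \<le> q" "\<not> q \<le> p"
  shows "cartan (c p) (c q) = 0"
  using heap_comparable[OF assms(1-3)] assms(4,5) by (auto simp: cartan_def)

lemma heap_remove_minimal:
  assumes h: "heap c P" and p: "p \<in> minimals P"
  shows "heap c (P - {p})"
proof -
  have eq: "{q \<in> P - {p}. r < q} = {q \<in> P. r < q}" if "r \<in> P" for r
    using p that by (auto simp: minimals_iff)
  show ?thesis
    unfolding heap_def covers_remove_minimal[OF p]
  proof (intro conjI ballI allI impI)
    fix r assume "r \<in> P - {p}"
    then show "lam (c r) - (\<Sum>q\<in>{q \<in> P - {p}. r < q}. cartan (c r) (c q)) = 1"
      using eq heap_weight[OF h] by simp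
  qed (use heap_finite[OF h] heap_comparable[OF h] heap_covers[OF h] in blast)+
qed

text \<open>\<open>pairing c F k\<close> is the pairing of the weight \<open>w\<^sub>F lam\<close> with the simple coroot of \<open>k\<close>, where
  \<open>w\<^sub>F\<close> is the product of the simple reflections of the colors of \<open>F\<close>.\<close>

definition pairing :: "('a \<Rightarrow> 'i) \<Rightarrow> 'a set \<Rightarrow> 'i \<Rightarrow> int" where
  "pairing c F k = lam k - (\<Sum>q\<in>F. cartan k (c q))"

lemma pairing_Un:
  "finite F \<Longrightarrow> finite S \<Longrightarrow> F \<inter> S = {} \<Longrightarrow>
    pairing c (F \<union> S) k = pairing c F k - (\<Sum>q\<in>S. cartan k (c q))"
  by (simp add: pairing_def sum.union_disjoint)

text \<open>Let \<open>q\<close> be the highest element of color \<open>k\<close> outside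
  \<open>F\<close>. Elements of \<open>F\<close> not above \<open>q\<close> are incomparable to it
  and contribute 0, so by the weight condition at \<open>q\<close> the pairing is 1 minus the number
  of elements of adjacent color in \<open>P - F\<close> above \<open>q\<close>. That number is 0 iff
  \<open>q\<close> is maximal in \<open>P - F\<close>, because covers have adjacent colors.\<close>

lemma pairing_addable:
  assumes h: "heap c P" and F: "order_filter P F" and k: "\<exists>p\<in>P - F. c p = k"
  shows "pairing c F k \<le> 1"
    and "pairing c F k = 1 \<longleftrightarrow> (\<exists>q\<in>maximals (P - F). c q = k)"
proof -
  have fin: "finite P" using heap_finite[OF h] .
  have FP: "F \<subseteq> P" and up: "\<And>x y. x \<in> F \<Longrightarrow> y \<in> P \<Longrightarrow> x \<le> y \<Longrightarrow> y \<in> F"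
    using F unfolding order_filter_def by (auto simp: order_le_less)
  obtain q where q: "q \<in> P" "q \<notin> F" "c q = k"
    and qmax: "\<And>r. r \<in> P - F \<Longrightarrow> c r = k \<Longrightarrow> \<not> q < r"
  proof -
    obtain p where "p \<in> P - F" "c p = k" using k by blast
    then show ?thesis
      using ex_maximal_such[of "P - F" p "\<lambda>r. c r = k"] fin that by blast
  qed
  let ?M = "{r \<in> {r \<in> P - F. q < r}. adj k (c r)}"
  have "(\<Sum>r\<in>F. cartan k (c r)) = (\<Sum>r\<in>{r \<in> F. q < r}. cartan k (c r))"
  proof (rule sum.mono_neutral_right)
    show "\<forall>r\<in>F - {r \<in> F. q < r}. cartan k (c r) = 0"
    proof
      fix r assume r: "r \<in> F - {r \<in> F. q < r}"
      then have "r \<noteq> q" "\<not> q \<le> r" "\<not> r \<le> q" using q up by (auto simp: order_le_less)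
      then show "cartan k (c r) = 0" using heap_cartan_zero[OF h q(1), of r] r FP q by auto
    qed
  qed (use finite_subset[OF FP fin] in auto)
  moreover have "(\<Sum>r\<in>{r \<in> P. q < r}. cartan k (c r)) =
      (\<Sum>r\<in>{r \<in> F. q < r}. cartan k (c r)) + (\<Sum>r\<in>{r \<in> P - F. q < r}. cartan k (c r))"
  proof -
    have "{r \<in> P. q < r} = {r \<in> F. q < r} \<union> {r \<in> P - F. q < r}" using FP by auto
    moreover have "finite {r \<in> F. q < r}" using fin FP finite_subset by fastforce
    moreover have "{r \<in> F. q < r} \<inter> {r \<in> P - F. q < r} = {}" by auto
    ultimately show ?thesis using fin by (simp add: sum.union_disjoint)
  qed
  moreover have "(\<Sum>r\<in>{r \<in> P - F. q < r}. cartan k (c r)) = - int (card ?M)"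
    by (rule sum_cartan_off_color) (use fin qmax in \<open>auto simp: order_less_le\<close>)
  ultimately have e: "pairing c F k = 1 - int (card ?M)"
    using heap_weight[OF h q(1)] q by (simp add: pairing_def)
  then show "pairing c F k \<le> 1" by simp
  have "?M = {} \<longleftrightarrow> (\<exists>q\<in>maximals (P - F). c q = k)"
  proof
    assume M: "?M = {}"
    have "\<not> q < r" if r: "r \<in> P - F" for r
    proof
      assume "q < r"
      then obtain s where s: "covers P s q" "s \<le> r" using exists_cover_above[OF fin q(1)] r by blast
      then have "s \<in> P" "q < s" "s \<notin> F" "adj (c s) (c q)"
        using up r heap_covers[OF h] by (auto simp: covers_def)
      then show False using M q adj_sym by blast
    qed
    then show "\<exists>q\<in>maximals (P - F). c q = k" using q by (auto simp: maximals_iff)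
  next
    assume "\<exists>q\<in>maximals (P - F). c q = k"
    then obtain q' where q': "q' \<in> P - F" "c q' = k" "\<And>z. z \<in> P - F \<Longrightarrow> \<not> q' < z"
      by (auto simp: maximals_iff)
    have "q \<le> q' \<or> q' \<le> q" using heap_comparable[OF h q(1)] q' q by auto
    then have "q = q'" using q' q qmax by (auto simp: order_le_less)
    then show "?M = {}" using q' by auto
  qed
  moreover have "finite ?M" using fin by auto
  ultimately show "pairing c F k = 1 \<longleftrightarrow> (\<exists>q\<in>maximals (P - F). c q = k)"
    using e card_0_eq[of ?M] by (simp del: card_0_eq)
qed

text \<open>Dually, let \<open>x\<close> be the lowest element of color \<open>k\<close> in
  \<open>F\<close>: the elements above \<open>x\<close> leave 1, \<open>x\<close> itself subtracts
  2, and each element of adjacent color in \<open>F\<close> below \<open>x\<close> adds 1. If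
  \<open>F\<close> avoids the color, the pairing is nonnegative because \<open>lam\<close> is
  dominant.\<close>

lemma pairing_removable:
  assumes h: "heap c P" and F: "order_filter P F"
  shows "-1 \<le> pairing c F k"
    and "pairing c F k = -1 \<longleftrightarrow> (\<exists>x\<in>minimals F. c x = k)"
proof -
  have fin: "finite P" using heap_finite[OF h] .
  have FP: "F \<subseteq> P" and up: "\<And>x y. x \<in> F \<Longrightarrow> y \<in> P \<Longrightarrow> x \<le> y \<Longrightarrow> y \<in> F"
    using F unfolding order_filter_def by (auto simp: order_le_less)
  have finF: "finite F" using FP fin finite_subset by blast
  have "-1 \<le> pairing c F k \<and> (pairing c F k = -1 \<longleftrightarrow> (\<exists>x\<in>minimals F. c x = k))"
  proof (cases "\<exists>x\<in>F. c x = k")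
    case False
    then have "pairing c F k = lam k + int (card {r \<in> F. adj k (c r)})"
      unfolding pairing_def using sum_cartan_off_color[OF finF, of c k] by auto
    moreover have "\<not> (\<exists>x\<in>minimals F. c x = k)" using False by (auto simp: minimals_def)
    ultimately show ?thesis using lam_nonneg[of k] by simp
  next
    case True
    then obtain x where x: "x \<in> F" "c x = k"
      and xmin: "\<And>r. r \<in> F \<Longrightarrow> c r = k \<Longrightarrow> \<not> r < x"
      using ex_minimal_such[OF finF, of _ "\<lambda>r. c r = k"] by blast
    have xP: "x \<in> P" using x FP by auto
    let ?M = "{r \<in> {r \<in> F. r < x}. adj k (c r)}"
    let ?A = "{r \<in> P. x < r}" and ?B = "{r \<in> F. r < x}"
    have "(\<Sum>r\<in>F. cartan k (c r)) = (\<Sum>r\<in>insert x (?A \<union> ?B). cartan k (c r))"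
    proof (rule sum.mono_neutral_right)
      show "insert x (?A \<union> ?B) \<subseteq> F" using x up by (auto simp: order_less_imp_le)
      show "\<forall>r\<in>F - insert x (?A \<union> ?B). cartan k (c r) = 0"
      proof
        fix r assume r: "r \<in> F - insert x (?A \<union> ?B)"
        then have "\<not> x \<le> r" "\<not> r \<le> x" "r \<in> P" using FP by (auto simp: order_le_less)
        then show "cartan k (c r) = 0" using heap_cartan_zero[OF h xP] x by auto
      qed
    qed (use finF in auto)
    also have "\<dots> = 2 + ((\<Sum>r\<in>?A. cartan k (c r)) + (\<Sum>r\<in>?B. cartan k (c r)))"
    proof -
      have "?A \<inter> ?B = {}" by auto
      then show ?thesis using fin finF x by (simp add: sum.union_disjoint)
    qed
    also have "(\<Sum>r\<in>?B. cartan k (c r)) = - int (card ?M)"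
      by (rule sum_cartan_off_color) (use finF xmin in \<open>auto simp: order_less_le\<close>)
    finally have e: "pairing c F k = -1 + int (card ?M)"
      using heap_weight[OF h xP] x by (simp add: pairing_def)
    have "?M = {} \<longleftrightarrow> (\<exists>x\<in>minimals F. c x = k)"
    proof
      assume M: "?M = {}"
      have "\<not> r < x" if r: "r \<in> F" for r
      proof
        assume "r < x"
        then obtain s where s: "covers P x s" "r \<le> s" using exists_cover_below[OF fin _ xP] r FP by blast
        then have "s < x" "s \<in> F" "adj (c x) (c s)"
          using up r heap_covers[OF h] by (auto simp: covers_def)
        then show False using M x by blast
      qed
      then show "\<exists>x\<in>minimals F. c x = k" using x by (auto simp: minimals_iff)
    next
      assume "\<exists>x\<in>minimals F. c x = k"
      then obtain y where y: "y \<in> F" "c y = k" "\<And>z. z \<in> F \<Longrightarrow> \<not> z < y"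
        by (auto simp: minimals_iff)
      have "x \<le> y \<or> y \<le> x" using heap_comparable[OF h xP] y x FP by auto
      then have "x = y" using y x xmin by (auto simp: order_le_less)
      then show "?M = {}" using y by auto
    qed
    moreover have "finite ?M" using finF by auto
    ultimately show ?thesis using e card_0_eq[of ?M] by (simp del: card_0_eq)
  qed
  then show "-1 \<le> pairing c F k" "pairing c F k = -1 \<longleftrightarrow> (\<exists>x\<in>minimals F. c x = k)" by auto
qed

lemma minimals_color_unique:
  assumes "heap c P" "F \<subseteq> P" "x \<in> minimals F" "y \<in> minimals F" "c x = c y"
  shows "x = y"
  using heap_comparable[OF assms(1), of x y] assms(2-5) unfolding minimals_iff
  by (auto simp: order_le_less)

text \<open>The sum is the difference of the pairings at \<open>F\<close> and at the filter
  \<open>P\<close>, and the latter is -1 because \<open>p\<close> can be removed from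
  \<open>P\<close>. It measures how the reflection of \<open>c p\<close> changes the sum of the
  simple roots over \<open>P - F\<close>.\<close>

lemma sum_cartan_complement:
  assumes h: "heap c P" and F: "order_filter P F" and p: "p \<in> minimals P"
  shows "(\<Sum>q\<in>P - F. cartan (c p) (c q)) = pairing c F (c p) + 1"
proof -
  have fin: "finite P" and FP: "F \<subseteq> P" using heap_finite[OF h] F by (auto simp: order_filter_def)
  have "order_filter P P" by (simp add: order_filter_def)
  then have "pairing c P (c p) = -1" using pairing_removable(2)[OF h] p by blast
  moreover have "pairing c P (c p) = pairing c F (c p) - (\<Sum>q\<in>P - F. cartan (c p) (c q))"
    using pairing_Un[of F "P - F" c "c p"] fin FP finite_subset[OF FP fin] by (simp add: Un_absorb1)
  ultimately show ?thesis by simp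
qed

end

section \<open>Inversion roots\<close>

lemma minimals_remove: "m \<in> minimals P \<Longrightarrow> p \<in> minimals P \<Longrightarrow> p \<noteq> m \<Longrightarrow> p \<in> minimals (P - {m})"
  by (auto simp: minimals_iff)

context simply_laced
begin

text \<open>The reflection acts on the values substituted for the simple roots instead of on
  polynomials, so identities can be stated over any commutative ring.\<close>

definition reflect :: "'i \<Rightarrow> ('i \<Rightarrow> 'r::comm_ring_1) \<Rightarrow> 'i \<Rightarrow> 'r" where
  "reflect i a j = a j - of_int (cartan i j) * a i"

lemma reflect_commute:
  "cartan i j = 0 \<Longrightarrow> reflect i (reflect j a) = reflect j (reflect i a)"
  using cartan_sym[of i j] by (auto simp: reflect_def fun_eq_iff)

lemma reflect_fixed: "cartan i j = 0 \<Longrightarrow> reflect i a j = a j"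
  by (simp add: reflect_def)

lemma reflect_self: "reflect i a i = - a i"
  by (simp add: reflect_def)

lemma sum_reflect:
  "(\<Sum>q\<in>S. reflect i a (c q)) = (\<Sum>q\<in>S. a (c q)) - of_int (\<Sum>q\<in>S. cartan i (c q)) * a i"
  by (simp add: reflect_def sum_subtractf sum_distrib_right)

text \<open>\<open>inv_root c P a u\<close> is the inversion of the element with heap \<open>P\<close> that belongs to \<open>u\<close>, where \<open>a i\<close>
  is substituted for the simple inv_root of \<open>i\<close>: the minimal elements of \<open>P\<close> are the leftmost letters.\<close>

function inv_root :: "('a::order \<Rightarrow> 'i) \<Rightarrow> 'a set \<Rightarrow> ('i \<Rightarrow> 'r::comm_ring_1) \<Rightarrow> 'a \<Rightarrow> 'r" where
  "inv_root c P a u = (if finite P \<and> u \<in> P then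
     (let p = SOME p. p \<in> minimals P in
      if u = p then a (c p) else inv_root c (P - {p}) (reflect (c p) a) u) else 0)"
  by auto
termination
proof (relation "measure (\<lambda>(c, P, a, u). card P)")
  fix c :: "'a::order \<Rightarrow> 'i" and P a u and p :: 'a
  assume *: "finite P \<and> u \<in> P" "p = (SOME p. p \<in> minimals P)"
  then have "p \<in> minimals P" using minimals_nonempty[of P u] someI_ex by metis
  then have "p \<in> P" by (simp add: minimals_iff)
  then show "((c, P - {p}, reflect (c p) a, u), c, P, a, u) \<in> measure (\<lambda>(c, P, a, u). card P)"
    using * card_Diff1_less[of P p] by simp
qed simp

declare inv_root.simps [simp del]

text \<open>The recursion picks its minimal element by \<open>SOME\<close>; any other choice gives
  the same value. Two distinct minimal elements are incomparable, so their colors are neither equal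
  nor adjacent, and the two reflections commute and fix each other's simple root. The induction
  removes both elements in either order.\<close>

lemma root_minimal_and_remove:
  assumes "heap c P" "p \<in> minimals P" "u \<in> P"
  shows "inv_root c P a u = (if u = p then a (c p) else inv_root c (P - {p}) (reflect (c p) a) u)"
  using assms
proof (induction "card P" arbitrary: P a p u rule: less_induct)
  case less
  note h = less.prems(1) and p = less.prems(2) and u = less.prems(3)
  define m where "m = (SOME m. m \<in> minimals P)"
  have fin: "finite P" using heap_finite[OF h] .
  have m: "m \<in> minimals P" unfolding m_def using minimals_nonempty[OF fin u] by (rule someI_ex)
  have inv_root: "inv_root c P b w = (if w = m then b (c m) else inv_root c (P - {m}) (reflect (c m) b) w)"
    if "w \<in> P" for b w
    using that fin by (subst inv_root.simps) (simp add: Let_def m_def)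
  show ?case
  proof (cases "p = m")
    case True then show ?thesis using inv_root[OF u, of a] by simp
  next
    case False
    have mP: "m \<in> P" and pP: "p \<in> P" using m p by (auto simp: minimals_iff)
    have C: "cartan (c m) (c p) = 0"
      by (rule heap_cartan_zero[OF h mP pP]) (use m p mP pP False in \<open>auto simp: minimals_iff order_le_less\<close>)
    have card: "card (P - {m}) < card P" "card (P - {p}) < card P"
      by (rule card_Diff1_less[OF fin mP], rule card_Diff1_less[OF fin pP])
    note IHm = less.hyps[OF card(1) heap_remove_minimal[OF h m] minimals_remove[OF m p False]]
    note IHp = less.hyps[OF card(2) heap_remove_minimal[OF h p] minimals_remove[OF p m False[symmetric]]]
    consider "u = m" | "u = p" | "u \<noteq> m" "u \<noteq> p" by blast
    then show ?thesis
    proof cases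
      case 1
      then have "inv_root c (P - {p}) (reflect (c p) a) u = a (c u)"
        using IHp[of u "reflect (c p) a"] u False C cartan_sym by (simp add: reflect_fixed)
      then show ?thesis using inv_root[OF u, of a] 1 False by simp
    next
      case 2
      then have "inv_root c (P - {m}) (reflect (c m) a) u = a (c u)"
        using IHm[of u "reflect (c m) a"] u False C by (simp add: reflect_fixed)
      then show ?thesis using inv_root[OF u, of a] 2 False by simp
    next
      case 3
      have "P - {m} - {p} = P - {p} - {m}" by blast
      then have "inv_root c (P - {m}) (reflect (c m) a) u = inv_root c (P - {p}) (reflect (c p) a) u"
        using IHm[of u "reflect (c m) a"] IHp[of u "reflect (c p) a"] 3 u reflect_commute[OF C, of a]
        by simp
      then show ?thesis using inv_root[OF u, of a] 3 by simp
    qed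
  qed
qed

lemma root_minimal:
  "heap c P \<Longrightarrow> p \<in> minimals P \<Longrightarrow> inv_root c P a p = a (c p)"
  using root_minimal_and_remove[of c P p p a] by (simp add: minimals_iff)

lemma root_remove:
  "heap c P \<Longrightarrow> p \<in> minimals P \<Longrightarrow> u \<in> P - {p} \<Longrightarrow> inv_root c P a u = inv_root c (P - {p}) (reflect (c p) a) u"
  using root_minimal_and_remove[of c P p u a] by simp

section \<open>Excited diagrams of heaps\<close>

text \<open>The form of an elementary excitation that makes sense in every heap: instead of spanning
  a d_k-interval, \<open>v\<close> and \<open>u\<close> are consecutive in their color.\<close>

definition excite :: "('a::order \<Rightarrow> 'i) \<Rightarrow> 'a set \<Rightarrow> 'a set \<Rightarrow> 'a set \<Rightarrow> bool" where
  "excite c P D D' \<longleftrightarrow> (\<exists>u\<in>D. \<exists>v\<in>P - D. v < u \<and> c v = c u \<and>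
     (\<forall>w\<in>P. v < w \<and> w < u \<longrightarrow> c w \<noteq> c u) \<and>
     (\<forall>w\<in>D. v < w \<and> w < u \<longrightarrow> \<not> adj (c w) (c u)) \<and> D' = insert v (D - {u}))"

definition excited :: "('a::order \<Rightarrow> 'i) \<Rightarrow> 'a set \<Rightarrow> 'a set \<Rightarrow> 'a set set" where
  "excited c P F = {D. (excite c P)\<^sup>*\<^sup>* F D}"

lemma exciteI:
  "u \<in> D \<Longrightarrow> v \<in> P \<Longrightarrow> v \<notin> D \<Longrightarrow> v < u \<Longrightarrow> c v = c u \<Longrightarrow>
   (\<And>w. w \<in> P \<Longrightarrow> v < w \<Longrightarrow> w < u \<Longrightarrow> c w \<noteq> c u) \<Longrightarrow>
   (\<And>w. w \<in> D \<Longrightarrow> v < w \<Longrightarrow> w < u \<Longrightarrow> \<not> adj (c w) (c u)) \<Longrightarrow>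
   D' = insert v (D - {u}) \<Longrightarrow> excite c P D D'"
  unfolding excite_def by blast

lemma exciteE:
  assumes "excite c P D D'"
  obtains u v where "u \<in> D" "v \<in> P" "v \<notin> D" "v < u" "c v = c u"
    "\<forall>w\<in>P. v < w \<longrightarrow> w < u \<longrightarrow> c w \<noteq> c u"
    "\<forall>w\<in>D. v < w \<longrightarrow> w < u \<longrightarrow> \<not> adj (c w) (c u)" "D' = insert v (D - {u})"
proof -
  obtain u v where "u \<in> D" "v \<in> P - D" "v < u \<and> c v = c u \<and>
     (\<forall>w\<in>P. v < w \<and> w < u \<longrightarrow> c w \<noteq> c u) \<and>
     (\<forall>w\<in>D. v < w \<and> w < u \<longrightarrow> \<not> adj (c w) (c u)) \<and> D' = insert v (D - {u})"
    using assms unfolding excite_def by (elim bexE)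
  then show thesis by (intro that[of u v]) auto
qed

lemma excited_self: "F \<in> excited c P F"
  by (simp add: excited_def)

lemma excited_trans: "D \<in> excited c P F \<Longrightarrow> D' \<in> excited c P D \<Longrightarrow> D' \<in> excited c P F"
  by (auto simp: excited_def)

lemma excited_step: "D \<in> excited c P F \<Longrightarrow> excite c P D D' \<Longrightarrow> D' \<in> excited c P F"
  by (auto simp: excited_def)

lemma excited_induct [consumes 1, case_names base step]:
  assumes "D \<in> excited c P F" "Q F"
    "\<And>D D'. D \<in> excited c P F \<Longrightarrow> Q D \<Longrightarrow> excite c P D D' \<Longrightarrow> Q D'"
  shows "Q D"
proof -
  have "(excite c P)\<^sup>*\<^sup>* F D" using assms(1) by (simp add: excited_def)
  then show ?thesis
    by (induction rule: rtranclp_induct) (use assms(2,3) in \<open>auto simp: excited_def\<close>)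
qed

lemma excited_subset: "D \<in> excited c P F \<Longrightarrow> F \<subseteq> P \<Longrightarrow> D \<subseteq> P"
  by (induction rule: excited_induct) (auto elim!: exciteE)

lemma excited_whole: "excited c P P = {P}"
proof -
  have "D = P" if "D \<in> excited c P P" for D
    using that by (induction rule: excited_induct) (auto elim!: exciteE)
  then show ?thesis using excited_self by blast
qed

section \<open>Excited diagrams under removal of a minimal element\<close>

lemma excite_remove:
  assumes "excite c P D D'" "p \<in> minimals P" "p \<in> D"
  shows "excite c (P - {p}) (D - {p}) (D' - {p})" "p \<in> D'"
proof -
  obtain u v where uv: "u \<in> D" "v \<in> P" "v \<notin> D" "v < u" "c v = c u"
    "\<forall>w\<in>P. v < w \<longrightarrow> w < u \<longrightarrow> c w \<noteq> c u"
    "\<forall>w\<in>D. v < w \<longrightarrow> w < u \<longrightarrow> \<not> adj (c w) (c u)" "D' = insert v (D - {u})"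
    using assms(1) by (elim exciteE)
  have ne: "u \<noteq> p" "v \<noteq> p" using uv assms by (auto simp: minimals_iff)
  show "excite c (P - {p}) (D - {p}) (D' - {p})"
    by (rule exciteI[of u _ v]) (use uv ne in auto)
  show "p \<in> D'" using uv ne assms by auto
qed

lemma excite_mono:
  assumes "excite c (P - {p}) D D'" "p \<in> minimals P"
  shows "excite c P D D'" "excite c P (insert p D) (insert p D')"
proof -
  obtain u v where uv: "u \<in> D" "v \<in> P - {p}" "v \<notin> D" "v < u" "c v = c u"
    "\<forall>w\<in>P - {p}. v < w \<longrightarrow> w < u \<longrightarrow> c w \<noteq> c u"
    "\<forall>w\<in>D. v < w \<longrightarrow> w < u \<longrightarrow> \<not> adj (c w) (c u)" "D' = insert v (D - {u})"
    using assms(1) by (elim exciteE)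
  have ne: "\<not> v < p" "v \<noteq> p" using uv assms by (auto simp: minimals_iff)
  show "excite c P D D'"
    by (rule exciteI[of u _ v]) (use uv ne in auto)
  have u: "u \<noteq> p" using uv(4) ne by blast
  show "excite c P (insert p D) (insert p D')"
  proof (rule exciteI)
    show "u \<in> insert p D" "v \<in> P" "v \<notin> insert p D" "v < u" "c v = c u" using uv(1-5) ne by auto
    show "insert p D' = insert v (insert p D - {u})" using uv(8) u by auto
    show "c w \<noteq> c u" if "w \<in> P" "v < w" "w < u" for w using that uv(6) ne by blast
    show "\<not> adj (c w) (c u)" if "w \<in> insert p D" "v < w" "w < u" for w using that uv(7) ne by blast
  qed
qed

lemma excited_mono:
  assumes "D \<in> excited c (P - {p}) F" "p \<in> minimals P"
  shows "D \<in> excited c P F" "insert p D \<in> excited c P (insert p F)"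
  using assms(1)
  by (induction rule: excited_induct) (auto intro: excited_self excited_step dest: excite_mono[OF _ assms(2)])

text \<open>Traced back along the excitations, \<open>u\<close> comes from an element of
  \<open>F\<close> of its color, and at no stage was anything of equal or adjacent color below it.
  Deleting the traced element from every diagram keeps the excitations of the others legal, since
  they only require certain elements to be absent.\<close>

lemma excited_delete_minimal:
  assumes h: "heap c P" and F: "order_filter P F"
    and "D \<in> excited c P F" "u \<in> D" "\<And>w. w \<in> D \<Longrightarrow> w < u \<Longrightarrow> c w \<noteq> c u \<and> \<not> adj (c w) (c u)"
  shows "\<exists>x\<in>minimals F. c x = c u \<and> D - {u} \<in> excited c P (F - {x})"
  using assms(3-)
proof (induction arbitrary: u rule: excited_induct)
  case base
  have FP: "F \<subseteq> P" using F by (simp add: order_filter_def)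
  have "\<not> z < u" if z: "z \<in> F" for z
  proof
    assume "z < u"
    then obtain s where s: "covers P u s" "z \<le> s"
      using exists_cover_below[OF heap_finite[OF h], of z u] FP z base by blast
    then have "s \<in> F" using F z unfolding order_filter_def covers_def by (auto simp: order_le_less)
    then show False using base(2)[of s] s(1) heap_covers[OF h s(1)] adj_sym by (auto simp: covers_def)
  qed
  then have "u \<in> minimals F" using base(1) by (auto simp: minimals_iff)
  then show ?case using excited_self by blast
next
  case (step D D')
  obtain s t where st: "s \<in> D" "t \<in> P" "t \<notin> D" "t < s" "c t = c s"
    "\<forall>w\<in>P. t < w \<longrightarrow> w < s \<longrightarrow> c w \<noteq> c s"
    "\<forall>w\<in>D. t < w \<longrightarrow> w < s \<longrightarrow> \<not> adj (c w) (c s)" "D' = insert t (D - {s})"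
    using step.hyps(2) by (elim exciteE)
  have DP: "D \<subseteq> P" using excited_subset[OF step.hyps(1)] F by (simp add: order_filter_def)
  have below: "c w \<noteq> c u \<and> \<not> adj (c w) (c u)" if "w \<in> D" "w \<noteq> s" "w < u" for w
    using step.prems(2)[of w] that st by auto
  show ?case
  \<comment> \<open>The last excitation moves \<open>s\<close> to \<open>t\<close>. If
    \<open>t = u\<close>, then \<open>u\<close> is traced back to \<open>s\<close>; otherwise
    \<open>u\<close> was already in \<open>D\<close> and the same excitation is performed without
    it.\<close>
  proof (cases "t = u")
    case True
    have "\<exists>x\<in>minimals F. c x = c s \<and> D - {s} \<in> excited c P (F - {x})"
    proof (rule step.IH[OF st(1)])
      fix w assume w: "w \<in> D" "w < s"
      show "c w \<noteq> c s \<and> \<not> adj (c w) (c s)"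
      proof (rule ccontr)
        \<comment> \<open>Such a \<open>w\<close> is comparable to \<open>t\<close>. Below
          \<open>t\<close> it contradicts the hypothesis on \<open>u\<close>; strictly between
          \<open>t\<close> and \<open>s\<close> it would have blocked the excitation.\<close>
        assume n: "\<not> (c w \<noteq> c s \<and> \<not> adj (c w) (c s))"
        then have "w \<le> t \<or> t \<le> w"
          using heap_comparable[OF h, of w t] w DP st by auto
        moreover have "\<not> w < t" using below[of w] w n st True by auto
        moreover have "w \<noteq> t" using w st by auto
        ultimately have "t < w" by auto
        then show False using bspec[OF st(6), of w] bspec[OF st(7), of w] w n DP by auto
      qed
    qed
    moreover have "D' - {u} = D - {s}" using st(3,8) True by blast
    moreover have "c u = c s" using st(5) True by simp
    ultimately show ?thesis by (simp only:)
  next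
    case False
    have u: "u \<in> D" "u \<noteq> s" using step.prems(1) st False by auto
    \<comment> \<open>If \<open>s\<close> lies below \<open>u\<close>, then so does
      \<open>t\<close>, which is in \<open>D'\<close> and has the color of \<open>s\<close>.\<close>
    have nsu: "c s \<noteq> c u \<and> \<not> adj (c s) (c u)" if "s < u"
      using step.prems(2)[of t] that st by auto
    have IH: "\<exists>x\<in>minimals F. c x = c u \<and> D - {u} \<in> excited c P (F - {x})"
      by (rule step.IH[OF u(1)]) (use below nsu in auto)
    have "t \<noteq> u" using False .
    have "excite c P (D - {u}) (D' - {u})"
      by (rule exciteI[of s _ t]) (use st(1-6) bspec[OF st(7)] st(8) u False in auto)
    then show ?thesis using IH excited_step by blast
  qed
qed

text \<open>The element \<open>x\<close> slides down its color class one element at a time. Nothing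
  in \<open>D\<close> below it can block a move, and the class ends at \<open>p\<close> because
  elements of equal color are comparable.\<close>

lemma excited_lower:
  assumes h: "heap c P" and p: "p \<in> minimals P" and D: "D \<subseteq> P"
    and x: "x \<in> D" "p \<notin> D" "c x = c p" "\<And>w. w \<in> D \<Longrightarrow> w < x \<Longrightarrow> c w \<noteq> c x \<and> \<not> adj (c w) (c x)"
  shows "insert p (D - {x}) \<in> excited c P D"
  using D x
proof (induction "card {w \<in> P. w < x}" arbitrary: D x rule: less_induct)
  case less
  note prems = less.prems
  have xP: "x \<in> P" and pP: "p \<in> P" using prems p by (auto simp: minimals_iff)
  have "x \<noteq> p" using prems by auto
  then have px: "p < x" using heap_comparable[OF h xP pP] prems xP p
    by (auto simp: minimals_iff order_le_less)
  have fin: "finite P" using heap_finite[OF h] .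
  obtain v where v: "v \<in> P" "v < x \<and> c v = c x" and vmax: "\<And>r. r \<in> P \<Longrightarrow> r < x \<and> c r = c x \<Longrightarrow> \<not> v < r"
    using ex_maximal_such[OF fin pP, of "\<lambda>r. r < x \<and> c r = c x"] px prems by auto
  have vD: "v \<notin> D" using prems(5)[of v] v by auto
  have e: "excite c P D (insert v (D - {x}))"
    by (rule exciteI[of x _ v]) (use prems v vD vmax in auto)
  show ?case
  proof (cases "v = p")
    case True
    then show ?thesis using e excited_self excited_step by blast
  next
    case False
    have "insert p (insert v (D - {x}) - {v}) \<in> excited c P (insert v (D - {x}))"
    proof (rule less.hyps)
      show "card {w \<in> P. w < v} < card {w \<in> P. w < x}"
        using v fin by (intro psubset_card_mono) auto
      show "insert v (D - {x}) \<subseteq> P" "v \<in> insert v (D - {x})" "p \<notin> insert v (D - {x})" "c v = c p"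
        using prems v False by auto
      fix w assume w: "w \<in> insert v (D - {x})" "w < v"
      then have "w < x" "w \<in> D" using v by auto
      then show "c w \<noteq> c v \<and> \<not> adj (c w) (c v)" using prems(5)[of w] v by auto
    qed
    moreover have "insert v (D - {x}) - {v} = D - {x}" using vD by auto
    moreover have "insert v (D - {x}) \<in> excited c P D" using e excited_self excited_step by blast
    ultimately show ?thesis using excited_trans by metis
  qed
qed

text \<open>A minimal element of \<open>P\<close> lying in \<open>F\<close> has nothing below it to
  move to, and being occupied it is never the target of a move.\<close>

lemma excited_minimal_in:
  assumes p: "p \<in> minimals P" "p \<in> F"
  shows "excited c P F = insert p ` excited c (P - {p}) (F - {p})"
proof -
  have "p \<in> D \<and> D - {p} \<in> excited c (P - {p}) (F - {p})" if "D \<in> excited c P F" for D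
    using that
  proof (induction rule: excited_induct)
    case base
    then show ?case using p excited_self by blast
  next
    case (step D D')
    then show ?case using excite_remove[OF step.hyps(2) p(1)] excited_step by blast
  qed
  then have "D \<in> insert p ` excited c (P - {p}) (F - {p})" if "D \<in> excited c P F" for D
    using that by (metis image_eqI insert_Diff)
  moreover have "insert p D \<in> excited c P F" if "D \<in> excited c (P - {p}) (F - {p})" for D
    using excited_mono(2)[OF that p(1)] p(2) by (simp add: insert_absorb)
  ultimately show ?thesis by blast
qed

text \<open>As in a subword formula, the leftmost letter \<open>p\<close> is skipped or used. If it
  is used, it holds an element that started at a minimal \<open>x\<close> of \<open>F\<close>. An
  element parked at \<open>p\<close> never lies between the ends of another move, so the others form
  an excited diagram of \<open>F - {x}\<close>.\<close>

lemma excited_minimal_notin: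
  assumes h: "heap c P" and F: "order_filter P F" and p: "p \<in> minimals P" "p \<notin> F"
  shows "excited c P F = excited c (P - {p}) F \<union>
    (\<Union>x\<in>{x \<in> minimals F. c x = c p}. insert p ` excited c (P - {p}) (F - {x}))" (is "_ = ?R")
proof
  have h': "heap c (P - {p})" using heap_remove_minimal[OF h p(1)] .
  have F': "order_filter (P - {p}) F" using F p unfolding order_filter_def by blast
  have pP: "p \<in> P" using p by (simp add: minimals_iff)
  show "excited c P F \<subseteq> ?R"
  proof
    fix D assume "D \<in> excited c P F"
    then show "D \<in> ?R"
    proof (induction rule: excited_induct)
      case base
      then show ?case using excited_self by blast
    next
      case (step D D')
      consider "D \<in> excited c (P - {p}) F"
        | x where "x \<in> minimals F" "c x = c p" "D \<in> insert p ` excited c (P - {p}) (F - {x})"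
        using step.IH by blast
      then show ?case
      proof cases
        case 1
        have DP: "D \<subseteq> P - {p}" using excited_subset[OF 1] F' by (simp add: order_filter_def)
        obtain u v where uv: "u \<in> D" "v \<in> P" "v \<notin> D" "v < u" "c v = c u"
          "\<forall>w\<in>P. v < w \<longrightarrow> w < u \<longrightarrow> c w \<noteq> c u"
          "\<forall>w\<in>D. v < w \<longrightarrow> w < u \<longrightarrow> \<not> adj (c w) (c u)" "D' = insert v (D - {u})"
          using step.hyps(2) by (elim exciteE)
        show ?thesis
        proof (cases "v = p")
          case True
          have "\<exists>x\<in>minimals F. c x = c u \<and> D - {u} \<in> excited c (P - {p}) (F - {x})"
          proof (rule excited_delete_minimal[OF h' F' 1 uv(1)])
            fix w assume w: "w \<in> D" "w < u"
            show "c w \<noteq> c u \<and> \<not> adj (c w) (c u)"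
            proof (rule ccontr)
              assume n: "\<not> (c w \<noteq> c u \<and> \<not> adj (c w) (c u))"
              then have "w \<le> p \<or> p \<le> w"
                using heap_comparable[OF h, of w p] w DP uv pP True by auto
              then have "p < w" using w DP p by (auto simp: minimals_iff order_le_less)
              then show False using bspec[OF uv(6), of w] bspec[OF uv(7), of w] w n DP True by auto
            qed
          qed
          then show ?thesis using uv True by auto
        next
          case False
          have "excite c (P - {p}) D D'"
            by (rule exciteI[OF uv(1) _ uv(3-5) _ _ uv(8)]) (use uv(2,6,7) False in blast)+
          then show ?thesis by (rule UnI1[OF excited_step[OF 1]])
        qed
      next
        case 2
        then obtain D1 where D1: "D1 \<in> excited c (P - {p}) (F - {x})" "D = insert p D1" by blast
        have "D1 \<subseteq> P - {p}" using excited_subset[OF D1(1)] F' by (auto simp: order_filter_def)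
        then have "D1 = D - {p}" using D1 by auto
        then have "D' - {p} \<in> excited c (P - {p}) (F - {x})" "p \<in> D'"
          using excite_remove[OF step.hyps(2) p(1)] D1 excited_step by auto
        then have "D' \<in> insert p ` excited c (P - {p}) (F - {x})"
          by (metis image_eqI insert_Diff)
        then show ?thesis using 2 by blast
      qed
    qed
  qed
  show "?R \<subseteq> excited c P F"
  proof
    fix D assume "D \<in> ?R"
    then consider "D \<in> excited c (P - {p}) F"
      | x D1 where "x \<in> minimals F" "c x = c p" "D1 \<in> excited c (P - {p}) (F - {x})" "D = insert p D1"
      by blast
    then show "D \<in> excited c P F"
    proof cases
      case 1
      then show ?thesis using excited_mono(1)[OF _ p(1)] by blast
    next
      case 2
      \<comment> \<open>Here \<open>x\<close> is slid down to \<open>p\<close> before the others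
        move, and their excitations are then performed with \<open>p\<close> occupied.\<close>
      have "insert p (F - {x}) \<in> excited c P F"
        by (rule excited_lower[OF h p(1)]) (use F p 2 in \<open>auto simp: order_filter_def minimals_iff\<close>)
      then show ?thesis using excited_mono(2)[OF 2(3) p(1)] 2 excited_trans by blast
    qed
  qed
qed

end

section \<open>The Chevalley formula\<close>

context simply_laced
begin

definition xi :: "('a::order \<Rightarrow> 'i) \<Rightarrow> 'a set \<Rightarrow> ('i \<Rightarrow> 'r::comm_ring_1) \<Rightarrow> 'a set \<Rightarrow> 'r" where
  "xi c P a F = (\<Sum>D\<in>excited c P F. \<Prod>q\<in>D. inv_root c P a q)"

lemma finite_excited: "finite P \<Longrightarrow> F \<subseteq> P \<Longrightarrow> finite (excited c P F)"
  by (rule finite_subset[of _ "Pow P"]) (auto dest: excited_subset)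

lemma prod_root_remove:
  assumes "heap c P" "p \<in> minimals P" "D \<subseteq> P - {p}"
  shows "(\<Prod>q\<in>D. inv_root c P a q) = (\<Prod>q\<in>D. inv_root c (P - {p}) (reflect (c p) a) q)"
  by (intro prod.cong refl root_remove[OF assms(1,2)]) (use assms(3) in auto)

lemma sum_prod_insert_minimal:
  assumes h: "heap c P" and p: "p \<in> minimals P" and G: "G \<subseteq> P - {p}"
  shows "(\<Sum>D\<in>insert p ` excited c (P - {p}) G. \<Prod>q\<in>D. inv_root c P a q) =
    a (c p) * xi c (P - {p}) (reflect (c p) a) G"
proof -
  have fin: "finite P" using heap_finite[OF h] .
  have D: "D \<subseteq> P - {p}" if "D \<in> excited c (P - {p}) G" for D
    using excited_subset[OF that G] .
  have inj: "inj_on (insert p) (excited c (P - {p}) G)"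
    using D by (intro inj_onI) (metis Diff_insert_absorb insert_Diff_single subset_Diff_insert)
  have "(\<Prod>q\<in>insert p D. inv_root c P a q) = a (c p) * (\<Prod>q\<in>D. inv_root c (P - {p}) (reflect (c p) a) q)"
    if "D \<in> excited c (P - {p}) G" for D
  proof -
    have "finite D" "p \<notin> D" using D[OF that] fin finite_subset[of D "P - {p}"] by auto
    then show ?thesis using root_minimal[OF h p, of a] prod_root_remove[OF h p D[OF that], of a] by simp
  qed
  then show ?thesis
    unfolding xi_def sum.reindex[OF inj] sum_distrib_left by (intro sum.cong) simp_all
qed

lemma xi_minimal_in:
  assumes h: "heap c P" and p: "p \<in> minimals P" "p \<in> F" and F: "order_filter P F"
  shows "xi c P a F = a (c p) * xi c (P - {p}) (reflect (c p) a) (F - {p})"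
proof -
  have "F - {p} \<subseteq> P - {p}" using F by (auto simp: order_filter_def)
  from sum_prod_insert_minimal[OF h p(1) this, of a] show ?thesis
    by (simp add: xi_def[of c P] excited_minimal_in[OF p])
qed

text \<open>The sum over \<open>x\<close> has at most one term, since minimal elements of
  \<open>F\<close> of equal color coincide; written as a sum, it covers the case without such an
  element as well.\<close>

lemma xi_minimal_notin:
  assumes h: "heap c P" and p: "p \<in> minimals P" "p \<notin> F" and F: "order_filter P F"
  shows "xi c P a F = xi c (P - {p}) (reflect (c p) a) F +
    a (c p) * (\<Sum>x\<in>{x \<in> minimals F. c x = c p}. xi c (P - {p}) (reflect (c p) a) (F - {x}))"
proof -
  let ?P' = "P - {p}" and ?X = "{x \<in> minimals F. c x = c p}"
  let ?E = "\<lambda>x. insert p ` excited c ?P' (F - {x})"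
  let ?g = "\<lambda>D. \<Prod>q\<in>D. inv_root c P a q"
  have fin: "finite P" using heap_finite[OF h] .
  have FP: "F \<subseteq> P" using F by (simp add: order_filter_def)
  have F': "F \<subseteq> ?P'" using FP p by auto
  have finX: "finite ?X"
    using finite_subset[OF FP fin] by (auto intro: finite_subset[of _ F] simp: minimals_def)
  have X: "x = y" if "x \<in> ?X" "y \<in> ?X" for x y
    using minimals_color_unique[OF h FP] that by auto
  have finE: "finite (excited c ?P' G)" if "G \<subseteq> F" for G
    using finite_excited[of ?P' G] fin F' that by auto
  have "xi c P a F = sum ?g (excited c ?P' F) + sum ?g (\<Union>x\<in>?X. ?E x)"
    unfolding xi_def excited_minimal_notin[OF h F p]
  proof (rule sum.union_disjoint)
    show "finite (\<Union>x\<in>?X. ?E x)" using finX finE by auto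
    show "excited c ?P' F \<inter> (\<Union>x\<in>?X. ?E x) = {}"
      using excited_subset[OF _ F'] by blast
  qed (rule finE, simp)
  also have "sum ?g (\<Union>x\<in>?X. ?E x) = (\<Sum>x\<in>?X. sum ?g (?E x))"
    by (rule sum.UNION_disjoint[OF finX]) (use finE X in auto)
  also have "\<dots> = (\<Sum>x\<in>?X. a (c p) * xi c ?P' (reflect (c p) a) (F - {x}))"
    by (intro sum.cong refl sum_prod_insert_minimal[OF h p(1)]) (use F' in auto)
  also have "sum ?g (excited c ?P' F) = xi c ?P' (reflect (c p) a) F"
    unfolding xi_def
    by (intro sum.cong refl prod_root_remove[OF h p(1)] excited_subset[OF _ F'])
  finally show ?thesis by (simp add: sum_distrib_left)
qed

text \<open>Let \<open>k\<close> be the color of a minimal \<open>p\<close> outside \<open>F\<close>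
  and \<open>e\<close> the pairing of \<open>F\<close> with \<open>k\<close>. Removing
  \<open>p\<close> and reflecting turns the factor \<open>A\<close> into \<open>A - e * a k\<close>.
  The value of \<open>e\<close> decides whether \<open>k\<close> can be added to \<open>F\<close> or
  removed from it, and the two recursions of \<open>xi\<close> produce exactly the compensating
  terms.\<close>

theorem chevalley:
  assumes "heap c P" "order_filter P F"
  shows "(\<Sum>q\<in>P - F. a (c q)) * xi c P a F = (\<Sum>q\<in>maximals (P - F). xi c P a (insert q F))"
  using assms
proof (induction "card P" arbitrary: P F a rule: less_induct)
  case less
  note h = less.prems(1) and F = less.prems(2)
  have fin: "finite P" using heap_finite[OF h] .
  have FP: "F \<subseteq> P" and up: "\<And>x y. x \<in> F \<Longrightarrow> y \<in> P \<Longrightarrow> x \<le> y \<Longrightarrow> y \<in> F"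
    using F unfolding order_filter_def by (auto simp: order_le_less)
  show ?case
  proof (cases "P = {}")
    case True
    then show ?thesis by (simp add: maximals_def)
  next
    case False
    then obtain p where p: "p \<in> minimals P" using minimals_nonempty[OF fin] by blast
    then have pP: "p \<in> P" and pmin: "\<And>z. z \<in> P \<Longrightarrow> \<not> z < p" by (auto simp: minimals_iff)
    define P' where "P' = P - {p}"
    define k where "k = c p"
    define a' where "a' = reflect k a"
    define A where "A = (\<Sum>q\<in>P - F. a (c q))"
    define e where "e = pairing c F k"
    have card: "card P' < card P" unfolding P'_def by (rule card_Diff1_less[OF fin pP])
    have h': "heap c P'" unfolding P'_def by (rule heap_remove_minimal[OF h p])
    have C: "(\<Sum>q\<in>P - F. cartan k (c q)) = e + 1"
      using sum_cartan_complement[OF h F p] by (simp add: k_def e_def)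
    have xi_in: "xi c P a G = a k * xi c P' a' (G - {p})" if "p \<in> G" "order_filter P G" for G
      unfolding P'_def a'_def k_def by (rule xi_minimal_in[OF h p that])
    have xi_notin: "xi c P a G =
        xi c P' a' G + a k * (\<Sum>x\<in>{x \<in> minimals G. c x = k}. xi c P' a' (G - {x}))"
      if "p \<notin> G" "order_filter P G" for G
      unfolding P'_def a'_def k_def by (rule xi_minimal_notin[OF h p that])
    have ins: "order_filter P (insert q F)" if "q \<in> maximals (P - F)" for q
      by (rule order_filter_insert_maximal[OF F that])
    show ?thesis
    proof (cases "p \<in> F")
      case True
      have F': "order_filter P' (F - {p})" using F unfolding P'_def order_filter_def by blast
      have PF: "P' - (F - {p}) = P - F" using True by (auto simp: P'_def)
      have "p \<in> minimals F" using True p FP by (auto simp: minimals_iff)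
      then have "e = -1" using pairing_removable(2)[OF h F, of k] by (auto simp: e_def k_def)
      then have "(\<Sum>q\<in>P - F. a' (c q)) = A"
        unfolding a'_def sum_reflect C A_def by simp
      then have "A * xi c P' a' (F - {p}) = (\<Sum>q\<in>maximals (P - F). xi c P' a' (insert q (F - {p})))"
        using less.hyps[OF card h' F', of a'] unfolding PF by simp
      then have "A * xi c P a F = (\<Sum>q\<in>maximals (P - F). a k * xi c P' a' (insert q (F - {p})))"
        unfolding xi_in[OF True F] by (simp add: sum_distrib_left[symmetric] mult.left_commute[of A])
      also have "\<dots> = (\<Sum>q\<in>maximals (P - F). xi c P a (insert q F))"
      proof (rule sum.cong[OF refl])
        fix q assume q: "q \<in> maximals (P - F)"
        then have "q \<noteq> p" using True by (auto simp: maximals_def)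
        then have "insert q F - {p} = insert q (F - {p})" by auto
        then show "a k * xi c P' a' (insert q (F - {p})) = xi c P a (insert q F)"
          using xi_in[OF _ ins[OF q]] True by simp
      qed
      finally show ?thesis by (simp add: A_def)
    next
      case False
      have F': "order_filter P' F" using F False unfolding P'_def order_filter_def by blast
      have ex: "\<exists>q\<in>P - F. c q = k" using pP False by (auto simp: k_def)
      define M where "M = maximals (P - F)"
      have finM: "finite M" using fin by (auto simp: M_def maximals_def)
      have M': "maximals (P' - F) = M - {p}"
      proof -
        have "q \<in> maximals (P' - F) \<longleftrightarrow> q \<in> M - {p}" for q
          using pmin[of q] pmin unfolding M_def P'_def Diff_iff maximals_iff by blast
        then show ?thesis by blast
      qed
      have PF: "P - F = insert p (P' - F)" "p \<notin> P' - F" "finite (P' - F)"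
        using pP False fin by (auto simp: P'_def)
      \<comment> \<open>Reflection subtracts \<open>(e + 1) * a k\<close> from the sum over
        \<open>P - F\<close>, and leaving out \<open>p\<close> removes its reflected value
        \<open>- a k\<close>.\<close>
      have A': "(\<Sum>q\<in>P' - F. a' (c q)) = A - of_int e * a k"
      proof -
        have C': "(\<Sum>q\<in>P' - F. cartan k (c q)) = e - 1"
          using C unfolding PF(1) sum.insert[OF PF(3,2)] by (simp add: k_def)
        moreover have "A = a k + (\<Sum>q\<in>P' - F. a (c q))"
          unfolding A_def PF(1) sum.insert[OF PF(3,2)] by (simp add: k_def)
        ultimately show ?thesis unfolding a'_def sum_reflect C' by (simp add: algebra_simps)
      qed
      have IH: "(A - of_int e * a k) * xi c P' a' F = (\<Sum>q\<in>M - {p}. xi c P' a' (insert q F))"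
        using less.hyps[OF card h' F', of a'] unfolding A' M' .
      have minF: "x \<in> minimals F" if "x \<in> minimals (insert q F)" "c x = k" "c q \<noteq> k" for x q
        using that by (auto simp: minimals_iff)
      have xiF: "xi c P a F = xi c P' a' F + a k * (\<Sum>x\<in>{x \<in> minimals F. c x = k}. xi c P' a' (F - {x}))"
        by (rule xi_notin[OF False F])
      have pM: "c p = k" by (simp add: k_def)
      have "e \<le> 1" "-1 \<le> e" unfolding e_def
        using pairing_addable(1)[OF h F ex] pairing_removable(1)[OF h F] by auto
      then consider (add) "e = 1" | (none) "e = 0" | (rem) "e = -1" by linarith
      then have "A * xi c P a F = (\<Sum>q\<in>M. xi c P a (insert q F))"
      proof cases
        \<comment> \<open>The missing \<open>a k * xi c P' a' F\<close> comes from the addable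
          \<open>q0\<close>. If \<open>q0 = p\<close>, it is the whole term of \<open>q0\<close>,
          which has no counterpart in \<open>P'\<close>; otherwise it arises because
          \<open>q0\<close> can be removed again from \<open>insert q0 F\<close>.\<close>
        case add
        then obtain q0 where q0: "q0 \<in> M" "c q0 = k"
          using pairing_addable(2)[OF h F ex] by (auto simp: e_def M_def)
        have noF: "{x \<in> minimals F. c x = k} = {}"
          using pairing_removable(2)[OF h F, of k] add by (auto simp: e_def)
        have uniq: "c q \<noteq> k" if "q \<in> M" "q \<noteq> q0" for q
          using heap_comparable[OF h, of q q0] that q0 by (auto simp: M_def maximals_iff order_le_less)
        have other: "xi c P a (insert q F) = xi c P' a' (insert q F)" if q: "q \<in> M - {q0}" for q
        proof -
          have cq: "c q \<noteq> k" using uniq q by blast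
          then have pn: "p \<notin> insert q F" using False pM by auto
          have E: "{x \<in> minimals (insert q F). c x = k} = {}" using minF[OF _ _ cq] noF by blast
          have "q \<in> maximals (P - F)" using q by (simp add: M_def)
          from xi_notin[OF pn ins[OF this]] show ?thesis unfolding E by simp
        qed
        have "(\<Sum>q\<in>M. xi c P a (insert q F)) = xi c P a (insert q0 F) + (\<Sum>q\<in>M - {q0}. xi c P' a' (insert q F))"
          using sum.remove[OF finM q0(1), of "\<lambda>q. xi c P a (insert q F)"] other by simp
        also have "\<dots> = a k * xi c P' a' F + (\<Sum>q\<in>M - {p}. xi c P' a' (insert q F))"
        proof (cases "q0 = p")
          case True
          then have "insert q0 F - {p} = F" using False by auto
          then show ?thesis using xi_in[OF _ ins] q0 True by (simp add: M_def)
        next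
          case False': False
          have "q0 \<notin> F" "q0 \<in> P" using q0 by (auto simp: M_def maximals_iff)
          then have "q0 \<in> minimals (insert q0 F)" using up by (auto simp: minimals_iff order_less_imp_le)
          moreover have "x = q0" if "x \<in> minimals (insert q0 F)" "c x = k" for x
            using minimals_color_unique[OF h _ that(1), of q0] calculation that q0 FP \<open>q0 \<in> P\<close> by auto
          ultimately have E: "{x \<in> minimals (insert q0 F). c x = k} = {q0}" using q0 by blast
          have E': "insert q0 F - {q0} = F" using \<open>q0 \<notin> F\<close> by auto
          have pn: "p \<notin> insert q0 F" using False False' by auto
          have "xi c P a (insert q0 F) = xi c P' a' (insert q0 F) + a k * xi c P' a' F"
            using xi_notin[OF pn ins[OF q0(1)[unfolded M_def]]] unfolding E by (simp add: E')
          moreover have "p \<notin> M" using uniq False' pM by blast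
          ultimately show ?thesis using sum.remove[OF finM q0(1), of "\<lambda>q. xi c P' a' (insert q F)"] by simp
        qed
        finally show ?thesis using IH xiF unfolding noF add by (simp add: algebra_simps)
      next
        case none
        then have cM: "c q \<noteq> k" if "q \<in> M" for q
          using pairing_addable(2)[OF h F ex] that by (auto simp: e_def M_def)
        have noF: "{x \<in> minimals F. c x = k} = {}"
          using pairing_removable(2)[OF h F, of k] none by (auto simp: e_def)
        have "xi c P a (insert q F) = xi c P' a' (insert q F)" if q: "q \<in> M" for q
        proof -
          have pn: "p \<notin> insert q F" using False pM cM[OF q] by auto
          have E: "{x \<in> minimals (insert q F). c x = k} = {}" using minF[OF _ _ cM[OF q]] noF by blast
          show ?thesis using xi_notin[OF pn ins[OF q[unfolded M_def]]] unfolding E by simp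
        qed
        moreover have "M - {p} = M" using cM pM by blast
        ultimately show ?thesis using IH xiF unfolding noF none by simp
      next
        \<comment> \<open>The induction hypothesis is used a second time, for
          \<open>G = F - {x}\<close>; its factor is \<open>A\<close>, since \<open>x\<close>
          contributes \<open>- a k\<close>. An element \<open>q\<close> below \<open>x\<close> drops
          out on both sides: it is not maximal in \<open>P' - G\<close>, and it keeps
          \<open>x\<close> from being minimal in \<open>insert q F\<close>.\<close>
        case rem
        then have cM: "c q \<noteq> k" if "q \<in> M" for q
          using pairing_addable(2)[OF h F ex] that by (auto simp: e_def M_def)
        have Mp: "M - {p} = M" using cM pM by blast
        obtain x where x: "x \<in> minimals F" "c x = k"
          using pairing_removable(2)[OF h F, of k] rem by (auto simp: e_def)
        have X: "{x \<in> minimals F. c x = k} = {x}"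
        proof -
          have "y = x" if "y \<in> minimals F" "c y = k" for y
            by (rule minimals_color_unique[OF h FP that(1) x(1)]) (simp add: that x(2))
          then show ?thesis using x by blast
        qed
        have xF: "x \<in> F" "x \<in> P" "x \<noteq> p" using x False FP by (auto simp: minimals_iff)
        define G where "G = F - {x}"
        have G: "order_filter P G" unfolding G_def by (rule order_filter_remove_minimal[OF F x(1)])
        have G': "order_filter P' G" using G False unfolding P'_def order_filter_def G_def by blast
        have PG: "P' - G = insert x (P' - F)" "x \<notin> P' - F" using xF by (auto simp: G_def P'_def)
        have AG: "(\<Sum>q\<in>P' - G. a' (c q)) = A"
          using A' unfolding PG(1) sum.insert[OF PF(3) PG(2)] x rem
          by (simp add: a'_def reflect_self)
        have MG: "maximals (P' - G) = insert x {q \<in> M. \<not> q < x}"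
        proof -
          have "\<not> x < q" if "q \<in> P' - F" for q using that up xF by (auto simp: P'_def order_less_imp_le)
          then show ?thesis unfolding PG(1) using M' Mp by (auto simp: maximals_iff)
        qed
        have xM: "x \<notin> {q \<in> M. \<not> q < x}" "finite {q \<in> M. \<not> q < x}"
          using xF finM by (simp_all add: M_def maximals_iff[of x])
        have "insert x G = F" using xF by (auto simp: G_def)
        then have IHG: "A * xi c P' a' G = xi c P' a' F + (\<Sum>q\<in>{q \<in> M. \<not> q < x}. xi c P' a' (insert q G))"
          using less.hyps[OF card h' G', of a'] unfolding AG MG sum.insert[OF xM(2,1)] by simp
        have step: "xi c P a (insert q F) = xi c P' a' (insert q F) +
            a k * (if \<not> q < x then xi c P' a' (insert q G) else 0)" if q: "q \<in> M" for q
        proof -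
          have qF: "q \<notin> F" using q by (auto simp: M_def maximals_iff)
          have E: "{y \<in> minimals (insert q F). c y = k} = (if \<not> q < x then {x} else {})"
          proof -
            have "y = x" if "y \<in> minimals (insert q F)" "c y = k" for y
              using minF[OF that cM[OF q]] that X by blast
            moreover have "x \<in> minimals (insert q F) \<longleftrightarrow> \<not> q < x"
              using x by (auto simp: minimals_iff)
            ultimately show ?thesis using x by auto
          qed
          have E': "insert q F - {x} = insert q G" using qF xF by (auto simp: G_def)
          have pn: "p \<notin> insert q F" using False pM cM[OF q] by auto
          show ?thesis using xi_notin[OF pn ins[OF q[unfolded M_def]]] unfolding E by (simp add: E')
        qed
        have "(\<Sum>q\<in>M. xi c P a (insert q F)) = (\<Sum>q\<in>M. xi c P' a' (insert q F)) +
            a k * (\<Sum>q\<in>M. if \<not> q < x then xi c P' a' (insert q G) else 0)"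
          using step by (simp add: sum.distrib sum_distrib_left)
        also have "(\<Sum>q\<in>M. if \<not> q < x then xi c P' a' (insert q G) else 0) =
            (\<Sum>q\<in>{q \<in> M. \<not> q < x}. xi c P' a' (insert q G))"
          by (rule sum.inter_filter[OF finM, symmetric])
        also have "\<dots> = A * xi c P' a' G - xi c P' a' F" using IHG by simp
        also have "(\<Sum>q\<in>M. xi c P' a' (insert q F)) = (A + a k) * xi c P' a' F"
          using IH unfolding Mp rem by simp
        finally have "(\<Sum>q\<in>M. xi c P a (insert q F)) = A * (xi c P' a' F + a k * xi c P' a' G)"
          by (simp add: algebra_simps)
        then show ?thesis using xiF unfolding X G_def by simp
      qed
      then show ?thesis by (simp add: A_def M_def)
    qed
  qed
qed

end

section \<open>Inversion roots as hooks\<close>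

context simply_laced
begin

text \<open>An antidominant sum of simple roots pairs positively with \<open>w\<^sub>F lam\<close>. This is where the
  finiteness of \<open>P\<close> enters: it fails for heaps that continue upwards indefinitely.\<close>

lemma sum_pairing_pos:
  assumes h: "heap c P" and F: "order_filter P F" and S: "S \<subseteq> P"
    and neg: "\<And>q. q \<in> F \<Longrightarrow> (\<Sum>w\<in>S. cartan (c q) (c w)) \<le> 0"
    and x: "x \<in> F" "c x \<in> c ` S"
  shows "0 < (\<Sum>w\<in>S. pairing c F (c w))"
proof (rule ccontr)
  assume n: "\<not> ?thesis"
  have fin: "finite P" using heap_finite[OF h] .
  have FP: "F \<subseteq> P" and finF: "finite F" and finS: "finite S"
    using F S fin finite_subset by (auto simp: order_filter_def)
  let ?D = "\<lambda>q. \<Sum>w\<in>S. cartan (c q) (c w)"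
  have "(\<Sum>w\<in>S. \<Sum>q\<in>F. cartan (c w) (c q)) = (\<Sum>q\<in>F. ?D q)"
    using sum.swap[of "\<lambda>w q. cartan (c w) (c q)" F S] by (simp add: cartan_sym)
  then have "(\<Sum>w\<in>S. pairing c F (c w)) = (\<Sum>w\<in>S. lam (c w)) + (\<Sum>q\<in>F. - ?D q)"
    unfolding pairing_def by (simp add: sum_subtractf sum_negf)
  moreover have "0 \<le> (\<Sum>w\<in>S. lam (c w))" "0 \<le> (\<Sum>q\<in>F. - ?D q)"
    by (rule sum_nonneg, rule lam_nonneg) (rule sum_nonneg, use neg in simp)
  ultimately have "(\<Sum>w\<in>S. lam (c w)) = 0" "(\<Sum>q\<in>F. - ?D q) = 0" using n by linarith+
  then have l0: "lam (c w) = 0" if "w \<in> S" for w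
    using that sum_nonneg_eq_0_iff[OF finS, of "\<lambda>w. lam (c w)"] lam_nonneg by blast
  have "\<forall>q\<in>F. - ?D q = 0"
    using sum_nonneg_eq_0_iff[OF finF, of "\<lambda>q. - ?D q"] neg \<open>(\<Sum>q\<in>F. - ?D q) = 0\<close> by auto
  then have D0: "?D q = 0" if "q \<in> F" for q using that by auto
  \<comment> \<open>As \<open>lam\<close> vanishes on the colors of \<open>S\<close>, this
    \<open>y\<close> is not maximal in \<open>P\<close>, where the weight condition would read
    \<open>lam (c y) = 1\<close>. A cover of \<open>y\<close> then has a color that is not in
    \<open>S\<close> but adjacent to one in \<open>S\<close>, so its \<open>?D\<close> is negative
    instead of 0.\<close>
  obtain y where y: "y \<in> F" "c y \<in> c ` S" and ymax: "\<And>r. r \<in> F \<Longrightarrow> c r \<in> c ` S \<Longrightarrow> \<not> y < r"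
    using ex_maximal_such[OF finF x(1), of "\<lambda>r. c r \<in> c ` S"] x(2) by blast
  have yP: "y \<in> P" using y FP by blast
  have "lam (c y) = 0" using l0 y(2) by auto
  then have "{q \<in> P. y < q} \<noteq> {}" using heap_weight[OF h yP] by (metis diff_0_right sum.empty zero_neq_one)
  then obtain q where "q \<in> P" "y < q" by blast
  then obtain r where r: "covers P r y" using exists_cover_above[OF fin yP] by blast
  then have rF: "r \<in> F" "y < r" using y F unfolding covers_def order_filter_def by blast+
  then have rS: "\<And>w. w \<in> S \<Longrightarrow> c w \<noteq> c r" using ymax by (metis image_eqI)
  obtain w where w: "w \<in> S" "c w = c y" using y(2) by auto
  then have ne: "{w \<in> S. adj (c r) (c w)} \<noteq> {}" using heap_covers[OF h r] by auto
  have finA: "finite {w \<in> S. adj (c r) (c w)}" using finS by simp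
  have "card {w \<in> S. adj (c r) (c w)} = 0"
    using D0[OF rF(1)] sum_cartan_off_color[OF finS, of c "c r"] rS by simp
  then show False using ne card_0_eq[OF finA] by blast
qed

text \<open>Once \<open>u\<close> has been lowered as far as possible, the sum of the simple roots of the colors of \<open>S\<close>,
  with multiplicity, is antidominant but pairs nonpositively with \<open>w\<^sub>F lam\<close>.\<close>

lemma no_removable_above_interval:
  assumes "heap c P" "order_filter P F" "v \<in> P - F" "S = {w \<in> P - F. v \<le> w}"
    "u \<in> S" "\<And>w. w \<in> S \<Longrightarrow> w \<le> u" "\<And>w. w \<in> S \<Longrightarrow> c w = c u \<Longrightarrow> w = u" "v \<noteq> u"
    "pairing c F (c v) = -1"
  shows False
  using assms
proof (induction "card S" arbitrary: F S u rule: less_induct)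
  case less
  note h = less.prems(1) and F = less.prems(2) and v = less.prems(3) and S = less.prems(4)
    and u = less.prems(5) and top = less.prems(6) and uniq = less.prems(7) and vu = less.prems(8)
    and e = less.prems(9)
  have fin: "finite P" using heap_finite[OF h] .
  have FP: "F \<subseteq> P" and up: "\<And>x y. x \<in> F \<Longrightarrow> y \<in> P \<Longrightarrow> x \<le> y \<Longrightarrow> y \<in> F"
    using F unfolding order_filter_def by (auto simp: order_le_less)
  have SP: "S \<subseteq> P" "finite S" "F \<inter> S = {}" "finite F"
    using S fin finite_subset[OF FP fin] by auto
  have vS: "v \<in> S" using v S by auto
  have umax: "u \<in> maximals (P - F)"
  proof -
    have "\<not> u < z" if "z \<in> P - F" for z
    proof
      assume "u < z"
      then have "z \<in> S" using u S that by auto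
      then show False using top[of z] \<open>u < z\<close> by (meson leD)
    qed
    then show ?thesis using u S by (auto simp: maximals_iff)
  qed
  then have eu: "pairing c F (c u) = 1" using pairing_addable(2)[OF h F] u S by blast
  have FS: "order_filter P (F \<union> S)"
    unfolding order_filter_def S using FP up by (auto intro: order_trans order_less_imp_le)
  have eFS: "pairing c (F \<union> S) k = pairing c F k - (\<Sum>w\<in>S. cartan k (c w))" for k
    by (rule pairing_Un[OF SP(4,2,3)])
  \<comment> \<open>Otherwise some maximal element of \<open>P - F\<close> has the color of
    \<open>w\<close>; it lies weakly above \<open>w\<close>, hence in \<open>S\<close>, and so
    equals \<open>u\<close>.\<close>
  have e0: "pairing c F (c w) \<le> 0" if w: "w \<in> S" "c w \<noteq> c u" for w
  proof (rule ccontr)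
    assume n: "\<not> pairing c F (c w) \<le> 0"
    have wP: "w \<in> P - F" "v \<le> w" using w S by auto
    have "pairing c F (c w) \<le> 1" by (rule pairing_addable(1)[OF h F]) (use wP in blast)
    then have "pairing c F (c w) = 1" using n by simp
    then obtain q where q: "q \<in> maximals (P - F)" "c q = c w"
      using pairing_addable(2)[OF h F, of "c w"] wP by blast
    then have "w \<le> q"
      using heap_comparable[OF h, of w q] wP by (auto simp: maximals_iff order_le_less)
    then have "q \<in> S" using q wP S by (auto simp: maximals_iff)
    then have "q = u" using top[of q] q u S by (auto simp: maximals_iff order_le_less)
    then show False using q w by simp
  qed
  \<comment> \<open>The sum is the pairing at \<open>F\<close> minus the pairing at the filter
    \<open>F \<union> S\<close>. For the color of \<open>v\<close> this is at most
    \<open>-1 - (-1)\<close>. For the others the second pairing is not -1, since a removable element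
    of that color would lie in \<open>S\<close> and so be \<open>v\<close>.\<close>
  have sum0: "(\<Sum>w\<in>S. cartan (c w0) (c w)) \<le> 0" if w0: "w0 \<in> S" "c w0 \<noteq> c u" for w0
  proof (cases "c w0 = c v")
    case True
    then show ?thesis using e eFS[of "c v"] pairing_removable(1)[OF h FS, of "c v"] by simp
  next
    case False
    have "pairing c (F \<union> S) (c w0) \<noteq> -1"
    proof
      assume "pairing c (F \<union> S) (c w0) = -1"
      then obtain x where xmin: "x \<in> minimals (F \<union> S)" and xw: "c x = c w0"
        using pairing_removable(2)[OF h FS, of "c w0"] by blast
      have x: "x \<in> F \<union> S" and nx: "\<not> z < x" if "z \<in> F \<union> S" for z
        using xmin that unfolding minimals_iff by blast+
      have w0FS: "w0 \<in> F \<union> S" "w0 \<in> P" "x \<in> P" using w0 SP FP x[of w0] by auto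
      have "x \<le> w0 \<or> w0 \<le> x" by (rule heap_comparable[OF h w0FS(3,2)]) (simp add: xw)
      then have "x \<le> w0" using nx[OF w0FS(1)] by auto
      then have "x \<notin> F" using up[OF _ w0FS(2)] w0(1) SP(3) by blast
      then have "x \<in> S" using x[OF w0FS(1)] by blast
      then have "x = v" using nx[of v] vS S by (auto simp: order_le_less)
      then show False using xw False by simp
    qed
    then show ?thesis
      using pairing_removable(1)[OF h FS, of "c w0"] eFS[of "c w0"] e0[OF w0] by simp
  qed
  let ?N = "{w \<in> S. adj (c u) (c w)}"
  have sumu: "(\<Sum>w\<in>S. cartan (c u) (c w)) = 2 - int (card ?N)"
  proof -
    have "(\<Sum>w\<in>S - {u}. cartan (c u) (c w)) = - int (card {w \<in> S - {u}. adj (c u) (c w)})"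
      by (rule sum_cartan_off_color) (use SP uniq in auto)
    moreover have "{w \<in> S - {u}. adj (c u) (c w)} = ?N" using adj_irrefl by auto
    ultimately show ?thesis using sum.remove[OF SP(2) u, of "\<lambda>w. cartan (c u) (c w)"] by simp
  qed
  show False
  \<comment> \<open>With two neighbors of \<open>u\<close> in \<open>S\<close>, the sum over
    \<open>S\<close> is antidominant while its total pairing is at most \<open>1 - 1 + 0\<close>,
    against \<open>sum_pairing_pos\<close>. With fewer, \<open>S - {u}\<close> has a greatest
    element \<open>z\<close>, which can take the place of \<open>u\<close>.\<close>
  proof (cases "2 \<le> card ?N")
    case True
    obtain x where x: "x \<in> F" "c x = c v"
      using e pairing_removable(2)[OF h F, of "c v"] by (auto simp: minimals_iff)
    have "(\<Sum>w\<in>S. cartan (c q) (c w)) \<le> 0" for q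
    proof (cases "c q \<in> c ` S")
      case c: True
      then obtain w where w: "w \<in> S" "c q = c w" by auto
      then show ?thesis using sum0[OF w(1)] sumu True by (cases "c w = c u") auto
    next
      case False
      then have "(\<Sum>w\<in>S. cartan (c q) (c w)) = - int (card {w \<in> S. adj (c q) (c w)})"
        by (intro sum_cartan_off_color SP(2)) (auto simp: image_iff)
      then show ?thesis by simp
    qed
    then have "0 < (\<Sum>w\<in>S. pairing c F (c w))"
      using sum_pairing_pos[OF h F SP(1) _ x(1)] x(2) vS by auto
    also have "\<dots> = pairing c F (c u) + (pairing c F (c v) + (\<Sum>w\<in>S - {u} - {v}. pairing c F (c w)))"
      using SP(2) u vS vu by (simp add: sum.remove[of S u] sum.remove[of "S - {u}" v])
    also have "\<dots> \<le> 0"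
    proof -
      have "(\<Sum>w\<in>S - {u} - {v}. pairing c F (c w)) \<le> 0"
        by (rule sum_nonpos) (use e0 uniq in auto)
      then show ?thesis using eu e by simp
    qed
    finally show False by simp
  next
    case False
    have "v \<le> u" using top vS by blast
    then have "v < u" using vu by simp
    then obtain z where z: "covers P u z" "v \<le> z"
      using exists_cover_below[OF fin, of v u] vS u SP by blast
    have adjz: "adj (c u) (c z)" by (rule heap_covers[OF h z(1)])
    have zS: "z \<in> S"
      using z up[of z u] u S by (auto simp: covers_def order_less_imp_le)
    have finN: "finite ?N" "z \<in> ?N" using SP zS adjz by auto
    then have Nz: "w = z" if "w \<in> ?N" for w
      using that False card_le_Suc0_iff_eq[OF finN(1)] by auto
    have below: "w \<le> z" if w: "w \<in> S" "w \<noteq> u" for w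
    proof -
      have "w < u" using top w by (auto simp: order_le_less)
      then obtain r where r: "covers P u r" "w \<le> r"
        using exists_cover_below[OF fin, of w u] w u SP by blast
      have "r \<in> S" using r w up[of r u] u S by (auto simp: covers_def order_less_imp_le)
      then show ?thesis using Nz[of r] heap_covers[OF h r(1)] r by auto
    qed
    have cvu: "c v \<noteq> c u" using uniq vS vu by blast
    show False
    \<comment> \<open>If \<open>S\<close> has shrunk to \<open>{v, u}\<close>, the pairing of
      \<open>F \<union> S\<close> with \<open>c v\<close> would be -2. Otherwise \<open>u\<close> is
      absorbed into \<open>F\<close>, and the pairing with \<open>c v\<close> stays -1 because
      \<open>v\<close> is not a neighbor of \<open>u\<close>.\<close>
    proof (cases "z = v")
      case True
      have "S = {v, u}"
      proof -
        have "w = v" if "w \<in> S" "w \<noteq> u" for w using below[OF that] that True S by auto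
        then show ?thesis using vS u by auto
      qed
      then have "(\<Sum>w\<in>S. cartan (c v) (c w)) = 1"
        using vu adj_sym[OF adjz] True by simp
      then show False using eFS[of "c v"] e pairing_removable(1)[OF h FS, of "c v"] by simp
    next
      case zv: False
      have F': "order_filter P (insert u F)" by (rule order_filter_insert_maximal[OF F umax])
      have "\<not> adj (c v) (c u)" using Nz[of v] vS zv adj_sym by blast
      then have cart: "cartan (c v) (c u) = 0" using cvu by (simp add: cartan_def)
      have uF: "u \<notin> F" using u S by auto
      show False
      proof (rule less.hyps[OF _ h F', of "S - {u}" z])
        show "card (S - {u}) < card S" by (rule card_Diff1_less[OF SP(2) u])
        show "v \<in> P - insert u F" using v vu by auto
        show "S - {u} = {w \<in> P - insert u F. v \<le> w}" using S by auto
        show "z \<in> S - {u}" using zS z by (auto simp: covers_def)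
        show "w \<le> z" if "w \<in> S - {u}" for w using that below by auto
        show "w = z" if "w \<in> S - {u}" "c w = c z" for w using that Nz[of w] adjz by auto
        show "v \<noteq> z" using zv by auto
        show "pairing c (insert u F) (c v) = -1"
          using e cart uF SP(4) by (simp add: pairing_def)
      qed
    qed
  qed
qed

text \<open>The ideal below \<open>u\<close> is the complement of a filter, so it remains to see
  that the pairing at that filter is 0. It is not 1, because the only maximal element
  \<open>u\<close> of the ideal does not have the color of \<open>p\<close>; it is not -1 by
  \<open>no_removable_above_interval\<close>.\<close>

lemma sum_cartan_below:
  assumes h: "heap c P" and u: "u \<in> P" "\<And>w. w \<in> P \<Longrightarrow> w < u \<Longrightarrow> c w \<noteq> c u"
    and p: "p \<in> minimals P" "p < u"
  shows "(\<Sum>w\<in>{w \<in> P. w \<le> u}. cartan (c p) (c w)) = 1"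
proof -
  let ?F = "{w \<in> P. \<not> w \<le> u}"
  have F: "order_filter P ?F" by (rule order_filter_not_le)
  have PF: "P - ?F = {w \<in> P. w \<le> u}" by auto
  have pP: "p \<in> P" using p by (simp add: minimals_iff)
  have ex: "\<exists>q\<in>P - ?F. c q = c p" using pP p by auto
  have "pairing c ?F (c p) \<noteq> 1"
  proof
    assume "pairing c ?F (c p) = 1"
    then obtain q where q: "q \<in> maximals (P - ?F)" "c q = c p"
      using pairing_addable(2)[OF h F ex] by blast
    then have "q = u" using u by (auto simp: maximals_iff order_le_less)
    then show False using q u(2)[OF pP p(2)] by simp
  qed
  moreover have "pairing c ?F (c p) \<noteq> -1"
  proof
    assume e: "pairing c ?F (c p) = -1"
    show False
      by (rule no_removable_above_interval[OF h F, of p "{w \<in> P - ?F. p \<le> w}" u])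
        (use p u pP e in \<open>auto simp: order_le_less\<close>)
  qed
  ultimately have "pairing c ?F (c p) = 0"
    using pairing_addable(1)[OF h F ex] pairing_removable(1)[OF h F, of "c p"] by linarith
  then show ?thesis using sum_cartan_complement[OF h F p(1)] unfolding PF by simp
qed

text \<open>For a minimal \<open>p < u\<close>, reflecting lowers the sum over the ideal by
  \<open>a (c p)\<close>, and leaving out the reflected term \<open>- a (c p)\<close> of
  \<open>p\<close> raises it again. A minimal \<open>p\<close> not below \<open>u\<close> is
  incomparable to the whole ideal and changes nothing.\<close>

lemma root_hook:
  assumes "heap c P" "u \<in> P" "\<And>w. w \<in> P \<Longrightarrow> w < u \<Longrightarrow> c w \<noteq> c u"
  shows "inv_root c P a u = (\<Sum>w\<in>{w \<in> P. w \<le> u}. a (c w))"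
  using assms
proof (induction "card P" arbitrary: P a rule: less_induct)
  case less
  note h = less.prems(1) and u = less.prems(2,3)
  have fin: "finite P" using heap_finite[OF h] .
  obtain p where p: "p \<in> minimals P" using minimals_nonempty[OF fin u(1)] by blast
  then have pP: "p \<in> P" and pmin: "\<And>z. z \<in> P \<Longrightarrow> \<not> z < p" by (auto simp: minimals_iff)
  show ?case
  proof (cases "u = p")
    case True
    then have "{w \<in> P. w \<le> u} = {p}" using pP pmin by (auto simp: order_le_less)
    then show ?thesis using root_minimal[OF h p] True by simp
  next
    case False
    let ?Q = "{w \<in> P. w \<le> u}"
    have "inv_root c P a u = inv_root c (P - {p}) (reflect (c p) a) u"
      using root_remove[OF h p] u False by blast
    also have "\<dots> = (\<Sum>w\<in>{w \<in> P - {p}. w \<le> u}. reflect (c p) a (c w))"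
      by (rule less.hyps[OF card_Diff1_less[OF fin pP] heap_remove_minimal[OF h p]])
        (use u False in auto)
    also have "\<dots> = (\<Sum>w\<in>?Q. a (c w))"
    proof (cases "p < u")
      case True
      then have "p \<in> ?Q" using pP by auto
      moreover have "{w \<in> P - {p}. w \<le> u} = ?Q - {p}" by auto
      moreover have "(\<Sum>w\<in>?Q. reflect (c p) a (c w)) = (\<Sum>w\<in>?Q. a (c w)) - a (c p)"
        using sum_cartan_below[OF h u p True] by (simp only: sum_reflect of_int_1 mult_1_left)
      ultimately show ?thesis using fin sum.remove[of ?Q p "\<lambda>w. reflect (c p) a (c w)"]
        by (simp add: reflect_self)
    next
      case F: False
      have "cartan (c p) (c w) = 0" if "w \<in> ?Q" for w
      proof (rule heap_cartan_zero[OF h pP])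
        show "w \<in> P" using that by simp
        have "\<not> p \<le> u" using F False by auto
        then show "\<not> p \<le> w" using that by (auto intro: order_trans)
        then show "\<not> w \<le> p" using pmin that by (auto simp: order_le_less)
      qed
      moreover have "{w \<in> P - {p}. w \<le> u} = ?Q" using F False by auto
      ultimately show ?thesis by (intro sum.cong) (simp_all add: reflect_fixed)
    qed
    finally show ?thesis .
  qed
qed

text \<open>The claim is linear in the four inversions, and removing a minimal element other than
  \<open>v\<close> only reflects \<open>a\<close>; so \<open>v\<close> may be taken as the least
  element. Once \<open>v\<close> is removed too, \<open>u\<close>, \<open>x\<close> and
  \<open>y\<close> are lowest in their colors and \<open>root_hook\<close> applies; the extra
  \<open>f (c u)\<close> becomes minus the inversion of \<open>v\<close>. Since \<open>a\<close>
  changes on the way, \<open>sums\<close> speaks of all \<open>f\<close>.\<close>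

lemma root_top:
  assumes "heap c P" "v \<in> P" "u \<in> P" "x \<in> P" "y \<in> P" "v < x" "v < y" "v < u" "c v = c u"
    "\<And>w. w \<in> P \<Longrightarrow> v < w \<Longrightarrow> w < u \<Longrightarrow> c w \<noteq> c u"
    "\<And>w. w \<in> P \<Longrightarrow> v < w \<Longrightarrow> w < x \<Longrightarrow> c w \<noteq> c x"
    "\<And>w. w \<in> P \<Longrightarrow> v < w \<Longrightarrow> w < y \<Longrightarrow> c w \<noteq> c y"
    and sums: "\<And>f :: 'i \<Rightarrow> 'r::comm_ring_1. (\<Sum>w\<in>{w \<in> P. v < w \<and> w \<le> u}. f (c w)) =
      (\<Sum>w\<in>{w \<in> P. v < w \<and> w \<le> x}. f (c w)) + (\<Sum>w\<in>{w \<in> P. v < w \<and> w \<le> y}. f (c w)) + f (c u)"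
  shows "inv_root c P (a :: 'i \<Rightarrow> 'r) u = inv_root c P a x + inv_root c P a y - inv_root c P a v"
  using assms
proof (induction "card P" arbitrary: P a rule: less_induct)
  case less
  note h = less.prems(1) and mem = less.prems(2-5) and lt = less.prems(6-8) and cvu = less.prems(9)
    and off = less.prems(10-12) and sums = less.prems(13)
  have fin: "finite P" using heap_finite[OF h] .
  show ?case
  proof (cases "\<exists>p\<in>minimals P. p \<noteq> v")
    case True
    then obtain p where p: "p \<in> minimals P" "p \<noteq> v" by blast
    then have pP: "p \<in> P" and pmin: "\<And>z. z \<in> P \<Longrightarrow> \<not> z < p" by (auto simp: minimals_iff)
    let ?P' = "P - {p}"
    have ne: "x \<noteq> p" "y \<noteq> p" "u \<noteq> p" using lt pmin mem by blast+
    have eq: "{w \<in> ?P'. v < w \<and> w \<le> z} = {w \<in> P. v < w \<and> w \<le> z}" for z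
      using pmin mem by auto
    have "inv_root c ?P' (reflect (c p) a) u = inv_root c ?P' (reflect (c p) a) x +
        inv_root c ?P' (reflect (c p) a) y - inv_root c ?P' (reflect (c p) a) v"
      by (rule less.hyps[OF card_Diff1_less[OF fin pP] heap_remove_minimal[OF h p(1)]], unfold eq)
        (use mem lt cvu off p ne sums in auto)
    moreover have "inv_root c P a z = inv_root c ?P' (reflect (c p) a) z" if "z \<in> P" "z \<noteq> p" for z
      using root_remove[OF h p(1)] that by blast
    ultimately show ?thesis using mem ne p by simp
  next
    case False
    obtain p where p: "p \<in> minimals P" using minimals_nonempty[OF fin mem(1)] by blast
    then have v: "v \<in> minimals P" using False by metis
    have above: "v < w" if w: "w \<in> P" "w \<noteq> v" for w
    proof -
      obtain m where m: "m \<in> P" "m \<le> w" "\<And>r. r \<in> P \<Longrightarrow> r \<le> w \<Longrightarrow> \<not> r < m"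
        using ex_minimal_such[OF fin w(1), of "\<lambda>r. r \<le> w"] by blast
      then have "m \<in> minimals P" by (auto simp: minimals_iff intro: order_trans order_less_imp_le)
      then have "m = v" using False by blast
      then show ?thesis using m w by (simp add: order_less_le)
    qed
    let ?P' = "P - {v}" and ?a = "reflect (c v) a"
    have eq: "{w \<in> ?P'. w \<le> z} = {w \<in> P. v < w \<and> w \<le> z}" for z
      using above by auto
    have hook: "inv_root c P a z = (\<Sum>w\<in>{w \<in> P. v < w \<and> w \<le> z}. ?a (c w))"
      if "z \<in> P" "v < z" "\<And>w. w \<in> P \<Longrightarrow> v < w \<Longrightarrow> w < z \<Longrightarrow> c w \<noteq> c z" for z
    proof -
      have "inv_root c P a z = inv_root c ?P' ?a z" using root_remove[OF h v] that by blast
      also have "\<dots> = (\<Sum>w\<in>{w \<in> ?P'. w \<le> z}. ?a (c w))"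
        by (rule root_hook[OF heap_remove_minimal[OF h v]]) (use that above in auto)
      finally show ?thesis unfolding eq .
    qed
    have "inv_root c P a u = inv_root c P a x + inv_root c P a y + ?a (c u)"
      using hook[OF mem(2) lt(3) off(1)] hook[OF mem(3) lt(1) off(2)] hook[OF mem(4) lt(2) off(3)]
        sums[of ?a] by simp
    moreover have "?a (c u) = - inv_root c P a v"
      unfolding root_minimal[OF h v] cvu by (rule reflect_self)
    ultimately show ?thesis by simp
  qed
qed

section \<open>Nonvanishing of inversions\<close>

definition int_independent :: "'i set \<Rightarrow> ('i \<Rightarrow> 'r::comm_ring_1) \<Rightarrow> bool" where
  "int_independent S a \<longleftrightarrow>
    (\<forall>n::'i \<Rightarrow> int. (\<Sum>i\<in>S. of_int (n i) * a i) = 0 \<longrightarrow> (\<forall>i\<in>S. n i = 0))"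

lemma int_independent_nonzero:
  assumes "int_independent S a" "finite S" "j \<in> S"
  shows "a j \<noteq> 0"
proof
  assume "a j = 0"
  then have "(\<Sum>i\<in>S. of_int (if i = j then 1 else 0) * a i) = 0"
    by (intro sum.neutral) auto
  then show False using assms unfolding int_independent_def by fastforce
qed

text \<open>Reflection changes only the coefficient of \<open>j\<close>, namely by \<open>m\<close>.
  If all new coefficients vanish, then so do the old ones away from \<open>j\<close>, which leaves
  \<open>n j = m = 2 * n j\<close>.\<close>

lemma int_independent_reflect:
  assumes ind: "int_independent S a" and S: "finite S" "j \<in> S"
  shows "int_independent S (reflect j a)"
  unfolding int_independent_def
proof (intro allI impI)
  fix n :: "'i \<Rightarrow> int"
  assume 0: "(\<Sum>i\<in>S. of_int (n i) * reflect j a i) = 0"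
  define m where "m = (\<Sum>i\<in>S. n i * cartan j i)"
  define n' where "n' i = (if i = j then n i - m else n i)" for i
  have "(\<Sum>i\<in>S. of_int (n' i) * a i) = of_int (n j - m) * a j + (\<Sum>i\<in>S - {j}. of_int (n i) * a i)"
    using sum.remove[OF S, of "\<lambda>i. of_int (n' i) * a i"] by (simp add: n'_def)
  also have "\<dots> = (\<Sum>i\<in>S. of_int (n i) * a i) - of_int m * a j"
    using sum.remove[OF S, of "\<lambda>i. of_int (n i) * a i"] by (simp add: algebra_simps)
  also have "\<dots> = (\<Sum>i\<in>S. of_int (n i) * reflect j a i)"
    by (simp add: m_def reflect_def sum_subtractf sum_distrib_left algebra_simps)
  finally have n': "\<forall>i\<in>S. n' i = 0" using 0 ind unfolding int_independent_def by simp
  then have z: "n i = 0" if "i \<in> S" "i \<noteq> j" for i using that by (auto simp: n'_def)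
  have "m = n j * 2" unfolding m_def using sum.remove[OF S, of "\<lambda>i. n i * cartan j i"] z by simp
  moreover have "n j = m" using n' S by (auto simp: n'_def)
  ultimately show "\<forall>i\<in>S. n i = 0" using z by auto
qed

text \<open>Reflected indeterminates are not indeterminates, but they stay independent over the
  integers; this is the genericity that can be carried through the recursion.\<close>

lemma root_nonzero:
  assumes "heap c P" "u \<in> P" "finite S" "c ` P \<subseteq> S" "int_independent S a"
  shows "inv_root c P a u \<noteq> 0"
  using assms
proof (induction "card P" arbitrary: P a rule: less_induct)
  case less
  note h = less.prems(1) and u = less.prems(2) and S = less.prems(3,4) and ind = less.prems(5)
  have fin: "finite P" using heap_finite[OF h] .
  obtain p where p: "p \<in> minimals P" using minimals_nonempty[OF fin u] by blast
  then have pP: "p \<in> P" by (simp add: minimals_iff)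
  show ?case
  proof (cases "u = p")
    case True
    then show ?thesis using root_minimal[OF h p, of a] int_independent_nonzero[OF ind S(1)] S pP by auto
  next
    case False
    have "inv_root c (P - {p}) (reflect (c p) a) u \<noteq> 0"
      by (rule less.hyps[OF card_Diff1_less[OF fin pP] heap_remove_minimal[OF h p]])
        (use u False S pP int_independent_reflect[OF ind S(1)] in auto)
    then show ?thesis using root_remove[OF h p, of u a] u False by simp
  qed
qed

end

section \<open>Double-tailed diamonds in \<open>d\<close>-complete posets\<close>

text \<open>Peeling off both ends of a double-tailed diamond allows proofs by induction on
  \<open>k\<close>, with the plain diamond as the base.\<close>

lemma dk_interval_cases:
  assumes "dk_interval P k v u"
  obtains (diamond) x y where "k = 3" "x \<noteq> y" "interval P v u = {u, v, x, y}"
      "covers P u x" "covers P u y" "covers P x v" "covers P y v"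
    | (tail) l v' u' where "k = Suc l" "dk_interval P l v' u'"
      "interval P v u = insert u (insert v (interval P v' u'))"
      "covers P u u'" "covers P v' v" "u \<notin> interval P v' u'" "v \<notin> interval P v' u'"
proof (cases "k = 3")
  case True
  obtain x y where xy: "x \<noteq> y" "interval P v u - {u, v} = {x, y}" "covers P u x" "covers P u y"
    using d3_interval_covers assms True by blast
  have uv: "u \<in> P" "v \<in> P" "v < u"
    using assms dk_minus_convex_of_interval(3)[OF assms] by (auto simp: dk_interval_def)
  then have "u \<in> interval P v u" "v \<in> interval P v u" by (auto simp: interval_def)
  then have I: "interval P v u = {u, v, x, y}" using xy(2) by blast
  have cov: "covers P a v" if a: "a \<in> {x, y}" for a
  proof -
    have aI: "a \<in> interval P v u - {u, v}" using a xy(2) by blast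
    then have av: "a \<in> P" "v < a" "a < u" by (auto simp: interval_def order_le_less)
    have "\<not> (v < z \<and> z < a)" if z: "z \<in> P" for z
    proof
      assume vz: "v < z \<and> z < a"
      then have "z \<in> interval P v u - {u, v}" using z av by (auto simp: interval_def)
      then have "z \<in> {x, y}" using xy(2) by blast
      then have "covers P u z" using xy by blast
      then show False using vz av by (auto simp: covers_def)
    qed
    then show ?thesis using av uv by (auto simp: covers_def)
  qed
  show ?thesis by (rule diamond[OF True xy(1) I xy(3,4) cov cov]) simp_all
next
  case False
  then have k: "3 \<le> k - 1" "k = Suc (k - 1)" using assms by (auto simp: dk_interval_def)
  obtain v' u' where i: "dk_interval P (k - 1) v' u'" "interval P v u - {u, v} = interval P v' u'"
      "covers P u u'" "covers P v' v"
    using dk_interval_inner[of P "k - 1" v u] assms k by auto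
  have "u \<in> interval P v u" "v \<in> interval P v u"
    using assms dk_minus_convex_of_interval(3)[OF assms] by (auto simp: interval_def dk_interval_def)
  then have "interval P v u = insert u (insert v (interval P v' u'))"
      "u \<notin> interval P v' u'" "v \<notin> interval P v' u'"
    using i(2) by blast+
  then show ?thesis using tail[OF k(2) i(1) _ i(3,4)] by blast
qed

lemma dk_interval_less: "dk_interval P k v u \<Longrightarrow> v < u"
  by (rule dk_minus_convex_of_interval(3))

lemma dk_interval_in: "dk_interval P k v u \<Longrightarrow> v \<in> P \<and> u \<in> P"
  by (simp add: dk_interval_def)

lemma interval_covers: "covers P b a \<Longrightarrow> interval P a b = {a, b}"
  by (auto simp: interval_def covers_def order_le_less)

lemma top_forest_up: "x \<in> top_forest P \<Longrightarrow> y \<in> P \<Longrightarrow> x \<le> y \<Longrightarrow> y \<in> top_forest P"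
  unfolding top_forest_def using order_trans by blast

text \<open>The completion axiom leaves the ends of the resulting interval unnamed. As
  \<open>u\<close> covers the maximal elements, it lies above all of the finite set
  \<open>S\<close>, so the ends can only be \<open>u\<close> and the least element
  \<open>v\<close>.\<close>

lemma d_complete_top:
  assumes "d_complete P" "dk_minus_convex P k S"
    and v: "v \<in> S" "\<And>z. z \<in> S \<Longrightarrow> v \<le> z"
  shows "\<exists>u. dk_interval P k v u \<and> interval P v u = insert u S \<and> (\<forall>m\<in>maximals S. covers P u m)"
proof -
  have k: "3 \<le> k" using assms(2) by (simp add: dk_minus_convex_def)
  then obtain u v' w where u: "u \<in> P" "\<forall>m\<in>maximals S. covers P u m"
      and I: "dk_interval P k v' w" "insert u S = interval P v' w"
    using assms(1,2) unfolding d_complete_def by meson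
  have SP: "S \<subseteq> P" using assms(2) by (simp add: dk_minus_convex_def convex_in_def)
  have fin: "finite S"
  proof -
    obtain f where "bij_betw f (dtd k - {DU 1}) S"
      using assms(2) by (auto simp: dk_minus_convex_def dtd_iso_def)
    then show ?thesis using bij_betw_finite[of f] by (auto simp: dtd_def)
  qed
  have below: "z < u" if z: "z \<in> S" for z
  proof -
    obtain m where m: "m \<in> S" "z \<le> m" "\<And>r. r \<in> S \<Longrightarrow> z \<le> r \<Longrightarrow> \<not> m < r"
      using ex_maximal_such[OF fin z, of "\<lambda>r. z \<le> r"] by blast
    then have "m \<in> maximals S" by (auto simp: maximals_iff intro: order_trans order_less_imp_le)
    then have "m < u" using u by (auto simp: covers_def)
    then show ?thesis using m by simp
  qed
  have "v' \<le> w" using dk_interval_less[OF I(1)] by simp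
  then have "v' \<in> insert u S" "w \<in> insert u S"
    unfolding I(2) using dk_interval_in[OF I(1)] by (auto simp: interval_def)
  moreover have "v' \<le> v" "u \<le> w" using I(2) v by (auto simp: interval_def)
  moreover have "v < u" using below v by blast
  ultimately have "v' = v" "w = u" using v(2)[of v'] below[of w] by (auto simp: order_le_less)
  then show ?thesis using u I by auto
qed

section \<open>Intervals that start outside the top forest\<close>

lemma two_covers_dk_minus_convex:
  assumes y: "covers P y x" "covers P y' x" "y \<noteq> y'"
  shows "dk_minus_convex P 3 {x, y, y'}"
  unfolding dk_minus_convex_def
proof (intro conjI)
  have yx: "x < y" "x < y'" "x \<in> P" "y \<in> P" "y' \<in> P"
    and no: "\<And>z. z \<in> P \<Longrightarrow> x < z \<Longrightarrow> z \<le> y \<Longrightarrow> z = y" "\<And>z. z \<in> P \<Longrightarrow> x < z \<Longrightarrow> z \<le> y' \<Longrightarrow> z = y'"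
    using y by (auto simp: covers_def order_le_less)
  have inc: "\<not> y \<le> y'" "\<not> y' \<le> y" using no yx y by auto
  show "convex_in P {x, y, y'}"
    unfolding convex_in_def
  proof (intro conjI ballI impI)
    fix a b z assume ab: "a \<in> {x, y, y'}" "b \<in> {x, y, y'}" "z \<in> P" "a \<le> z \<and> z \<le> b"
    then have "x \<le> z" using yx by (auto intro: order_trans)
    moreover have "z \<le> y \<or> z \<le> y'" using ab yx by (auto intro: order_trans)
    ultimately show "z \<in> {x, y, y'}" using no ab by (auto simp: order_le_less)
  qed (use yx in simp)
  have d: "dtd 3 - {DU 1} = {DX, DY, DV 1}" by (auto simp: dtd_def)
  let ?f = "\<lambda>p. if p = DX then y else if p = DY then y' else x"
  show "dtd_iso 3 (dtd 3 - {DU 1}) {x, y, y'}"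
    unfolding dtd_iso_def
  proof (intro exI[of _ ?f] conjI)
    show "bij_betw ?f (dtd 3 - {DU 1}) {x, y, y'}"
      unfolding d using y(3) yx by (auto simp: bij_betw_def inj_on_def)
    show "\<forall>p\<in>dtd 3 - {DU 1}. \<forall>q\<in>dtd 3 - {DU 1}. dtd_le 3 p q \<longleftrightarrow> ?f p \<le> ?f q"
    proof (intro ballI)
      fix p q assume pq: "p \<in> dtd 3 - {DU 1}" "q \<in> dtd 3 - {DU 1}"
      have "dtd_le 3 p q \<longleftrightarrow> p = q \<or> dtd_rank 3 p < dtd_rank 3 q"
        using pq by (intro dtd_le_iff) auto
      then show "dtd_le 3 p q \<longleftrightarrow> ?f p \<le> ?f q"
        using pq inc yx unfolding d by auto
    qed
  qed
qed simp

text \<open>Everything strictly above \<open>x\<close> lies above its only cover \<open>y\<close>,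
  which gives convexity; \<open>x\<close> becomes the new bottom of the lower tail.\<close>

lemma extended_tail_dk_minus_convex:
  assumes I: "dk_interval P k y z" and x: "covers P y x" "\<And>y'. covers P y' x \<Longrightarrow> y' = y"
    and fin: "finite P"
  shows "dk_minus_convex P (Suc k) (insert x (interval P y z))"
  unfolding dk_minus_convex_def
proof (intro conjI)
  let ?S = "insert x (interval P y z)"
  obtain f where k: "3 \<le> k" and f: "dtd_iso_by k f (interval P y z)"
    using I unfolding dk_interval_iff by blast
  show "3 \<le> Suc k" using k by simp
  have xy: "x < y" "x \<in> P" "y \<in> P" using x by (auto simp: covers_def)
  have above: "y \<le> w" if w: "w \<in> P" "x < w" for w
    using exists_cover_above[OF fin xy(2) w] x(2) by metis
  show "convex_in P ?S"
    unfolding convex_in_def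
  proof (intro conjI ballI impI)
    fix a b w assume ab: "a \<in> ?S" "b \<in> ?S" "w \<in> P" "a \<le> w \<and> w \<le> b"
    have "x \<le> a" using ab xy by (auto simp: interval_def)
    then have xw: "x \<le> w" using ab by auto
    show "w \<in> ?S"
    proof (cases "w = x")
      case False
      then have yw: "y \<le> w" using above[OF ab(3)] xw by auto
      then have "b \<noteq> x" using ab xy by auto
      then show ?thesis using ab yw by (auto simp: interval_def)
    qed simp
  qed (use xy in \<open>auto simp: interval_def\<close>)
  \<comment> \<open>Both tails of \<open>[y,z]\<close> are renumbered by one: in the larger diamond,
    index 1 belongs to the missing top and to \<open>x\<close>.\<close>
  define sh where "sh p = (case p of DU i \<Rightarrow> DU (Suc i) | DV i \<Rightarrow> DV (Suc i) | _ \<Rightarrow> p)" for p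
  define un where "un p = (case p of DU i \<Rightarrow> DU (i - 1) | DV i \<Rightarrow> DV (i - 1) | _ \<Rightarrow> p)" for p
  have un_sh: "un (sh p) = p" for p by (cases p) (auto simp: un_def sh_def)
  have rank: "dtd_rank (Suc k) (sh p) = Suc (dtd_rank k p)" if "p \<in> dtd k" for p
    using that k by (auto simp: sh_def dtd_def)
  have rank_pos: "0 < dtd_rank k p" if "p \<in> dtd k" for p
    using that k by (auto simp: dtd_def)
  have ne: "sh p \<noteq> DV 1" if "p \<in> dtd k" for p
    using that by (auto simp: sh_def dtd_def)
  have dom: "dtd (Suc k) - {DU 1} = insert (DV 1) (sh ` dtd k)" (is "?L = ?R")
  proof
    show "?R \<subseteq> ?L" using k by (auto simp: sh_def dtd_def)
    show "?L \<subseteq> ?R"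
    proof
      fix p assume p: "p \<in> ?L"
      show "p \<in> ?R"
      proof (cases "p = DV 1")
        case False
        have "un p \<in> dtd k" "sh (un p) = p"
          using p False k by (auto simp: un_def sh_def dtd_def image_iff)
        then show ?thesis by (metis image_eqI insertI2)
      qed simp
    qed
  qed
  define g where "g p = (if p = DV 1 then x else f (un p))" for p
  have inj: "inj_on f (dtd k)" and im: "f ` dtd k = interval P y z"
    using f by (auto simp: dtd_iso_by_def bij_betw_def)
  have fS: "f p \<in> interval P y z" if "p \<in> dtd k" for p using im that by blast
  have gV: "g (DV 1) = x" by (simp add: g_def)
  have xf: "x < f p" if "p \<in> dtd k" for p using fS[OF that] xy by (auto simp: interval_def)
  have gsh: "g (sh p) = f p" if "p \<in> dtd k" for p using ne[OF that] un_sh by (simp add: g_def)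
  show "dtd_iso (Suc k) (dtd (Suc k) - {DU 1}) ?S"
    unfolding dtd_iso_def
  proof (intro exI[of _ g] conjI)
    have "g ` (sh ` dtd k) = f ` dtd k" unfolding image_image using gsh by (intro image_cong) auto
    then have "g ` (insert (DV 1) (sh ` dtd k)) = ?S"
      unfolding image_insert im by (simp add: g_def)
    moreover have "inj_on g (insert (DV 1) (sh ` dtd k))"
    proof (rule inj_onI)
      fix p q assume pq: "p \<in> insert (DV 1) (sh ` dtd k)" "q \<in> insert (DV 1) (sh ` dtd k)" "g p = g q"
      then consider "p = DV 1" "q = DV 1" | p' where "p = sh p'" "p' \<in> dtd k" "q = DV 1"
        | q' where "q = sh q'" "q' \<in> dtd k" "p = DV 1"
        | p' q' where "p = sh p'" "p' \<in> dtd k" "q = sh q'" "q' \<in> dtd k" by blast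
      then show "p = q"
      proof cases
        case 2 then show ?thesis using pq(3) gsh xf gV by (metis order_less_irrefl)
      next
        case 3 then show ?thesis using pq(3) gsh xf gV by (metis order_less_irrefl)
      next
        case 4
        then have "f p' = f q'" using pq(3) gsh by metis
        then show ?thesis using inj_onD[OF inj] 4 by blast
      qed simp
    qed
    ultimately show "bij_betw g (dtd (Suc k) - {DU 1}) ?S"
      unfolding dom bij_betw_def by blast
    show "\<forall>p\<in>dtd (Suc k) - {DU 1}. \<forall>q\<in>dtd (Suc k) - {DU 1}. dtd_le (Suc k) p q \<longleftrightarrow> g p \<le> g q"
    proof (intro ballI)
      fix p q assume pq: "p \<in> dtd (Suc k) - {DU 1}" "q \<in> dtd (Suc k) - {DU 1}"
      have le: "dtd_le (Suc k) p q \<longleftrightarrow> p = q \<or> dtd_rank (Suc k) p < dtd_rank (Suc k) q"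
        using pq k by (intro dtd_le_iff) auto
      consider "p = DV 1" "q = DV 1" | p' where "p = sh p'" "p' \<in> dtd k" "q = DV 1"
        | q' where "q = sh q'" "q' \<in> dtd k" "p = DV 1"
        | p' q' where "p = sh p'" "p' \<in> dtd k" "q = sh q'" "q' \<in> dtd k"
        using pq unfolding dom by blast
      then show "dtd_le (Suc k) p q \<longleftrightarrow> g p \<le> g q"
      proof cases
        case 2
        then have "\<not> g p \<le> g q" using gsh[OF 2(2)] xf[OF 2(2)] gV 2 by auto
        moreover have "p \<noteq> q" using ne[OF 2(2)] 2 by simp
        moreover have "\<not> dtd_rank (Suc k) p < dtd_rank (Suc k) q" using rank[OF 2(2)] 2 by simp
        ultimately show ?thesis using le by blast
      next
        case 3
        then have "g p \<le> g q" using gsh[OF 3(2)] xf[OF 3(2)] gV 3 by auto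
        moreover have "dtd_rank (Suc k) p < dtd_rank (Suc k) q"
          using rank[OF 3(2)] rank_pos[OF 3(2)] 3 by simp
        ultimately show ?thesis using le by blast
      next
        case 4
        have "f p' \<le> f q' \<longleftrightarrow> p' = q' \<or> dtd_rank k p' < dtd_rank k q'"
          using f 4 unfolding dtd_iso_by_def by blast
        moreover have "p = q \<longleftrightarrow> p' = q'" using 4(1,3) un_sh by metis
        moreover have "dtd_rank (Suc k) p = Suc (dtd_rank k p')" "g p = f p'"
          "dtd_rank (Suc k) q = Suc (dtd_rank k q')" "g q = f q'"
          unfolding 4(1,3) by (rule rank[OF 4(2)] gsh[OF 4(2)] rank[OF 4(4)] gsh[OF 4(4)])+
        ultimately show ?thesis using le by simp
      next
        case 1
        then show ?thesis using le by blast
      qed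
    qed
  qed
qed

text \<open>Two covers of \<open>x\<close> can be completed to a diamond; a single cover is again
  outside the top forest, and its interval is extended down to \<open>x\<close>. That all covers lie
  in one interval uses the colors: diamonds over \<open>x\<close> sharing a cover have tops of equal
  color, which are comparable and cover a common element, hence equal.\<close>

lemma bottom_of_dk_interval:
  assumes fin: "finite P" and dc: "d_complete P" and col: "d_coloring P I c"
  shows "x \<in> P \<Longrightarrow> x \<notin> top_forest P \<Longrightarrow>
    \<exists>k u. dk_interval P k x u \<and> (\<forall>y. covers P y x \<longrightarrow> y \<in> interval P x u)"
proof (induction "card {z \<in> P. x < z}" arbitrary: x rule: less_induct)
  case less
  show ?case
  proof (cases "\<exists>y y'. covers P y x \<and> covers P y' x \<and> y \<noteq> y'")
    case True
    then obtain y y' where y: "covers P y x" "covers P y' x" "y \<noteq> y'" by blast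
    have dia: "\<exists>u. dk_interval P 3 x u \<and> covers P u b \<and> covers P u b'"
      if b: "covers P b x" "covers P b' x" "b \<noteq> b'" for b b'
    proof -
      have xb: "x \<le> z" if "z \<in> {x, b, b'}" for z
        using that b by (auto simp: covers_def order_less_imp_le)
      obtain u where u: "dk_interval P 3 x u" "\<forall>m\<in>maximals {x, b, b'}. covers P u m"
        using d_complete_top[OF dc two_covers_dk_minus_convex[OF b] insertI1 xb] by blast
      have "\<not> b < b'" "\<not> b' < b" using b by (auto simp: covers_def)
      then have "b \<in> maximals {x, b, b'}" "b' \<in> maximals {x, b, b'}"
        using b by (auto simp: maximals_iff covers_def)
      then show ?thesis using u by blast
    qed
    obtain u where u: "dk_interval P 3 x u" "covers P u y" "covers P u y'" using dia[OF y] by blast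
    have "w \<in> interval P x u" if w: "covers P w x" for w
    proof (cases "w = y")
      case True
      then show ?thesis using dk_interval_covers_in[OF dc u(1,2)] by simp
    next
      case False
      obtain t where t: "dk_interval P 3 x t" "covers P t w" "covers P t y"
        using dia[OF w y(1) False] by blast
      have "c x = c u" "c x = c t" using col u(1) t(1) unfolding d_coloring_def by blast+
      moreover have "u \<in> P" "t \<in> P" using u t by (auto simp: covers_def)
      ultimately have "u \<le> t \<or> t \<le> u" using col unfolding d_coloring_def by metis
      moreover have "\<not> u < t" "\<not> t < u" using u(2) t(3) by (auto simp: covers_def)
      ultimately have "u = t" by auto
      then show ?thesis using dk_interval_covers_in[OF dc u(1)] t(2) by simp
    qed
    then show ?thesis using u by blast
  next
    case False
    obtain y0 z z' where "y0 \<in> P" "x \<le> y0" "covers P z y0" "covers P z' y0" "z \<noteq> z'"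
      using less.prems unfolding top_forest_def by blast
    then have "y0 \<noteq> x" using False by blast
    then have "x < y0" using \<open>x \<le> y0\<close> by simp
    then obtain y where y: "covers P y x" "y \<le> y0"
      using exists_cover_above[OF fin less.prems(1) \<open>y0 \<in> P\<close>] by blast
    have uniq: "y' = y" if "covers P y' x" for y' using False y that by blast
    have yP: "y \<in> P" "x < y" using y by (auto simp: covers_def)
    have "y \<notin> top_forest P"
      unfolding top_forest_def using \<open>y0 \<in> P\<close> y(2) \<open>covers P z y0\<close> \<open>covers P z' y0\<close> \<open>z \<noteq> z'\<close> by blast
    moreover have "card {z \<in> P. y < z} < card {z \<in> P. x < z}"
      using yP fin by (intro psubset_card_mono) auto
    ultimately obtain k w where w: "dk_interval P k y w" using less.hyps[of y] yP by blast
    note wP = dk_interval_in[OF w] dk_interval_less[OF w]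
    let ?S = "insert x (interval P y w)"
    have xb: "x \<le> z" if "z \<in> ?S" for z using that yP by (auto simp: interval_def)
    obtain u where u: "dk_interval P (Suc k) x u" "interval P x u = insert u ?S"
      using d_complete_top[OF dc extended_tail_dk_minus_convex[OF w y(1) uniq fin] insertI1 xb] by blast
    have "y \<in> ?S" using wP by (auto simp: interval_def)
    then show ?thesis using u uniq by blast
  qed
qed

section \<open>Colors in \<open>d\<close>-complete posets\<close>

locale colored_d_complete =
  fixes P :: "'a::order set" and I :: "'i set" and c :: "'a \<Rightarrow> 'i"
  assumes fin: "finite P" and dc: "d_complete P" and col: "d_coloring P I c"
begin

lemma incomparable_colors: "x \<in> P \<Longrightarrow> y \<in> P \<Longrightarrow> c x = c y \<Longrightarrow> x \<le> y \<or> y \<le> x"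
  using col unfolding d_coloring_def by metis

lemma chain_colors:
  assumes "v \<in> P" "u \<in> P" "\<And>x y. x \<in> interval P v u \<Longrightarrow> y \<in> interval P v u \<Longrightarrow> x \<le> y \<or> y \<le> x"
  shows "inj_on c (interval P v u)"
  using col assms unfolding d_coloring_def by blast

lemma dk_colors: "dk_interval P k v u \<Longrightarrow> c v = c u"
  using col unfolding d_coloring_def by blast

lemma top_forest_inj: "x \<in> top_forest P \<Longrightarrow> y \<in> top_forest P \<Longrightarrow> c x = c y \<Longrightarrow> x = y"
  using col unfolding d_coloring_def bij_betw_def inj_on_def by blast

lemma top_forest_rep: "p \<in> P \<Longrightarrow> \<exists>g\<in>top_forest P. c g = c p"
proof -
  assume "p \<in> P"
  then have "c p \<in> I" "c ` top_forest P = I" using col unfolding d_coloring_def bij_betw_def by blast+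
  then show ?thesis by (metis imageE)
qed

lemma top_forest_subset: "top_forest P \<subseteq> P"
  by (auto simp: top_forest_def)

lemma color_adj_sym: "color_adj P c i j \<Longrightarrow> color_adj P c j i"
  unfolding color_adj_def top_forest_adj_def by blast

lemma color_adj_top_forest:
  assumes "x \<in> top_forest P" "y \<in> top_forest P"
  shows "color_adj P c (c x) (c y) \<longleftrightarrow> covers P x y \<or> covers P y x"
  using assms top_forest_inj unfolding color_adj_def top_forest_adj_def by metis

lemma color_adj_irrefl: "\<not> color_adj P c i i"
proof
  assume "color_adj P c i i"
  then obtain x y where xy: "x \<in> top_forest P" "y \<in> top_forest P" "covers P x y \<or> covers P y x" "c x = c y"
    unfolding color_adj_def top_forest_adj_def by metis
  then have "x = y" by (intro top_forest_inj)
  then show False using xy by (auto simp: covers_def)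
qed

lemma top_forest_color_above:
  assumes x: "x \<in> top_forest P" and y: "y \<in> P" "x < y"
  shows "c y \<noteq> c x"
  using top_forest_up[OF x y(1)] top_forest_inj[OF x, of y] y by auto

text \<open>Outside the top forest, \<open>x\<close> is the bottom of a d_k-interval containing
  \<open>y\<close>. Since the ends of this interval, and of the next inner one, have equal colors,
  the same pair of colors already occurs at a cover below the top of the interval.\<close>

lemma covers_color_adj: "covers P y x \<Longrightarrow> color_adj P c (c y) (c x)"
proof (induction "card {z \<in> P. x < z}" arbitrary: x y rule: less_induct)
  case less
  have xy: "x \<in> P" "y \<in> P" "x < y" using less.prems by (auto simp: covers_def)
  have up: "card {z \<in> P. w < z} < card {z \<in> P. x < z}" if "w \<in> P" "x < w" for w
    using that fin by (intro psubset_card_mono) auto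
  show ?case
  proof (cases "x \<in> top_forest P")
    case True
    have "y \<in> top_forest P" by (rule top_forest_up[OF True xy(2)]) (use xy in simp)
    then show ?thesis using color_adj_top_forest True less.prems by blast
  next
    case False
    obtain k u where u: "dk_interval P k x u" "y \<in> interval P x u"
      using bottom_of_dk_interval[OF fin dc col xy(1) False] less.prems by blast
    have cxu: "c x = c u" using dk_colors[OF u(1)] .
    from u(1) show ?thesis
    proof (cases rule: dk_interval_cases)
      case (diamond a b)
      have "y \<noteq> u" using diamond less.prems by (auto simp: covers_def)
      then have "covers P u y" using u(2) diamond xy by auto
      then show ?thesis using less.hyps[OF up[OF xy(2,3)]] color_adj_sym cxu by metis
    next
      case (tail l v' u')
      have v'u': "v' < u'" "v' \<in> P" "u' \<in> P"
        using dk_interval_less[OF tail(2)] dk_interval_in[OF tail(2)] by auto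
      have "y = v'"
      proof -
        have "v' \<le> y" using u(2) tail xy v'u' by (auto simp: interval_def covers_def)
        moreover have "\<not> v' < y" using less.prems tail by (auto simp: covers_def)
        ultimately show ?thesis by simp
      qed
      moreover have "x < u'" using v'u' tail by (auto simp: covers_def)
      ultimately show ?thesis
        using less.hyps[OF up[OF v'u'(3)] tail(4)] dk_colors[OF tail(2)] color_adj_sym cxu by metis
    qed
  qed
qed

text \<open>Coloring separates colors along chains, but \<open>[w,u]\<close> is not a chain when
  \<open>w\<close> is in the lower tail. Such a \<open>w\<close> has the color of its mirror image
  in the upper tail, and from there up to \<open>u\<close> the interval is a chain.\<close>

lemma dk_interval_upper_chain:
  assumes "dk_interval P k v u" "w \<in> interval P v u - {v, u}"
  shows "\<exists>w'\<in>interval P v u - {v, u}. c w' = c w \<and>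
    (\<forall>a\<in>interval P w' u. \<forall>b\<in>interval P w' u. a \<le> b \<or> b \<le> a)"
  using assms
proof (induction k arbitrary: v u w)
  case 0
  then show ?case by (simp add: dk_interval_def)
next
  case (Suc k)
  from Suc.prems(1) show ?case
  proof (cases rule: dk_interval_cases)
    case (diamond x y)
    then have "covers P u w" using Suc.prems(2) by auto
    then have "interval P w u = {w, u}" "w < u" using interval_covers[of P u w] by (auto simp: covers_def)
    then have "\<forall>a\<in>interval P w u. \<forall>b\<in>interval P w u. a \<le> b \<or> b \<le> a" by auto
    then show ?thesis using Suc.prems(2) by (intro bexI[of _ w] conjI refl)
  next
    case (tail l v' u')
    have I: "interval P v u - {v, u} = interval P v' u'" using tail by blast
    have l: "k = l" using tail by simp
    have v'u': "v' < u'" "v' \<in> P" "u' \<in> P"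
      using dk_interval_less[OF tail(2)] dk_interval_in[OF tail(2)] by auto
    show ?thesis
    proof (cases "w = v' \<or> w = u'")
      case True
      then have "c u' = c w" using dk_colors[OF tail(2)] by auto
      moreover have "interval P u' u = {u', u}" "u' < u"
        using tail(4) interval_covers[OF tail(4)] by (auto simp: covers_def)
      then have "\<forall>a\<in>interval P u' u. \<forall>b\<in>interval P u' u. a \<le> b \<or> b \<le> a" by auto
      moreover have "u' \<in> interval P v u - {v, u}" unfolding I using v'u' by (auto simp: interval_def)
      ultimately show ?thesis by (intro bexI[of _ u'] conjI)
    next
      case False
      then obtain w' where w': "w' \<in> interval P v' u' - {v', u'}" "c w' = c w"
        and ch: "\<forall>a\<in>interval P w' u'. \<forall>b\<in>interval P w' u'. a \<le> b \<or> b \<le> a"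
        using Suc.IH[of v' u' w] tail(2) l Suc.prems(2) I by blast
      have "v < w'" using w' tail(5) by (auto simp: interval_def covers_def)
      have sub: "z \<in> interval P w' u'" if "z \<in> interval P w' u" "z \<noteq> u" for z
      proof -
        have "z \<in> interval P v u - {v, u}" using that \<open>v < w'\<close> by (auto simp: interval_def)
        then have "z \<le> u'" unfolding I by (simp add: interval_def)
        then show ?thesis using that by (simp add: interval_def)
      qed
      have "a \<le> b \<or> b \<le> a" if ab: "a \<in> interval P w' u" "b \<in> interval P w' u" for a b
      proof (cases "a = u \<or> b = u")
        case True
        then show ?thesis using ab by (auto simp: interval_def)
      next
        case False
        then show ?thesis using sub ch ab by blast
      qed
      then have "\<forall>a\<in>interval P w' u. \<forall>b\<in>interval P w' u. a \<le> b \<or> b \<le> a" by blast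
      moreover have "w' \<in> interval P v u - {v, u}" using w'(1) I by blast
      ultimately show ?thesis using w'(2) by (intro bexI[of _ w'] conjI)
    qed
  qed
qed

lemma dk_interval_inner_color:
  assumes I: "dk_interval P k v u" and w: "w \<in> P" "v < w" "w < u"
  shows "c w \<noteq> c u"
proof -
  have "w \<in> interval P v u - {v, u}" using w by (auto simp: interval_def)
  then obtain w' where w': "w' \<in> interval P v u - {v, u}" "c w' = c w"
    "\<forall>a\<in>interval P w' u. \<forall>b\<in>interval P w' u. a \<le> b \<or> b \<le> a"
    using dk_interval_upper_chain[OF I] by blast
  have mem: "w' \<in> P" "u \<in> P" "w' \<noteq> u" "w' \<in> interval P w' u" "u \<in> interval P w' u"
    using w'(1) dk_interval_in[OF I] by (auto simp: interval_def)
  have "inj_on c (interval P w' u)" by (rule chain_colors[OF mem(1,2)]) (use w'(3) in blast)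
  then show ?thesis using mem w'(2) by (metis inj_onD)
qed

text \<open>Otherwise the colors of the chain would form a cycle in the top forest, and the lowest node of
  that cycle would be covered by two elements.\<close>

lemma chain_color_adj_covers:
  assumes mem: "w \<in> P" "u \<in> P" "w < u" and adj: "color_adj P c (c w) (c u)"
    and ch: "\<And>a b. a \<in> interval P w u \<Longrightarrow> b \<in> interval P w u \<Longrightarrow> a \<le> b \<or> b \<le> a"
  shows "covers P u w"
proof (rule ccontr)
  assume "\<not> covers P u w"
  then obtain z where z: "z \<in> P" "w < z" "z < u" using mem by (auto simp: covers_def)
  let ?T = "interval P w u"
  have inj: "inj_on c ?T" by (rule chain_colors[OF mem(1,2) ch])
  have finT: "finite ?T" using fin by (simp add: interval_def)
  have TP: "t \<in> P \<and> w \<le> t \<and> t \<le> u" if "t \<in> ?T" for t using that by (simp add: interval_def)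
  have wT: "w \<in> ?T" and uT: "u \<in> ?T" using mem by (auto simp: interval_def)
  define g where "g t = (SOME x. x \<in> top_forest P \<and> c x = c t)" for t
  have g: "g t \<in> top_forest P" "c (g t) = c t" if "t \<in> ?T" for t
  proof -
    have "\<exists>x. x \<in> top_forest P \<and> c x = c t" using top_forest_rep TP[OF that] by blast
    from someI_ex[OF this] show "g t \<in> top_forest P" "c (g t) = c t" by (auto simp: g_def)
  qed
  have "finite (g ` ?T)" "g w \<in> g ` ?T" using finT wT by auto
  then obtain m where m: "m \<in> g ` ?T" "\<And>r. r \<in> g ` ?T \<Longrightarrow> \<not> r < m"
    using ex_minimal_such[of "g ` ?T" "g w" "\<lambda>_. True"] by metis
  then obtain t where t: "t \<in> ?T" "m = g t" by blast
  have nb: "covers P (g a) m" if "a \<in> ?T" "color_adj P c (c a) (c t)" for a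
  proof -
    have "color_adj P c (c (g a)) (c (g t))" using g t that by simp
    then have "covers P (g a) m \<or> covers P m (g a)"
      using color_adj_top_forest g t that by blast
    moreover have "\<not> g a < m" using m(2) that by blast
    ultimately show ?thesis by (auto simp: covers_def)
  qed
  \<comment> \<open>By minimality of \<open>m\<close>, its neighbors in the image of
    \<open>g\<close> all cover it, and a node of the top forest has at most one cover. But
    \<open>t\<close> has two neighbors in the chain, the pair \<open>w\<close>, \<open>u\<close>
    closing the cycle; \<open>z\<close> keeps them distinct.\<close>
  have one: "a = b" if "a \<in> ?T" "b \<in> ?T" "color_adj P c (c a) (c t)" "color_adj P c (c b) (c t)" for a b
  proof -
    have "m \<in> P" "m \<in> top_forest P" using g t top_forest_subset by auto
    then have "g a = g b"
      using nb[OF that(1,3)] nb[OF that(2,4)] unfolding top_forest_def by blast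
    then have "c a = c b" using g that by metis
    then show ?thesis using inj_onD[OF inj] that by blast
  qed
  have above: "\<exists>r\<in>?T. color_adj P c (c r) (c t) \<and> t < r \<and> r \<le> s" if s: "s \<in> ?T" "t < s" for s
  proof -
    obtain r where r: "covers P r t" "r \<le> s" using exists_cover_above[OF fin, of t s] TP[OF t(1)] TP[OF s(1)] s(2) by blast
    then have "r \<in> ?T" "t < r"
      using TP[OF t(1)] TP[OF s(1)] by (auto simp: interval_def covers_def)
    then show ?thesis using covers_color_adj[OF r(1)] r by blast
  qed
  have below: "\<exists>r\<in>?T. color_adj P c (c r) (c t) \<and> r < t \<and> s \<le> r" if s: "s \<in> ?T" "s < t" for s
  proof -
    obtain r where r: "covers P t r" "s \<le> r" using exists_cover_below[OF fin, of s t] TP[OF t(1)] TP[OF s(1)] s(2) by blast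
    then have "r \<in> ?T" "r < t"
      using TP[OF t(1)] TP[OF s(1)] by (auto simp: interval_def covers_def)
    then show ?thesis using color_adj_sym[OF covers_color_adj[OF r(1)]] r by blast
  qed
  have zT: "z \<in> ?T" using z by (auto simp: interval_def)
  consider "t = w" | "t = u" | "w < t" "t < u" using TP[OF t(1)] by (auto simp: order_le_less)
  then show False
  proof cases
    case 1
    then obtain r where "r \<in> ?T" "color_adj P c (c r) (c t)" "r \<le> z" using above[OF zT] z by blast
    moreover have "color_adj P c (c u) (c t)" using adj color_adj_sym 1 by blast
    ultimately have "r = u" using one uT by blast
    then show False using \<open>r \<le> z\<close> z by auto
  next
    case 2
    then obtain r where "r \<in> ?T" "color_adj P c (c r) (c t)" "z \<le> r" using below[OF zT] z by blast
    then have "r = w" using one wT adj 2 by blast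
    then show False using \<open>z \<le> r\<close> z by auto
  next
    case 3
    then obtain r s where "r \<in> ?T" "color_adj P c (c r) (c t)" "t < r"
      "s \<in> ?T" "color_adj P c (c s) (c t)" "s < t"
      using above[OF uT] below[OF wT] by blast
    then show False using one[of r s] by auto
  qed
qed

text \<open>In a diamond the two elements are the sides, otherwise the ends \<open>u'\<close> and
  \<open>v'\<close> of the next inner interval. Any other candidate shares its color with an element
  of the upper chain, which \<open>u\<close> covers by \<open>chain_color_adj_covers\<close> and
  which therefore is \<open>u'\<close>.\<close>

lemma dk_interval_inner_adj:
  assumes I: "dk_interval P k v u"
  shows "card {w \<in> {w \<in> P. v < w \<and> w < u}. color_adj P c (c u) (c w)} = 2"
    and "w \<in> P \<Longrightarrow> v < w \<Longrightarrow> w < u \<Longrightarrow> color_adj P c (c u) (c w) \<Longrightarrow>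
      covers P w v \<or> (\<exists>l v'. dk_interval P l v' w \<and> v < v')"
proof -
  let ?N = "{w \<in> {w \<in> P. v < w \<and> w < u}. color_adj P c (c u) (c w)}"
  have inner: "{w \<in> P. v < w \<and> w < u} = interval P v u - {v, u}"
    by (auto simp: interval_def order_le_less)
  have "card ?N = 2 \<and> (\<forall>w\<in>?N. covers P w v \<or> (\<exists>l v'. dk_interval P l v' w \<and> v < v'))"
    using I
  proof (cases rule: dk_interval_cases)
    case (diamond x y)
    have "?N = {x, y}"
      unfolding inner using diamond covers_color_adj by (auto simp: covers_def)
    then show ?thesis using diamond by auto
  next
    case (tail l v' u')
    have v'u': "v' < u'" "v' \<in> P" "u' \<in> P" "v < v'"
      using dk_interval_less[OF tail(2)] dk_interval_in[OF tail(2)] tail(5) by (auto simp: covers_def)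
    have I': "interval P v u - {v, u} = interval P v' u'" using tail by blast
    have cu: "color_adj P c (c u) (c u')" "c v' = c u'"
      using covers_color_adj[OF tail(4)] dk_colors[OF tail(2)] by auto
    have "?N = {u', v'}"
    proof
      show "{u', v'} \<subseteq> ?N" unfolding inner I' using cu v'u' by (auto simp: interval_def)
      show "?N \<subseteq> {u', v'}"
      proof
        fix w assume "w \<in> ?N"
        then have w: "w \<in> interval P v u - {v, u}" "color_adj P c (c u) (c w)" unfolding inner by auto
        then obtain w' where w': "w' \<in> interval P v u - {v, u}" "c w' = c w"
          "\<forall>a\<in>interval P w' u. \<forall>b\<in>interval P w' u. a \<le> b \<or> b \<le> a"
          using dk_interval_upper_chain[OF I] by blast
        have "w' \<in> P" "u \<in> P" "w' < u"
          using w'(1) dk_interval_in[OF I] by (auto simp: interval_def order_le_less)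
        then have cov: "covers P u w'"
          using chain_color_adj_covers[of w' u] w' w(2) color_adj_sym by metis
        have "w' \<in> interval P v' u'" using w' I' by blast
        then have "w' = u'" using cov tail(4) by (auto simp: interval_def covers_def order_le_less)
        then have "c w = c u'" using w' by simp
        moreover have "w \<in> interval P v' u'" using w I' by blast
        ultimately show "w \<in> {u', v'}"
          using dk_interval_inner_color[OF tail(2), of w] by (auto simp: interval_def order_le_less)
      qed
    qed
    then show ?thesis using v'u' tail by auto
  qed
  then show "card ?N = 2" "w \<in> P \<Longrightarrow> v < w \<Longrightarrow> w < u \<Longrightarrow> color_adj P c (c u) (c w) \<Longrightarrow>
      covers P w v \<or> (\<exists>l v'. dk_interval P l v' w \<and> v < v')" by blast+
qed

text \<open>By \<open>dk_interval_inner_adj\<close>, either \<open>p'\<close> covers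
  \<open>q\<close>, and then \<open>q\<close> lies in \<open>[p,p']\<close>, or \<open>p'\<close> is
  the top of an interval starting above \<open>q\<close>, and by uniqueness that interval starts at
  \<open>p\<close>.\<close>

lemma dk_top_adj_below:
  assumes p: "dk_interval P k p p'" and q: "dk_interval P l q q'"
    and "q < p'" "p' < q'" "color_adj P c (c q) (c p')"
  shows "p \<le> q \<or> q \<le> p"
proof -
  have "color_adj P c (c q') (c p')" using assms(5) dk_colors[OF q] by simp
  then consider "covers P p' q" | l v' where "dk_interval P l v' p'" "q < v'"
    using dk_interval_inner_adj(2)[OF q _ assms(3,4)] dk_interval_in[OF p] by blast
  then show ?thesis
  proof cases
    case 1
    then show ?thesis using dk_interval_covers_in[OF dc p] by (auto simp: interval_def)
  next
    case 2
    then show ?thesis using dk_interval_unique[OF dc p] by auto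
  qed
qed

text \<open>An element outside the top forest is replaced by the top of the interval above it, which
  has the same color, so that the induction hypothesis applies. If both are outside and
  incomparable, the two intervals interlock with \<open>q < p'\<close> and \<open>p < q'\<close>,
  which \<open>dk_top_adj_below\<close> excludes.\<close>

lemma color_adj_comparable:
  "p \<in> P \<Longrightarrow> q \<in> P \<Longrightarrow> color_adj P c (c p) (c q) \<Longrightarrow> p \<le> q \<or> q \<le> p"
proof (induction "card {z \<in> P. p < z} + card {z \<in> P. q < z}" arbitrary: p q rule: less_induct)
  case less
  note p = less.prems(1) and q = less.prems(2) and adj = less.prems(3)
  have up: "card {z \<in> P. b < z} < card {z \<in> P. a < z}" if "b \<in> P" "a < b" for a b
    using that fin by (intro psubset_card_mono) auto
  \<comment> \<open>If \<open>b < a'\<close>, then \<open>a'\<close> is in the top forest as well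
    and covers \<open>b\<close>, which puts \<open>b\<close> into \<open>[a,a']\<close>.\<close>
  have mixed: "a \<le> b \<or> b \<le> a"
    if a: "a \<in> P" "dk_interval P k a a'" and b: "b \<in> top_forest P" "b \<in> P"
      and adj: "color_adj P c (c a) (c b)" and cmp: "a' \<le> b \<or> b \<le> a'" for a a' b k
  proof -
    have a': "a < a'" "a' \<in> P" "c a' = c a"
      using dk_interval_less[OF a(2)] dk_interval_in[OF a(2)] dk_colors[OF a(2)] by auto
    show ?thesis
    proof (cases "a' \<le> b")
      case True
      then show ?thesis using a' by auto
    next
      case False
      then have ba: "b < a'" using cmp by auto
      then have "a' \<in> top_forest P" using top_forest_up[OF b(1) a'(2)] by simp
      then have "covers P a' b \<or> covers P b a'"
        using color_adj_top_forest[of a' b] b(1) adj a'(3) by simp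
      then have "covers P a' b" using ba by (auto simp: covers_def)
      then show ?thesis using dk_interval_covers_in[OF dc a(2)] by (auto simp: interval_def)
    qed
  qed
  show ?case
  proof (cases "p \<in> top_forest P")
    case pT: True
    show ?thesis
    proof (cases "q \<in> top_forest P")
      case True
      then show ?thesis using color_adj_top_forest pT adj by (auto simp: covers_def)
    next
      case False
      then obtain k q' where q': "dk_interval P k q q'"
        using bottom_of_dk_interval[OF fin dc col q] by blast
      note m = dk_interval_less[OF q'] dk_interval_in[OF q'] dk_colors[OF q']
      have "p \<le> q' \<or> q' \<le> p"
        by (rule less.hyps) (use up[of q' q] m p adj in auto)
      then show ?thesis using mixed[OF q q' pT p color_adj_sym[OF adj]] by blast
    qed
  next
    case False
    then obtain k p' where p': "dk_interval P k p p'"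
      using bottom_of_dk_interval[OF fin dc col p] by blast
    note m = dk_interval_less[OF p'] dk_interval_in[OF p'] dk_colors[OF p']
    have c1: "p' \<le> q \<or> q \<le> p'"
      by (rule less.hyps) (use up[of p' p] m q adj in auto)
    show ?thesis
    proof (cases "q \<in> top_forest P")
      case True
      then show ?thesis using mixed[OF p p' True q adj c1] by blast
    next
      case False
      then obtain l q' where q': "dk_interval P l q q'"
        using bottom_of_dk_interval[OF fin dc col q] by blast
      note n = dk_interval_less[OF q'] dk_interval_in[OF q'] dk_colors[OF q']
      have c2: "p \<le> q' \<or> q' \<le> p"
        by (rule less.hyps) (use up[of q' q] n p adj in auto)
      have c3: "p' \<le> q' \<or> q' \<le> p'"
        by (rule less.hyps) (use up[of q' q] up[of p' p] m n adj in auto)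
      have adj': "color_adj P c (c p') (c q')" "c p' \<noteq> c q'"
        using adj m n color_adj_irrefl by auto
      show ?thesis
      proof (rule ccontr)
        assume no: "\<not> ?thesis"
        then have "q < p'" "p < q'" using c1 c2 m n by (auto simp: order_le_less)
        moreover have "p' < q' \<or> q' < p'" using c3 adj'(2) by (auto simp: order_le_less)
        ultimately show False
          using no dk_top_adj_below[OF p' q'] dk_top_adj_below[OF q' p'] adj' m n color_adj_sym by metis
      qed
    qed
  qed
qed

text \<open>Colors do not repeat above a node of the top forest, so \<open>x\<close> is the bottom
  of some \<open>[x,u]\<close>. Having equal colors, \<open>u\<close> and \<open>y\<close> are
  comparable, and neither lies strictly between \<open>x\<close> and the other.\<close>

lemma consecutive_dk_interval:
  assumes xy: "x \<in> P" "y \<in> P" "x < y" "c x = c y" and no: "\<And>w. w \<in> P \<Longrightarrow> x < w \<Longrightarrow> w < y \<Longrightarrow> c w \<noteq> c y"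
  shows "\<exists>k. dk_interval P k x y"
proof -
  have "x \<notin> top_forest P" using top_forest_color_above xy by metis
  then obtain k u where u: "dk_interval P k x u"
    using bottom_of_dk_interval[OF fin dc col xy(1)] by blast
  note m = dk_interval_less[OF u] dk_interval_in[OF u] dk_colors[OF u]
  have "u \<le> y \<or> y \<le> u" using incomparable_colors[of u y] m xy by simp
  moreover have "\<not> u < y" using no[of u] m xy by auto
  moreover have "\<not> y < u" using dk_interval_inner_color[OF u, of y] m xy by auto
  ultimately show ?thesis using u by auto
qed

text \<open>This is what \<open>root_top\<close> asks of a side. Strictly between \<open>v\<close>
  and a side there is only the lower tail, and a nested bottom \<open>v'\<close> has the color of
  its top \<open>u'\<close>, which no inner element of \<open>[v',u']\<close> has.\<close>

lemma side_color:
  assumes "dk_interval P k v u" "x \<in> interval P v u" "y \<in> interval P v u" "\<not> x \<le> y" "\<not> y \<le> x"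
    "w \<in> P" "v < w" "w < x"
  shows "c w \<noteq> c x"
  using assms
proof (induction k arbitrary: v u w)
  case 0
  then show ?case by (simp add: dk_interval_def)
next
  case (Suc k)
  have xy: "v \<le> x" "x \<le> u" "v \<le> y" "y \<le> u" "x \<in> P" "y \<in> P"
    using Suc.prems(2,3) by (auto simp: interval_def)
  then have ne: "x \<noteq> u" "x \<noteq> v" "y \<noteq> u" "y \<noteq> v" using Suc.prems(4,5) by auto
  have wI: "w \<in> interval P v u - {v, u}"
    using Suc.prems(6-8) xy by (auto simp: interval_def)
  from Suc.prems(1) show ?case
  proof (cases rule: dk_interval_cases)
    case (diamond a b)
    then have "covers P x v" using Suc.prems(2) ne by auto
    then show ?thesis using Suc.prems(6-8) by (auto simp: covers_def)
  next
    case (tail l v' u')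
    have I': "interval P v u - {v, u} = interval P v' u'" using tail by blast
    have in': "x \<in> interval P v' u'" "y \<in> interval P v' u'" "w \<in> interval P v' u'"
      using Suc.prems(2,3) ne wI I' by blast+
    have k: "k = l" using tail(1) by simp
    show ?thesis
    proof (cases "w = v'")
      case True
      have "x \<noteq> u'" using in' Suc.prems(5) by (auto simp: interval_def)
      then have "c x \<noteq> c u'"
        using dk_interval_inner_color[OF tail(2), of x] in' Suc.prems(8) True
        by (auto simp: interval_def order_le_less)
      then show ?thesis using dk_colors[OF tail(2)] True by simp
    next
      case False
      then have "v' < w" using in'(3) by (auto simp: interval_def)
      then show ?thesis
        using Suc.IH[of v' u' w] tail(2) k in' Suc.prems(4-8) by simp
    qed
  qed
qed

text \<open>The two sums on the right count the lower tail without \<open>v\<close> twice, and its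
  second copy stands for the upper tail of the same colors. Only the color of \<open>u\<close> is
  then missing.\<close>

lemma sum_dk_interval:
  fixes f :: "'i \<Rightarrow> 'r::comm_ring_1"
  assumes "dk_interval P k v u" "x \<in> interval P v u" "y \<in> interval P v u" "\<not> x \<le> y" "\<not> y \<le> x"
  shows "(\<Sum>w\<in>{w \<in> P. v < w \<and> w \<le> u}. f (c w)) =
    (\<Sum>w\<in>{w \<in> P. v < w \<and> w \<le> x}. f (c w)) + (\<Sum>w\<in>{w \<in> P. v < w \<and> w \<le> y}. f (c w)) + f (c u)"
  using assms
proof (induction k arbitrary: v u)
  case 0
  then show ?case by (simp add: dk_interval_def)
next
  case (Suc k)
  have xy: "v \<le> x" "x \<le> u" "v \<le> y" "y \<le> u" "x \<in> P" "y \<in> P"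
    using Suc.prems(2,3) by (auto simp: interval_def)
  then have ne: "x \<noteq> u" "x \<noteq> v" "y \<noteq> u" "y \<noteq> v" "x \<noteq> y" using Suc.prems(4,5) by auto
  have E: "{w \<in> P. v < w \<and> w \<le> z} = {w \<in> interval P v u. w \<noteq> v \<and> w \<le> z}" if "z \<le> u" for z
    using that by (auto simp: interval_def)
  note vu = dk_interval_less[OF Suc.prems(1)] dk_interval_in[OF Suc.prems(1)]
  from Suc.prems(1) show ?case
  proof (cases rule: dk_interval_cases)
    case (diamond a b)
    then have I: "interval P v u = {u, v, x, y}" using Suc.prems(2,3) ne by auto
    have lt: "v < u" "v \<noteq> u" "\<not> u \<le> x" "\<not> u \<le> y" using vu ne xy by auto
    have "{w \<in> P. v < w \<and> w \<le> u} = {x, y, u}"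
      unfolding E[OF order_refl] I using ne xy lt by auto
    moreover have "{w \<in> P. v < w \<and> w \<le> x} = {x}"
      unfolding E[OF xy(2)] I using ne lt Suc.prems(5) by auto
    moreover have "{w \<in> P. v < w \<and> w \<le> y} = {y}"
      unfolding E[OF xy(4)] I using ne lt Suc.prems(4) by auto
    ultimately show ?thesis using ne by (simp add: algebra_simps)
  next
    case (tail l v' u')
    have I': "interval P v u - {v, u} = interval P v' u'" using tail by blast
    have in': "x \<in> interval P v' u'" "y \<in> interval P v' u'" using Suc.prems(2,3) ne I' by blast+
    have k: "k = l" using tail(1) by simp
    have v'u': "v' < u'" "v' \<in> P" "u' \<in> P" "v < v'" "u' < u"
      using dk_interval_less[OF tail(2)] dk_interval_in[OF tail(2)] tail(4,5) by (auto simp: covers_def)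
    have S: "{w \<in> P. v < w \<and> w \<le> z} = insert v' {w \<in> P. v' < w \<and> w \<le> z}" if z: "z \<in> interval P v' u'" for z
    proof -
      have zu: "z \<le> u'" "v' \<le> z" using z by (auto simp: interval_def)
      have "v' \<le> w" if w: "w \<in> P" "v < w" "w \<le> z" for w
      proof -
        have "w \<in> interval P v u - {v, u}" using w zu v'u' by (auto simp: interval_def)
        then show ?thesis unfolding I' by (simp add: interval_def)
      qed
      then show ?thesis using v'u' zu by (auto simp: order_le_less)
    qed
    have "{w \<in> P. v < w \<and> w \<le> u} = insert u {w \<in> P. v < w \<and> w \<le> u'}"
    proof -
      have "w \<le> u'" if w: "w \<in> P" "v < w" "w \<le> u" "w \<noteq> u" for w
      proof -
        have "w \<in> interval P v u - {v, u}" using w by (auto simp: interval_def)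
        then show ?thesis unfolding I' by (simp add: interval_def)
      qed
      then show ?thesis using v'u' vu by auto
    qed
    then have U: "{w \<in> P. v < w \<and> w \<le> u} = insert u (insert v' {w \<in> P. v' < w \<and> w \<le> u'})"
      using S[of u'] v'u' by (simp add: interval_def)
    have "(\<Sum>w\<in>{w \<in> P. v < w \<and> w \<le> u}. f (c w)) = f (c u) + (f (c v') + (\<Sum>w\<in>{w \<in> P. v' < w \<and> w \<le> u'}. f (c w)))"
      unfolding U using fin v'u' by (subst sum.insert) auto
    also have "(\<Sum>w\<in>{w \<in> P. v' < w \<and> w \<le> u'}. f (c w)) =
        (\<Sum>w\<in>{w \<in> P. v' < w \<and> w \<le> x}. f (c w)) + (\<Sum>w\<in>{w \<in> P. v' < w \<and> w \<le> y}. f (c w)) + f (c u')"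
      by (rule Suc.IH[of v' u']) (use tail(2) k in' Suc.prems(4,5) in auto)
    also have "c u' = c v'" using dk_colors[OF tail(2)] by simp
    finally show ?thesis using fin S[OF in'(1)] S[OF in'(2)] by (simp add: algebra_simps)
  qed
qed

text \<open>The sum of the fundamental weights of the colors of the maximal elements; this is the
  dominant weight for which \<open>P\<close> is a minuscule heap.\<close>

definition top_weight :: "'i \<Rightarrow> int" where
  "top_weight k = (if \<exists>g\<in>top_forest P. c g = k \<and> (\<forall>y\<in>P. \<not> g < y) then 1 else 0)"

sublocale simply_laced "color_adj P c" top_weight
  by unfold_locales (use color_adj_sym color_adj_irrefl in \<open>auto simp: top_weight_def\<close>)

text \<open>For \<open>p\<close> in the top forest, the elements of adjacent color above it are its
  covers: none with weight 1, or one with weight 0. Otherwise \<open>p\<close> is the bottom of some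
  \<open>[p,u]\<close>, and passing from \<open>u\<close> to \<open>p\<close> adds 2 for
  \<open>u\<close> and -1 for each of the two inner elements of adjacent color.\<close>

lemma weight_equation:
  "p \<in> P \<Longrightarrow> top_weight (c p) - (\<Sum>q\<in>{q \<in> P. p < q}. cartan (c p) (c q)) = 1"
proof (induction "card {z \<in> P. p < z}" arbitrary: p rule: less_induct)
  case less
  note p = less.prems
  show ?case
  proof (cases "p \<in> top_forest P")
    case True
    have "(\<Sum>q\<in>{q \<in> P. p < q}. cartan (c p) (c q)) =
        - int (card {q \<in> {q \<in> P. p < q}. color_adj P c (c p) (c q)})"
      by (rule sum_cartan_off_color) (use fin top_forest_color_above[OF True] in auto)
    also have "{q \<in> {q \<in> P. p < q}. color_adj P c (c p) (c q)} = {q. covers P q p}"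
    proof -
      have "color_adj P c (c p) (c q) \<longleftrightarrow> covers P q p" if "q \<in> P" "p < q" for q
      proof -
        have "q \<in> top_forest P" using top_forest_up[OF True that(1)] that(2) by simp
        then show ?thesis using color_adj_top_forest[OF True] that by (auto simp: covers_def)
      qed
      then show ?thesis by (auto simp: covers_def)
    qed
    finally have s: "(\<Sum>q\<in>{q \<in> P. p < q}. cartan (c p) (c q)) = - int (card {q. covers P q p})" .
    have tw: "top_weight (c p) = (if \<forall>y\<in>P. \<not> p < y then 1 else 0)"
      using True top_forest_inj unfolding top_weight_def by metis
    show ?thesis
    proof (cases "\<forall>y\<in>P. \<not> p < y")
      case max: True
      then have "{q. covers P q p} = {}" by (auto simp: covers_def)
      then show ?thesis using s tw max by simp
    next
      case False
      then obtain y where "y \<in> P" "p < y" by blast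
      then obtain r where r: "covers P r p" using exists_cover_above[OF fin p] by blast
      have "r' = r" if "covers P r' p" for r' using True p r that unfolding top_forest_def by blast
      then have "{q. covers P q p} = {r}" using r by blast
      then show ?thesis using s tw False by simp
    qed
  next
    case False
    then obtain k u where u: "dk_interval P k p u"
      using bottom_of_dk_interval[OF fin dc col p] by blast
    note m = dk_interval_less[OF u] dk_interval_in[OF u] dk_colors[OF u]
    let ?A = "{q \<in> P. u < q}" and ?B = "{q \<in> P. p < q \<and> q < u}"
    have IH: "top_weight (c u) - (\<Sum>q\<in>?A. cartan (c u) (c q)) = 1"
      by (rule less.hyps) (use m fin in \<open>auto intro!: psubset_card_mono\<close>)
    have "(\<Sum>q\<in>{q \<in> P. p < q}. cartan (c u) (c q)) = (\<Sum>q\<in>insert u (?A \<union> ?B). cartan (c u) (c q))"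
    proof (rule sum.mono_neutral_right)
      show "insert u (?A \<union> ?B) \<subseteq> {q \<in> P. p < q}" using m by auto
      show "\<forall>q\<in>{q \<in> P. p < q} - insert u (?A \<union> ?B). cartan (c u) (c q) = 0"
      proof
        fix q assume q: "q \<in> {q \<in> P. p < q} - insert u (?A \<union> ?B)"
        then have n: "q \<in> P" "\<not> u \<le> q" "\<not> q \<le> u" by (auto simp: order_le_less)
        then have "c u \<noteq> c q" "\<not> color_adj P c (c u) (c q)"
          using incomparable_colors[of u q] color_adj_comparable[of u q] m by auto
        then show "cartan (c u) (c q) = 0" by (simp add: cartan_def)
      qed
    qed (use fin in simp)
    also have "\<dots> = 2 + ((\<Sum>q\<in>?A. cartan (c u) (c q)) + (\<Sum>q\<in>?B. cartan (c u) (c q)))"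
    proof -
      have "?A \<inter> ?B = {}" by auto
      then have "(\<Sum>q\<in>?A \<union> ?B. cartan (c u) (c q)) =
          (\<Sum>q\<in>?A. cartan (c u) (c q)) + (\<Sum>q\<in>?B. cartan (c u) (c q))"
        using fin by (intro sum.union_disjoint) auto
      moreover have "finite (?A \<union> ?B)" "u \<notin> ?A \<union> ?B" using fin by auto
      ultimately show ?thesis by simp
    qed
    also have "(\<Sum>q\<in>?B. cartan (c u) (c q)) = -2"
    proof -
      have "(\<Sum>q\<in>?B. cartan (c u) (c q)) = - int (card {q \<in> ?B. color_adj P c (c u) (c q)})"
        by (rule sum_cartan_off_color) (use fin dk_interval_inner_color[OF u] in auto)
      then show ?thesis using dk_interval_inner_adj(1)[OF u] by simp
    qed
    finally show ?thesis using IH m by simp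
  qed
qed

lemma heap_d_complete: "heap c P"
  unfolding heap_def
  using fin incomparable_colors color_adj_comparable covers_color_adj weight_equation by blast

text \<open>The d_k-intervals join exactly the consecutive elements of a color. Closed and open
  intervals give the same condition on neighbors, since no color is adjacent to itself.\<close>

lemma excitation_iff_excite:
  assumes D: "D \<subseteq> P"
  shows "excitation P c D D' \<longleftrightarrow> excite c P D D'"
proof
  assume "excitation P c D D'"
  then obtain u v k where u: "u \<in> D" and v: "v \<in> P - D" and vu: "v < u" "c v = c u"
      and k: "dk_interval P k v u" and no: "interval P v u \<inter> D \<inter> color_nbrs P c (c u) = {}"
      and D': "D' = insert v (D - {u})"
    unfolding excitation_def by blast
  show "excite c P D D'"
  proof (rule exciteI[OF u _ _ vu _ _ D'])
    show "c w \<noteq> c u" if "w \<in> P" "v < w" "w < u" for w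
      by (rule dk_interval_inner_color[OF k that])
    show "\<not> color_adj P c (c w) (c u)" if w: "w \<in> D" "v < w" "w < u" for w
    proof
      assume "color_adj P c (c w) (c u)"
      then have "w \<in> interval P v u \<inter> D \<inter> color_nbrs P c (c u)"
        using w D by (auto simp: interval_def color_nbrs_def)
      then show False using no by blast
    qed
  qed (use v in auto)
next
  assume "excite c P D D'"
  then obtain u v where u: "u \<in> D" and v: "v \<in> P" "v \<notin> D" and vu: "v < u" "c v = c u"
    and no: "\<forall>w\<in>P. v < w \<longrightarrow> w < u \<longrightarrow> c w \<noteq> c u"
    and na: "\<forall>w\<in>D. v < w \<longrightarrow> w < u \<longrightarrow> \<not> color_adj P c (c w) (c u)"
    and D': "D' = insert v (D - {u})"
    by (elim exciteE)
  have "\<exists>k. dk_interval P k v u"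
    by (rule consecutive_dk_interval) (use u v vu no D in auto)
  moreover have "interval P v u \<inter> D \<inter> color_nbrs P c (c u) = {}"
  proof -
    have "\<not> color_adj P c (c w) (c u)" if "w \<in> D" "v \<le> w" "w \<le> u" for w
      using that na vu color_adj_irrefl by (metis order_le_less)
    then show ?thesis by (auto simp: interval_def color_nbrs_def)
  qed
  ultimately show "excitation P c D D'"
    unfolding excitation_def using u v vu D' by blast
qed

lemma excited_diagrams_eq:
  assumes F: "F \<subseteq> P"
  shows "excited_diagrams P c F = excited c P F"
proof
  show "excited_diagrams P c F \<subseteq> excited c P F"
  proof
    fix D assume "D \<in> excited_diagrams P c F"
    then have "(excitation P c)\<^sup>*\<^sup>* F D" by (simp add: excited_diagrams_def)
    then show "D \<in> excited c P F"
    proof (induction rule: rtranclp_induct)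
      case (step D D')
      then show ?case
        using excited_step excitation_iff_excite excited_subset[OF _ F] by metis
    qed (rule excited_self)
  qed
  show "excited c P F \<subseteq> excited_diagrams P c F"
  proof
    fix D assume "D \<in> excited c P F"
    then show "D \<in> excited_diagrams P c F"
    proof (induction rule: excited_induct)
      case (step D D')
      then have "excitation P c D D'"
        using excitation_iff_excite excited_subset[OF _ F] by metis
      then show ?case
        using step.IH unfolding excited_diagrams_def by (simp add: rtranclp.rtrancl_into_rtrancl)
    qed (simp add: excited_diagrams_def)
  qed
qed

section \<open>Hook rules for inversions\<close>

lemma no_lower_color:
  assumes u: "u \<in> P" "\<not> dk_top P u" and w: "w \<in> P" "w < u"
  shows "c w \<noteq> c u"
proof
  assume "c w = c u"
  then obtain m where m: "m \<in> P" "m < u \<and> c m = c u" "\<And>r. r \<in> P \<Longrightarrow> r < u \<and> c r = c u \<Longrightarrow> \<not> m < r"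
    using ex_maximal_such[OF fin w(1), of "\<lambda>r. r < u \<and> c r = c u"] w by blast
  then have "\<exists>k. dk_interval P k m u"
    by (intro consecutive_dk_interval) (use u in auto)
  then show False using u by (auto simp: dk_top_def)
qed

lemma root_dk_sides:
  fixes a :: "'i \<Rightarrow> 'r::comm_ring_1"
  assumes s: "dk_sides P v u x y"
  shows "inv_root c P a u = inv_root c P a x + inv_root c P a y - inv_root c P a v"
proof -
  obtain k where k: "dk_interval P k v u" and x: "x \<in> interval P v u" and y: "y \<in> interval P v u"
    and inc: "\<not> x \<le> y" "\<not> y \<le> x"
    using s by (auto simp: dk_sides_def)
  note b = dk_sides_below[OF s]
  have "v \<le> x" "v \<le> y" using x y by (auto simp: interval_def)
  then have "v < x" "v < y" using inc by (auto simp: order_le_less)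
  then show ?thesis
    by (intro root_top[OF heap_d_complete b(4) b(5) b(6) b(7) _ _ b(1) dk_colors[OF k]
          dk_interval_inner_color[OF k] side_color[OF k x y inc] side_color[OF k y x inc(2,1)]
          sum_dk_interval[OF k x y inc]])
qed

end

section \<open>Linear extensions\<close>

lemma linear_extensions_snoc:
  assumes S: "S \<noteq> {}"
  shows "linear_extensions S = (\<Union>p\<in>maximals S. (\<lambda>qs. qs @ [p]) ` linear_extensions (S - {p}))"
proof (intro equalityI subsetI)
  fix qs assume "qs \<in> linear_extensions S"
  then have qs: "set qs = S" "distinct qs"
    and ord: "\<And>i j. i < length qs \<Longrightarrow> j < length qs \<Longrightarrow> qs ! i < qs ! j \<Longrightarrow> i < j"
    by (auto simp: linear_extensions_def)
  then obtain ys p where ys: "qs = ys @ [p]" using S by (cases qs rule: rev_cases) auto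
  have "\<not> p < z" if z: "z \<in> S" for z
  proof
    assume pz: "p < z"
    obtain j where j: "j < length qs" "qs ! j = z" using z qs by (metis in_set_conv_nth)
    have "length ys < j" using ord[of "length ys" j] j pz ys by simp
    then show False using j ys by simp
  qed
  then have p: "p \<in> maximals S" using qs ys by (auto simp: maximals_iff)
  have "i < j" if "i < length ys" "j < length ys" "ys ! i < ys ! j" for i j
    using ord[of i j] that ys by (simp add: nth_append)
  then have "ys \<in> linear_extensions (S - {p})"
    using qs ys by (auto simp: linear_extensions_def)
  then show "qs \<in> (\<Union>p\<in>maximals S. (\<lambda>qs. qs @ [p]) ` linear_extensions (S - {p}))"
    using p ys by blast
next
  fix qs assume "qs \<in> (\<Union>p\<in>maximals S. (\<lambda>qs. qs @ [p]) ` linear_extensions (S - {p}))"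
  then obtain p ys where p: "p \<in> maximals S" and ys: "ys \<in> linear_extensions (S - {p})" "qs = ys @ [p]"
    by blast
  have set: "set ys = S - {p}" "distinct ys" and pS: "p \<in> S" "\<And>z. z \<in> S \<Longrightarrow> \<not> p < z"
    and ord: "\<And>i j. i < length ys \<Longrightarrow> j < length ys \<Longrightarrow> ys ! i < ys ! j \<Longrightarrow> i < j"
    using p ys by (auto simp: linear_extensions_def maximals_iff)
  have setq: "set qs = S" using set ys(2) pS(1) by auto
  have "i < j" if ij: "i < length qs" "j < length qs" "qs ! i < qs ! j" for i j
  proof (cases "i < length ys")
    case True
    then show ?thesis using ij ys ord[of i j] by (cases "j < length ys") (auto simp: nth_append)
  next
    case False
    then have "qs ! i = p" using ij ys by (simp add: nth_append less_Suc_eq)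
    moreover have "qs ! j \<in> S" using nth_mem[OF ij(2)] unfolding setq .
    ultimately show ?thesis using ij(3) pS(2) by blast
  qed
  then show "qs \<in> linear_extensions S"
    using set ys(2) setq by (auto simp: linear_extensions_def)
qed

lemma linear_extensions_empty: "linear_extensions {} = {[]}"
  by (auto simp: linear_extensions_def)

lemma finite_linear_extensions: "finite S \<Longrightarrow> finite (linear_extensions S)"
  by (rule finite_subset[OF _ finite_lists_length_eq[of S "card S"]])
    (auto simp: linear_extensions_def distinct_card)

definition extension_sum :: "('a::order \<Rightarrow> 'k::field) \<Rightarrow> 'a set \<Rightarrow> 'k" where
  "extension_sum b S = (\<Sum>qs\<in>linear_extensions S. \<Prod>m=1..card S. 1 / (\<Sum>l<m. b (qs ! l)))"

lemma extension_sum_recursion: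
  fixes b :: "'a::order \<Rightarrow> 'k::field"
  assumes S: "finite S" "S \<noteq> {}" and nz: "(\<Sum>p\<in>S. b p) \<noteq> 0"
  shows "(\<Sum>p\<in>S. b p) * extension_sum b S = (\<Sum>p\<in>maximals S. extension_sum b (S - {p}))"
proof -
  let ?w = "\<lambda>n qs. \<Prod>m=1..n. 1 / (\<Sum>l<m. b (qs ! l))"
  let ?s = "\<Sum>p\<in>S. b p"
  have step: "?w (card S) (ys @ [p]) = ?w (card (S - {p})) ys / ?s"
    if p: "p \<in> S" and ys: "ys \<in> linear_extensions (S - {p})" for p ys
  proof -
    have set: "set ys = S - {p}" "distinct ys" using ys by (auto simp: linear_extensions_def)
    then have len: "length ys = card (S - {p})" using distinct_card by metis
    then have card: "card S = Suc (length ys)" using p S by (metis card.remove)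
    \<comment> \<open>Whatever the order of the list, its last partial sum runs over all of
      \<open>S\<close>.\<close>
    have bij: "bij_betw ((!) (ys @ [p])) {..<Suc (length ys)} S"
      by (rule bij_betw_nth) (use set p in auto)
    have "(\<Sum>l<Suc (length ys). b ((ys @ [p]) ! l)) = ?s"
      by (rule sum.reindex_bij_betw[OF bij])
    moreover have "?w (length ys) (ys @ [p]) = ?w (length ys) ys"
      by (intro prod.cong refl arg_cong[of _ _ "\<lambda>x. 1 / x"] sum.cong) (auto simp: nth_append)
    moreover have "?w (Suc (length ys)) (ys @ [p]) =
        ?w (length ys) (ys @ [p]) * (1 / (\<Sum>l<Suc (length ys). b ((ys @ [p]) ! l)))"
      by (subst prod.nat_ivl_Suc') (simp_all only: mult.commute le_add1 One_nat_def Suc_le_mono le0)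
    ultimately show ?thesis unfolding card len[symmetric] by simp
  qed
  have fin: "finite (maximals S)" using S by (simp add: maximals_def)
  have "extension_sum b S = (\<Sum>p\<in>maximals S. \<Sum>qs\<in>(\<lambda>qs. qs @ [p]) ` linear_extensions (S - {p}). ?w (card S) qs)"
    unfolding extension_sum_def linear_extensions_snoc[OF S(2)]
  proof (rule sum.UNION_disjoint[OF fin])
    show "\<forall>p\<in>maximals S. finite ((\<lambda>qs. qs @ [p]) ` linear_extensions (S - {p}))"
      using S(1) by (auto intro!: finite_imageI finite_linear_extensions)
  qed auto
  also have "\<dots> = (\<Sum>p\<in>maximals S. extension_sum b (S - {p}) / ?s)"
  proof (rule sum.cong[OF refl])
    fix p assume p: "p \<in> maximals S"
    have "(\<Sum>qs\<in>(\<lambda>qs. qs @ [p]) ` linear_extensions (S - {p}). ?w (card S) qs) =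
        (\<Sum>qs\<in>linear_extensions (S - {p}). ?w (card S) (qs @ [p]))"
      by (subst sum.reindex) (auto simp: inj_on_def)
    also have "\<dots> = extension_sum b (S - {p}) / ?s"
      unfolding extension_sum_def sum_divide_distrib
      by (intro sum.cong refl step) (use p in \<open>auto simp: maximals_def\<close>)
    finally show "(\<Sum>qs\<in>(\<lambda>qs. qs @ [p]) ` linear_extensions (S - {p}). ?w (card S) qs) =
        extension_sum b (S - {p}) / ?s" .
  qed
  finally show ?thesis using nz by (simp add: sum_divide_distrib[symmetric])
qed

section \<open>The skew hook formula\<close>

context simply_laced
begin

lemma extension_sum_excited:
  fixes a :: "'i \<Rightarrow> 'k::field"
  assumes h: "heap c P" and nz: "\<And>u. u \<in> P \<Longrightarrow> inv_root c P a u \<noteq> 0"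
    and pos: "\<And>S. S \<subseteq> P \<Longrightarrow> S \<noteq> {} \<Longrightarrow> (\<Sum>p\<in>S. a (c p)) \<noteq> 0"
  shows "order_filter P F \<Longrightarrow>
    extension_sum (\<lambda>p. a (c p)) (P - F) = (\<Sum>D\<in>excited c P F. \<Prod>v\<in>P - D. 1 / inv_root c P a v)"
proof (induction "card (P - F)" arbitrary: F rule: less_induct)
  case less
  note F = less.prems
  have fin: "finite P" using heap_finite[OF h] .
  \<comment> \<open>A product over \<open>P - D\<close> is the product over \<open>D\<close> divided
    by the product over \<open>P\<close>, which does not depend on \<open>D\<close>; so the
    recursion of \<open>xi\<close> carries over.\<close>
  have R: "(\<Sum>D\<in>excited c P G. \<Prod>v\<in>P - D. 1 / inv_root c P a v) = xi c P a G / (\<Prod>v\<in>P. inv_root c P a v)"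
    if G: "order_filter P G" for G
  proof -
    have "(\<Prod>v\<in>P - D. 1 / inv_root c P a v) = (\<Prod>v\<in>D. inv_root c P a v) / (\<Prod>v\<in>P. inv_root c P a v)"
      if "D \<in> excited c P G" for D
    proof -
      have D: "D \<subseteq> P" using excited_subset[OF that] G by (simp add: order_filter_def)
      have "(\<Prod>v\<in>P. inv_root c P a v) = (\<Prod>v\<in>P - D. inv_root c P a v) * (\<Prod>v\<in>D. inv_root c P a v)"
        by (rule prod.subset_diff[OF D fin])
      moreover have "(\<Prod>v\<in>D. inv_root c P a v) \<noteq> 0"
        using D fin finite_subset nz by (subst prod_zero_iff) auto
      ultimately show ?thesis by (simp add: prod_dividef)
    qed
    then show ?thesis unfolding xi_def sum_divide_distrib by simp
  qed
  show ?case
  proof (cases "P - F = {}")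
    case True
    then have "F = P" using F by (auto simp: order_filter_def)
    then show ?thesis by (simp add: extension_sum_def linear_extensions_empty excited_whole)
  next
    case False
    let ?s = "\<Sum>p\<in>P - F. a (c p)"
    have s: "?s \<noteq> 0" by (rule pos[OF _ False]) simp
    have "?s * extension_sum (\<lambda>p. a (c p)) (P - F) =
        (\<Sum>q\<in>maximals (P - F). extension_sum (\<lambda>p. a (c p)) (P - F - {q}))"
      by (rule extension_sum_recursion) (use fin False s in auto)
    also have "\<dots> = (\<Sum>q\<in>maximals (P - F). xi c P a (insert q F) / (\<Prod>v\<in>P. inv_root c P a v))"
    proof (rule sum.cong[OF refl])
      fix q assume q: "q \<in> maximals (P - F)"
      have qF: "order_filter P (insert q F)" by (rule order_filter_insert_maximal[OF F q])
      have "q \<in> P - F" using q by (simp add: maximals_def)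
      then have "card (P - insert q F) < card (P - F)" using fin by (intro psubset_card_mono) auto
      then have "extension_sum (\<lambda>p. a (c p)) (P - insert q F) =
          xi c P a (insert q F) / (\<Prod>v\<in>P. inv_root c P a v)"
        using less.hyps[OF _ qF] R[OF qF] by simp
      moreover have "P - insert q F = P - F - {q}" by auto
      ultimately show "extension_sum (\<lambda>p. a (c p)) (P - F - {q}) =
          xi c P a (insert q F) / (\<Prod>v\<in>P. inv_root c P a v)" by simp
    qed
    also have "\<dots> = ?s * (xi c P a F / (\<Prod>v\<in>P. inv_root c P a v))"
      using chevalley[OF h F, of a] by (simp add: sum_divide_distrib[symmetric])
    finally show ?thesis unfolding R[OF F] mult_left_cancel[OF s] .
  qed
qed

end

section \<open>Generic simple roots\<close>

lemma to_ratfun_add: "to_ratfun (p + q) = to_ratfun p + to_ratfun q"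
  by (simp add: to_ratfun_def)

lemma to_ratfun_diff: "to_ratfun (p - q) = to_ratfun p - to_ratfun q"
  by (simp add: to_ratfun_def)

lemma to_ratfun_mult: "to_ratfun (p * q) = to_ratfun p * to_ratfun q"
  by (simp add: to_ratfun_def)

lemma to_ratfun_sum: "to_ratfun (\<Sum>x\<in>S. f x) = (\<Sum>x\<in>S. to_ratfun (f x))"
proof (induction S rule: infinite_finite_induct)
  case (insert x S)
  then show ?case by (simp add: to_ratfun_add)
qed (simp_all add: to_ratfun_def Zero_fract_def)

lemma to_ratfun_of_int: "to_ratfun (of_int n) = of_int n"
proof -
  have nat: "to_ratfun (of_nat m) = of_nat m" for m
    unfolding to_ratfun_def by (rule Fract_of_nat_eq)
  obtain k m where n: "n = int k - int m" using int_diff_cases by blast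
  show ?thesis unfolding n of_int_diff of_int_of_nat_eq to_ratfun_diff nat ..
qed

lemma to_ratfun_eq_0: "to_ratfun p = 0 \<longleftrightarrow> p = 0"
  unfolding to_ratfun_def Zero_fract_def by (subst eq_fract(1)) simp_all

text \<open>Reading off the coefficient of one degree-one monomial isolates one coefficient of an
  integral combination of indeterminates.\<close>

lemma lookup_of_int_indet:
  "Poly_Mapping.lookup (of_int n * indet i) (Poly_Mapping.single j 1) = (if i = j then of_int n else 0)"
proof -
  have "of_int n * indet i = Poly_Mapping.single (Poly_Mapping.single i 1) (of_int n)"
    unfolding indet_def single_of_int[symmetric] mult_single by simp
  moreover have "i = j" if "Poly_Mapping.single i (1::nat) = Poly_Mapping.single j 1"
    using arg_cong[OF that, of Poly_Mapping.keys] by simp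
  ultimately show ?thesis by (auto simp: lookup_single when_def)
qed

lemma int_combination_indet_nonzero:
  fixes n :: "'i::linorder \<Rightarrow> int"
  assumes S: "finite S" and 0: "(\<Sum>i\<in>S. of_int (n i) * to_ratfun (indet i)) = 0" and j: "j \<in> S"
  shows "n j = 0"
proof -
  have "to_ratfun (\<Sum>i\<in>S. of_int (n i) * indet i) = 0"
    using 0 by (simp add: to_ratfun_sum to_ratfun_mult to_ratfun_of_int)
  then have "(\<Sum>i\<in>S. of_int (n i) * indet i) = 0" by (simp add: to_ratfun_eq_0)
  then have "Poly_Mapping.lookup (\<Sum>i\<in>S. of_int (n i) * indet i) (Poly_Mapping.single j 1) = 0"
    by simp
  then have "(\<Sum>i\<in>S. if i = j then of_int (n i) else 0 :: rat) = 0"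
    by (simp only: lookup_sum lookup_of_int_indet)
  then show ?thesis using S j by simp
qed

text \<open>Grouped by color, the coefficients are positive numbers of elements, so equal colors
  cannot cancel.\<close>

lemma sum_indet_nonzero:
  fixes c :: "'a \<Rightarrow> 'i::linorder"
  assumes S: "finite S" "S \<noteq> {}"
  shows "(\<Sum>p\<in>S. to_ratfun (indet (c p))) \<noteq> 0"
proof
  assume 0: "(\<Sum>p\<in>S. to_ratfun (indet (c p))) = 0"
  obtain p where p: "p \<in> S" using S by blast
  let ?n = "\<lambda>i. int (card {q \<in> S. c q = i})"
  have "(\<Sum>p\<in>S. to_ratfun (indet (c p))) = (\<Sum>i\<in>c ` S. \<Sum>q\<in>{q \<in> S. c q = i}. to_ratfun (indet (c q)))"
    using S(1) by (rule sum.image_gen)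
  also have "\<dots> = (\<Sum>i\<in>c ` S. of_int (?n i) * to_ratfun (indet i))"
    by (intro sum.cong) auto
  finally have "?n (c p) = 0"
    using int_combination_indet_nonzero[of "c ` S" ?n "c p"] 0 S p by simp
  then have "{q \<in> S. c q = c p} = {}" using S by simp
  then show False using p by blast
qed

theorem corollary5p4:
  fixes P F :: "'a::order set"
    and I :: "'i::linorder set"
    and c :: "'a \<Rightarrow> 'i"
  assumes "finite P" and "d_complete P"
    and "d_coloring P I c"
    and "order_filter P F"
  shows "(\<Sum>qs\<in>linear_extensions (P - F).
            \<Prod>m=1..card (P - F). 1 / (\<Sum>l<m. to_ratfun (indet (c (qs ! l)))))
       = (\<Sum>D\<in>excited_diagrams P c F. \<Prod>v\<in>P - D. 1 / to_ratfun (hook_poly P c v))"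
proof -
  interpret colored_d_complete P I c
    by (rule colored_d_complete.intro) (fact assms)+
  define a where "a i = to_ratfun (indet i)" for i :: 'i
  \<comment> \<open>Inversions obey both rules of the hook polynomials:
    \<open>no_lower_color\<close> makes \<open>root_hook\<close> available for elements that are not
    tops, and \<open>root_dk_sides\<close> is the rule for tops.\<close>
  have hook: "to_ratfun (hook_poly P c u) = inv_root c P a u" if "u \<in> P" for u
    using that
  proof (induction "card {z \<in> P. z < u}" arbitrary: u rule: less_induct)
    case less
    show ?case
    proof (cases "dk_top P u")
      case False
      have "inv_root c P a u = (\<Sum>w\<in>{w \<in> P. w \<le> u}. a (c w))"
        by (rule root_hook[OF heap_d_complete less.prems no_lower_color[OF less.prems False]])
      then show ?thesis
        using hook_poly_not_top[OF fin dc less.prems False, of c] by (simp add: to_ratfun_sum a_def)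
    next
      case True
      then obtain v x y where s: "dk_sides P v u x y"
        unfolding dk_top_def using dk_interval_sides_exist by blast
      have IH: "to_ratfun (hook_poly P c w) = inv_root c P a w" if w: "w \<in> P" "w < u" for w
      proof (rule less.hyps[OF _ w(1)])
        show "card {z \<in> P. z < w} < card {z \<in> P. z < u}"
          using w fin by (intro psubset_card_mono) auto
      qed
      note b = dk_sides_below[OF s]
      show ?thesis
        unfolding hook_poly_top[OF fin dc s] to_ratfun_add to_ratfun_diff
          IH[OF b(4,1)] IH[OF b(6,2)] IH[OF b(7,3)] root_dk_sides[OF s] ..
    qed
  qed
  have "int_independent (c ` P) a"
    unfolding int_independent_def a_def
    using int_combination_indet_nonzero[of "c ` P"] fin by blast
  then have nz: "inv_root c P a u \<noteq> 0" if "u \<in> P" for u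
    using root_nonzero[OF heap_d_complete that, of "c ` P"] fin by simp
  have pos: "(\<Sum>p\<in>S. a (c p)) \<noteq> 0" if "S \<subseteq> P" "S \<noteq> {}" for S
    unfolding a_def using sum_indet_nonzero[OF finite_subset[OF that(1) fin] that(2)] .
  have FP: "F \<subseteq> P" using assms(4) by (simp add: order_filter_def)
  have "extension_sum (\<lambda>p. a (c p)) (P - F) =
      (\<Sum>D\<in>excited_diagrams P c F. \<Prod>v\<in>P - D. 1 / inv_root c P a v)"
    unfolding excited_diagrams_eq[OF FP]
    by (rule extension_sum_excited[OF heap_d_complete nz pos assms(4)])
  also have "\<dots> = (\<Sum>D\<in>excited_diagrams P c F. \<Prod>v\<in>P - D. 1 / to_ratfun (hook_poly P c v))"
    using hook by (intro sum.cong prod.cong) auto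
  finally show ?thesis unfolding extension_sum_def a_def .
qed

end
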